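(* Let $\mathcal{A}$ be a unital complex algebra, $\psi:\mathcal{A}\to\mathbb{C}$ a unital linear functional and $\omega:\mathcal{A}\to\mathbb{C}$ a tracial (possibly non-unital) linear functional. Unital subalgebras $(\mathcal{A}_i)_{i\in I}$ of $\mathcal{A}$ are cyclically free relatively to $(\psi,\omega)$ if and only if all mixed free cumulants $\kappa^\psi_n$ and all mixed cyclic free cumulants $D\kappa^{\psi,\omega}_n$ vanish.
   Context: Cyclic freeness: unital subalgebras $(\mathcal{A}_i)$ are cyclically free relatively to $(\psi,\omega)$ if they are free with respect to $\psi$ and $\omega(a_1\cdots a_n)=0$ for all $n\ge2$ and $a_k\in\mathcal{A}_{j_k}$ with $\psi(a_k)=0$ for all $k$, $j_k\ne j_{k+1}$ for $1\le k\le n-1$, and $j_n\ne j_1$. Boolean cumulants $\beta^\psi$: $\psi(a_1\cdots a_n)=\sum_{I}\prod_{\{i,\ldots,j\}\in I}\beta^\psi(a_i,\ldots,a_j)$, sum over interval partitions $I$ of $[n]=\{1,\ldots,n\}$. Define $$[\psi](a_1,\ldots,a_n)=\sum_{\ell=1}^n\sum_{1\le i_1<\cdots<i_\ell\le n}\prod_{k=1}^{\ell}\beta^\psi(a_{i_k},\ldots,a_{i_{k+1}-1}),$$ with $i_{\ell+1}=i_1$ and indices read cyclically modulo $n$ (the last factor is $\beta^\psi(a_{i_\ell},\ldots,a_n,a_1,\ldots,a_{i_1-1})$). Free cumulants $\kappa^\psi_n$: $\psi(a_1\cdots a_n)=\sum_{\pi\in NC(n)}\prod_{V\in\pi}\kappa^\psi_{|V|}(a_V)$,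 where $NC(n)$ is the set of non-crossing partitions of $[n]$ and $a_V$ lists $(a_v)_{v\in V}$ in increasing order. Cyclic free cumulants $D\kappa^{\psi,\omega}_n:\mathcal{A}^{\otimes n}\to\mathbb{C}$ with respect to $(\psi,\omega)$ are defined recursively by $$\omega(a_1\cdots a_n)=\omega(1_{\mathcal{A}})[\psi](a_1,\ldots,a_n)+\sum_{\pi\in NC(n)}[\kappa^\psi,D\kappa^{\psi,\omega}]_\pi(a_1,\ldots,a_n),\quad a_1,\ldots,a_n\in\mathcal{A},$$ where for $f=(f_n)$ and a sequence $Df=(Df_n)$ of cyclically invariant functionals, $[f,Df]_\pi(a_1,\ldots,a_n)=\sum_{V\in\pi}Df_{|V|}(a_V)\prod_{W\in\pi,W\ne V}f_{|W|}(a_{(W,\prec_V)})$. Here $a_{(W,\prec_V)}$ lists $(a_w)_{w\in W}$ as follows: arrange $1,\ldots,n$ clockwise on a circle; $W$ lies in one arc between two cyclically consecutive elements of $V$ (the whole circle minus $V$ if $|V|=1$), and $W$ is listed in the order met when traversing this arc clockwise. A cumulant is mixed if its arguments $a_k\in\mathcal{A}_{j_k}$ come from at least two distinct algebras (the $j_k$ are not all equal). *)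

theory Defs
  imports Complex_Main "HOL-Library.Disjoint_Sets"
begin

section \<open>Unital complex algebras\<close>

text \<open>The class \<^class>\<open>ring_1\<close> excludes only the zero ring, on which no unital functional exists.\<close>

locale unital_complex_algebra = vector_space scale
  for scale :: "complex \<Rightarrow> 'a::ring_1 \<Rightarrow> 'a" (infixr "*s" 75) +
  assumes scale_mult_left: "(c *s x) * y = c *s (x * y)"
    and scale_mult_right: "x * (c *s y) = c *s (x * y)"

definition linear_functional :: "(complex \<Rightarrow> 'a::ring_1 \<Rightarrow> 'a) \<Rightarrow> ('a \<Rightarrow> complex) \<Rightarrow> bool" where
  "linear_functional scale \<phi> \<longleftrightarrow> Vector_Spaces.linear scale (*) \<phi>"

definition tracial :: "('a::ring_1 \<Rightarrow> complex) \<Rightarrow> bool" where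
  "tracial \<phi> \<longleftrightarrow> (\<forall>a b. \<phi> (a * b) = \<phi> (b * a))"

definition unital_subalgebra :: "(complex \<Rightarrow> 'a::ring_1 \<Rightarrow> 'a) \<Rightarrow> 'a set \<Rightarrow> bool" where
  "unital_subalgebra scale B \<longleftrightarrow>
     module.subspace scale B \<and> 1 \<in> B \<and> (\<forall>a\<in>B. \<forall>b\<in>B. a * b \<in> B)"

section \<open>Freeness and cyclic freeness\<close>

text \<open>A list \<open>js\<close> of indices in \<open>I\<close> records, for each argument, an algebra which contains it.\<close>

definition arguments_from :: "'i set \<Rightarrow> ('i \<Rightarrow> 'a set) \<Rightarrow> 'i list \<Rightarrow> 'a list \<Rightarrow> bool" where
  "arguments_from I A js as \<longleftrightarrow> list_all2 (\<lambda>j a. j \<in> I \<and> a \<in> A j) js as"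

definition free_subalgebras ::
    "('a::ring_1 \<Rightarrow> complex) \<Rightarrow> 'i set \<Rightarrow> ('i \<Rightarrow> 'a set) \<Rightarrow> bool" where
  "free_subalgebras \<psi> I A \<longleftrightarrow>
     (\<forall>js as. as \<noteq> [] \<and> arguments_from I A js as \<and> (\<forall>a\<in>set as. \<psi> a = 0) \<and> distinct_adj js
        \<longrightarrow> \<psi> (prod_list as) = 0)"

definition cyclically_free ::
    "('a::ring_1 \<Rightarrow> complex) \<Rightarrow> ('a \<Rightarrow> complex) \<Rightarrow> 'i set \<Rightarrow> ('i \<Rightarrow> 'a set) \<Rightarrow> bool" where
  "cyclically_free \<psi> \<omega> I A \<longleftrightarrow> free_subalgebras \<psi> I A \<and>
     (\<forall>js as. length as \<ge> 2 \<and> arguments_from I A js as \<and> (\<forall>a\<in>set as. \<psi> a = 0) \<and>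
        distinct_adj js \<and> last js \<noteq> hd js \<longrightarrow> \<omega> (prod_list as) = 0)"

section \<open>Non-crossing and interval partitions\<close>

text \<open>
  Positions are numbered \<open>0, \<dots>, n - 1\<close>. An \<open>n\<close>-linear functional is applied to
  the list of its arguments, so a sequence of functionals is a function on lists, and the list
  \<open>a\<^sub>V\<close> of the arguments at positions in \<open>V\<close>, in increasing order, is
  \<open>nths as V\<close>. Values at the empty list are irrelevant.
\<close>

definition noncrossing :: "nat set set \<Rightarrow> bool" where
  "noncrossing \<pi> \<longleftrightarrow>
     (\<forall>V\<in>\<pi>. \<forall>W\<in>\<pi>. V \<noteq> W \<longrightarrow>
        \<not> (\<exists>a b c d. a < b \<and> b < c \<and> c < d \<and> a \<in> V \<and> c \<in> V \<and> b \<in> W \<and> d \<in> W))"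

definition NC :: "nat \<Rightarrow> nat set set set" where
  "NC n = {\<pi>. partition_on {..<n} \<pi> \<and> noncrossing \<pi>}"

definition interval_partitions :: "nat \<Rightarrow> nat set set set" where
  "interval_partitions n = {\<pi>. partition_on {..<n} \<pi> \<and> (\<forall>V\<in>\<pi>. \<exists>i j. V = {i..j})}"

lemma finite_partitions: "finite {\<pi>. partition_on {..<n::nat} \<pi>}"
  by (rule finitely_many_partition_on) simp

lemma finite_NC: "finite (NC n)"
  unfolding NC_def by (rule finite_subset[OF _ finite_partitions[of n]]) auto

lemma finite_interval_partitions: "finite (interval_partitions n)"
  unfolding interval_partitions_def by (rule finite_subset[OF _ finite_partitions[of n]]) auto

lemma partition_on_full_block:
  assumes "partition_on S \<pi>" "S \<in> \<pi>"
  shows "\<pi> = {S}"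
proof -
  have "V = S" if "V \<in> \<pi>" for V
  proof (rule ccontr)
    assume "V \<noteq> S"
    with assms that have "V \<inter> S = {}" "V \<subseteq> S" "V \<noteq> {}"
      by (auto simp: partition_on_def disjoint_def)
    then show False by auto
  qed
  with assms show ?thesis by blast
qed

lemma full_partition_NC: "n > 0 \<Longrightarrow> {{..<n}} \<in> NC n"
  by (auto simp: NC_def noncrossing_def partition_on_def)

lemma full_partition_interval: "n > 0 \<Longrightarrow> {{..<n}} \<in> interval_partitions n"
proof -
  assume "n > 0"
  then have "{..<n} = {0..n - 1}" by auto
  then have "\<exists>i j. {..<n} = {i..j}" by blast
  with \<open>n > 0\<close> show ?thesis
    by (auto simp: interval_partitions_def partition_on_def)
qed

lemma length_nths_block:
  assumes "partition_on {..<length as} \<pi>" "\<pi> \<noteq> {{..<length as}}" "V \<in> \<pi>"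
  shows "length (nths as V) < length as"
proof -
  have "V \<subseteq> {..<length as}" using assms by (auto simp: partition_on_def)
  moreover have "V \<noteq> {..<length as}" using partition_on_full_block assms by metis
  ultimately have *: "V \<subset> {..<length as}" by auto
  then have "{i. i < length as \<and> i \<in> V} = V" by auto
  then show ?thesis using psubset_card_mono[OF _ *] by (simp add: length_nths)
qed

lemma nths_full: "nths as {..<length as} = as"
  by (rule nths_all) simp

section \<open>Cumulants\<close>

text \<open>
  The moment-cumulant formulas determine the cumulants recursively, as the one-block partition
  contributes exactly the cumulant of the full list. The functions below solve these formulas
  for that term; the formulas themselves are then proved as lemmas.
\<close>

function boolean_cumulant :: "('a::ring_1 \<Rightarrow> complex) \<Rightarrow> 'a list \<Rightarrow> complex" where
  "boolean_cumulant \<psi> as = \<psi> (prod_list as) -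
     (\<Sum>\<pi>\<in>interval_partitions (length as) - {{{..<length as}}}.
        \<Prod>V\<in>\<pi>. boolean_cumulant \<psi> (nths as V))"
  by pat_completeness auto
termination
  by (relation "measure (\<lambda>(\<psi>, as). length as)")
     (auto simp: interval_partitions_def intro!: length_nths_block)

function free_cumulant :: "('a::ring_1 \<Rightarrow> complex) \<Rightarrow> 'a list \<Rightarrow> complex" where
  "free_cumulant \<psi> as = \<psi> (prod_list as) -
     (\<Sum>\<pi>\<in>NC (length as) - {{{..<length as}}}. \<Prod>V\<in>\<pi>. free_cumulant \<psi> (nths as V))"
  by pat_completeness auto
termination
  by (relation "measure (\<lambda>(\<psi>, as). length as)")
     (auto simp: NC_def intro!: length_nths_block)

declare boolean_cumulant.simps [simp del] free_cumulant.simps [simp del]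

lemma boolean_moment_cumulant:
  assumes "as \<noteq> []"
  shows "\<psi> (prod_list as) =
    (\<Sum>\<pi>\<in>interval_partitions (length as). \<Prod>V\<in>\<pi>. boolean_cumulant \<psi> (nths as V))"
  using assms
  by (subst sum.remove[OF finite_interval_partitions full_partition_interval])
     (simp_all add: nths_full boolean_cumulant.simps[of \<psi> as])

lemma free_moment_cumulant:
  assumes "as \<noteq> []"
  shows "\<psi> (prod_list as) =
    (\<Sum>\<pi>\<in>NC (length as). \<Prod>V\<in>\<pi>. free_cumulant \<psi> (nths as V))"
  using assms
  by (subst sum.remove[OF finite_NC full_partition_NC])
     (simp_all add: nths_full free_cumulant.simps[of \<psi> as])

text \<open>
  With \<open>0, \<dots>, n - 1\<close> arranged clockwise on a circle and \<open>v \<in> V\<close>,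
  \<open>cyclic_arc n V v\<close> lists the positions met after \<open>v\<close> and before the next element of
  \<open>V\<close>; if \<open>V = {v}\<close>, it lists the whole circle except \<open>v\<close>.
\<close>

definition cyclic_arc :: "nat \<Rightarrow> nat set \<Rightarrow> nat \<Rightarrow> nat list" where
  "cyclic_arc n V v = takeWhile (\<lambda>i. i \<notin> V) (map (\<lambda>t. (v + t) mod n) [1..<n])"

text \<open>
  The cut points \<open>i\<^sub>1 < \<dots> < i\<^sub>l\<close>, \<open>l \<ge> 1\<close>, form a nonempty set
  \<open>S\<close> of positions.
\<close>

definition cyclic_boolean :: "('a::ring_1 \<Rightarrow> complex) \<Rightarrow> 'a list \<Rightarrow> complex" where
  "cyclic_boolean \<psi> as =
     (\<Sum>S\<in>Pow {..<length as} - {{}}.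
        \<Prod>i\<in>S. boolean_cumulant \<psi> (map ((!) as) (i # cyclic_arc (length as) S i)))"

text \<open>
  The positions in \<open>W\<close> in the order induced by \<open>V\<close>: \<open>W\<close> lies in the arc
  following a unique \<open>v \<in> V\<close>, whenever \<open>V\<close> and \<open>W\<close> are distinct blocks of
  a non-crossing partition.
\<close>

definition arc_order :: "nat \<Rightarrow> nat set \<Rightarrow> nat set \<Rightarrow> nat list" where
  "arc_order n V W =
     filter (\<lambda>w. w \<in> W) (cyclic_arc n V (THE v. v \<in> V \<and> W \<subseteq> set (cyclic_arc n V v)))"

definition cyclic_block_sum ::
    "('a list \<Rightarrow> complex) \<Rightarrow> ('a list \<Rightarrow> complex) \<Rightarrow> nat set set \<Rightarrow> 'a list \<Rightarrow> complex" where
  "cyclic_block_sum f Df \<pi> as =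
     (\<Sum>V\<in>\<pi>. Df (nths as V) * (\<Prod>W\<in>\<pi> - {V}. f (map ((!) as) (arc_order (length as) V W))))"

lemma cyclic_block_sum_cong [fundef_cong]:
  assumes "f = f'" "\<pi> = \<pi>'" "as = as'"
    and "\<And>x. x \<in> nths as' ` \<pi>' \<Longrightarrow> Df x = Df' x"
  shows "cyclic_block_sum f Df \<pi> as = cyclic_block_sum f' Df' \<pi>' as'"
  unfolding cyclic_block_sum_def using assms by (auto intro!: sum.cong)

function cyclic_free_cumulant ::
    "('a::ring_1 \<Rightarrow> complex) \<Rightarrow> ('a \<Rightarrow> complex) \<Rightarrow> 'a list \<Rightarrow> complex" where
  "cyclic_free_cumulant \<psi> \<omega> as = \<omega> (prod_list as) - \<omega> 1 * cyclic_boolean \<psi> as -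
     (\<Sum>\<pi>\<in>NC (length as) - {{{..<length as}}}.
        cyclic_block_sum (free_cumulant \<psi>) (\<lambda>bs. cyclic_free_cumulant \<psi> \<omega> bs) \<pi> as)"
  by pat_completeness auto
termination
  by (relation "measure (\<lambda>(\<psi>, \<omega>, as). length as)")
     (auto simp: NC_def intro!: length_nths_block)

declare cyclic_free_cumulant.simps [simp del]

lemma cyclic_moment_cumulant:
  assumes "as \<noteq> []"
  shows "\<omega> (prod_list as) = \<omega> 1 * cyclic_boolean \<psi> as +
    (\<Sum>\<pi>\<in>NC (length as).
       cyclic_block_sum (free_cumulant \<psi>) (cyclic_free_cumulant \<psi> \<omega>) \<pi> as)"
proof -
  have "cyclic_block_sum (free_cumulant \<psi>) (cyclic_free_cumulant \<psi> \<omega>) {{..<length as}} as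
      = cyclic_free_cumulant \<psi> \<omega> as"
    by (simp add: cyclic_block_sum_def nths_full)
  then show ?thesis
    using assms
    by (subst sum.remove[OF finite_NC full_partition_NC])
       (simp_all add: cyclic_free_cumulant.simps[of \<psi> \<omega> as])
qed

definition mixed_cumulants_vanish ::
    "('a list \<Rightarrow> complex) \<Rightarrow> 'i set \<Rightarrow> ('i \<Rightarrow> 'a set) \<Rightarrow> bool" where
  "mixed_cumulants_vanish c I A \<longleftrightarrow>
     (\<forall>js as. arguments_from I A js as \<and> (\<exists>j\<in>set js. \<exists>j'\<in>set js. j \<noteq> j') \<longrightarrow> c as = 0)"

end

theory Submission
  imports Defs "HOL-Library.FuncSet"
begin

text \<open>
  Fix a block \<open>V\<close> of a non-crossing partition of positions on a circle. The other blocks lie in the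
  arcs cut out by \<open>V\<close>, and summing over them turns every arc into a moment of \<open>\<psi>\<close>. So both
  moment-cumulant formulas become triangular systems indexed by sets of positions,
  \<open>\<psi>(S) = \<Sum>\<^bsub>p \<in> V \<subseteq> S\<^esub> \<kappa>(V) \<Prod>\<^bsub>v\<in>V\<^esub> \<psi>(arc v)\<close> for any fixed position \<open>p\<close>, and
  \<open>\<omega>(S) = \<omega>(1)[\<psi>](S) + \<Sum>\<^bsub>V \<noteq> {}\<^esub> D\<kappa>(V) \<Prod>\<^bsub>v\<in>V\<^esub> \<psi>(arc v)\<close>.

  For centred arguments from alternating algebras, each proper \<open>V\<close> leaves a nonempty arc, whose
  moment vanishes by freeness; thus \<open>\<psi>(S) = \<kappa>(S)\<close> and \<open>\<omega>(S) = D\<kappa>(S)\<close>, which relates the two sides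
  of the equivalence. From cyclic freeness to cumulants there remain the arguments that are not of
  this kind. They can be centred by multilinearity, since cumulants with an entry \<open>1\<close> vanish, and
  two neighbours from the same algebra can be multiplied: comparing the triangular systems before
  and after the multiplication expresses, for instance, \<open>D\<kappa>(a\<^sub>2, \<dots>, a\<^sub>n a\<^sub>1)\<close> as the sum of
  \<open>D\<kappa>(a\<^sub>1, \<dots>, a\<^sub>n)\<close>, of products \<open>D\<kappa> \<cdot> \<kappa>\<close> of lower order, and of
  \<open>\<omega>(1) \<kappa>(a\<^sub>1, \<dots>, a\<^sub>n)\<close>. All terms but the first contain a mixed cumulant that vanishes by
  induction.
\<close>

section \<open>The cyclic order\<close>

text \<open>The obstacle is that \<open>\<psi>\<close> need not be tracial: in the formula for
  \<open>\<omega>\<close> the arcs of a block are read clockwise, whereas \<open>kappa\<close> reads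
  its arguments in increasing order. The two readings agree for blocks that contain the first or the
  last position. So when the last argument is multiplied into the first, only such blocks have to be
  refined; blocks that avoid both ends contribute the same before and after, and cancel. This is the
  only product formula proved for \<open>Dkappa\<close>: since \<open>\<omega>\<close> is tracial,
  \<open>Dkappa\<close> is cyclically invariant, and any two cyclic neighbours can be rotated to the
  ends.

  The term \<open>\<omega>(1) \<kappa>\<close> has the following origin. Multiplying across the ends
  removes from \<open>[\<psi>]\<close> precisely the Boolean cumulant of the whole list. That
  cumulant is the sum over the non-crossing partitions with the first and the last position in one
  block. Written as a sum over this block, it has the same arc weights as the triangular systems, so
  its top coefficient is \<open>\<kappa>\<close> of the whole list.\<close>

abbreviation slist :: "nat set \<Rightarrow> nat list" where
  "slist \<equiv> sorted_list_of_set"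

text \<open>Clockwise order of three distinct positions. Cycling the triple does not change it, so
  statements made with \<open>cyc\<close> do not depend on where the circle is cut open.\<close>

definition cyc :: "nat \<Rightarrow> nat \<Rightarrow> nat \<Rightarrow> bool" where
  "cyc x y z \<longleftrightarrow> x < y \<and> y < z \<or> y < z \<and> z < x \<or> z < x \<and> x < y"

text \<open>For \<open>v \<in> V\<close>, the positions met after \<open>v\<close> and before the
  next element of \<open>V\<close>. The case \<open>u = v\<close> is void, as \<open>cyc\<close>
  forces distinct entries; thus \<open>V = {v}\<close> yields all of \<open>S - {v}\<close>. Arcs
  are sets, because moments read them in two different orders.\<close>

definition arc :: "nat set \<Rightarrow> nat set \<Rightarrow> nat \<Rightarrow> nat set" where
  "arc S V v = {x \<in> S - V. \<forall>u\<in>V. \<not> cyc v u x}"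

text \<open>The order in which a clockwise walk from \<open>v\<close> meets \<open>R\<close>. With
  \<open>v\<close> the element of \<open>V\<close> before the arc, this is the listing that the
  cyclic moment-cumulant formula prescribes for the blocks in that arc.\<close>

definition clist :: "nat \<Rightarrow> nat set \<Rightarrow> nat list" where
  "clist v R = slist {x \<in> R. v < x} @ slist {x \<in> R. x < v}"

text \<open>Covers renumberings as well as rotations. Injectivity is a separate requirement, since
  the condition on triples is void on sets with at most two elements.\<close>

definition cyc_preserving :: "(nat \<Rightarrow> nat) \<Rightarrow> nat set \<Rightarrow> bool" where
  "cyc_preserving g S \<longleftrightarrow>
     inj_on g S \<and> (\<forall>x\<in>S. \<forall>y\<in>S. \<forall>z\<in>S. cyc x y z \<longrightarrow> cyc (g x) (g y) (g z))"

lemma cyc_asym: "cyc v x y \<Longrightarrow> \<not> cyc v y x"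
  by (auto simp: cyc_def)

lemma cyc_total: "x \<noteq> y \<Longrightarrow> y \<noteq> z \<Longrightarrow> z \<noteq> x \<Longrightarrow> cyc x y z \<or> cyc x z y"
  by (auto simp: cyc_def)

lemma cyc_distinct: "cyc x y z \<Longrightarrow> x \<noteq> y \<and> y \<noteq> z \<and> z \<noteq> x"
  by (auto simp: cyc_def)

text \<open>Three distinct points have only two orientations, so a map that preserves orientation
  also reflects it.\<close>

lemma cyc_preserving_iff:
  assumes "cyc_preserving g S" "x \<in> S" "y \<in> S" "z \<in> S"
  shows "cyc (g x) (g y) (g z) \<longleftrightarrow> cyc x y z"
proof
  assume *: "cyc (g x) (g y) (g z)"
  show "cyc x y z"
  proof (rule ccontr)
    assume "\<not> cyc x y z"
    with cyc_distinct[OF *] have "cyc x z y"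
      using cyc_total[of x y z] by auto
    then have "cyc (g x) (g z) (g y)"
      using assms by (simp add: cyc_preserving_def)
    with * cyc_asym show False by blast
  qed
qed (use assms in \<open>simp add: cyc_preserving_def\<close>)

lemma cyc_preserving_strict_mono: "strict_mono_on S g \<Longrightarrow> cyc_preserving g S"
  unfolding cyc_preserving_def cyc_def
  by (auto intro: strict_mono_on_imp_inj_on dest: strict_mono_onD)

lemma arc_subset: "arc S V v \<subseteq> S - V"
  by (auto simp: arc_def)

lemma finite_arc [intro]: "finite S \<Longrightarrow> finite (arc S V v)"
  using finite_subset[OF arc_subset] by blast

lemma arc_full [simp]: "arc S S v = {}"
  by (auto simp: arc_def)

lemma arc_image:
  assumes g: "cyc_preserving g S" and V: "V \<subseteq> S" and v: "v \<in> S"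
  shows "arc (g ` S) (g ` V) (g v) = g ` arc S V v"
proof -
  have "g x \<in> g ` V \<longleftrightarrow> x \<in> V" if "x \<in> S" for x
    using that V g by (auto simp: cyc_preserving_def inj_on_def)
  moreover have "cyc (g v) (g u) (g x) \<longleftrightarrow> cyc v u x" if "x \<in> S" "u \<in> V" for x u
    using cyc_preserving_iff[OF g v] that V by blast
  ultimately show ?thesis
    by (auto simp: arc_def)
qed

text \<open>The heads must agree, since otherwise each would precede the other. For fixed
  \<open>v\<close> the relation \<open>cyc v\<close> is asymmetric, so clockwise lists are
  determined by their sets.\<close>

lemma sorted_wrt_unique:
  assumes "sorted_wrt r xs" "sorted_wrt r ys" "set xs = set ys" "\<And>x y. r x y \<Longrightarrow> \<not> r y x"
  shows "xs = ys"
  using assms(1-3)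
proof (induction xs arbitrary: ys)
  case (Cons x xs)
  then obtain y ys' where ys: "ys = y # ys'"
    by (cases ys) auto
  have irr: "x \<notin> set xs" "y \<notin> set ys'"
    using Cons.prems assms(4) ys by force+
  have "x = y"
  proof (rule ccontr)
    assume "x \<noteq> y"
    then have "y \<in> set xs" "x \<in> set ys'"
      using Cons.prems(3) ys by auto
    with Cons.prems(1,2) ys assms(4)[of x y] show False
      by auto
  qed
  moreover have "set xs = set ys'"
    using irr Cons.prems(3) \<open>x = y\<close> ys by (auto simp: set_eq_iff)
  ultimately show ?case
    using Cons ys by simp
qed simp

lemma sorted_wrt_cyc_slist:
  assumes "finite R" "\<And>x. x \<in> R \<Longrightarrow> v < x \<or> (\<forall>y\<in>R. y < v)"
  shows "sorted_wrt (cyc v) (slist R)"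
  by (rule sorted_wrt_mono_rel[of _ "(<)"]) (use assms in \<open>auto simp: cyc_def\<close>)

lemma sorted_wrt_clist:
  assumes "finite R"
  shows "sorted_wrt (cyc v) (clist v R)"
proof -
  have "sorted_wrt (cyc v) (slist {x \<in> R. v < x})" "sorted_wrt (cyc v) (slist {x \<in> R. x < v})"
    by (rule sorted_wrt_cyc_slist; use assms in auto)+
  then show ?thesis
    using assms by (auto simp: clist_def sorted_wrt_append cyc_def)
qed

lemma set_clist: "finite R \<Longrightarrow> v \<notin> R \<Longrightarrow> set (clist v R) = R"
  by (auto simp: clist_def) (metis linorder_neqE_nat)

lemma clist_eqI:
  assumes "sorted_wrt (cyc v) L" "set L = R" "finite R" "v \<notin> R"
  shows "L = clist v R"
  by (rule sorted_wrt_unique[OF assms(1) sorted_wrt_clist])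
     (use assms set_clist cyc_asym in auto)

lemma distinct_clist: "finite R \<Longrightarrow> distinct (clist v R)"
  by (auto simp: clist_def)

lemma slist_eqI: "sorted_wrt (<) L \<Longrightarrow> set L = R \<Longrightarrow> L = slist R"
  by (metis sorted_list_of_set.idem_if_sorted_distinct strict_sorted_iff)

lemma clist_greater: "finite R \<Longrightarrow> (\<And>x. x \<in> R \<Longrightarrow> v < x) \<Longrightarrow> clist v R = slist R"
proof -
  assume *: "finite R" "\<And>x. x \<in> R \<Longrightarrow> v < x"
  then have "{x \<in> R. v < x} = R" "{x \<in> R. x < v} = {}" by force+
  then show ?thesis by (simp add: clist_def del: Collect_empty_eq)
qed

lemma clist_less: "finite R \<Longrightarrow> (\<And>x. x \<in> R \<Longrightarrow> x < v) \<Longrightarrow> clist v R = slist R"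
proof -
  assume *: "finite R" "\<And>x. x \<in> R \<Longrightarrow> x < v"
  then have "{x \<in> R. v < x} = {}" "{x \<in> R. x < v} = R" by force+
  then show ?thesis by (simp add: clist_def del: Collect_empty_eq)
qed

lemma clist_empty [simp]: "clist v {} = []"
  by (simp add: clist_def)

lemma map_clist:
  assumes g: "cyc_preserving g S" and "v \<in> S" "R \<subseteq> S" "v \<notin> R" "finite R"
  shows "map g (clist v R) = clist (g v) (g ` R)"
proof (rule clist_eqI)
  have "sorted_wrt (\<lambda>x y. cyc (g v) (g x) (g y)) (clist v R)"
    by (rule sorted_wrt_mono_rel[OF _ sorted_wrt_clist])
       (use assms set_clist[of R v] in \<open>auto simp: cyc_preserving_iff[OF g] subset_iff\<close>)
  then show "sorted_wrt (cyc (g v)) (map g (clist v R))"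
    by (simp add: sorted_wrt_map)
  show "g v \<notin> g ` R"
    using assms by (auto simp: cyc_preserving_def inj_on_def)
qed (use assms set_clist in auto)

lemma map_slist:
  assumes "strict_mono_on S g" "R \<subseteq> S" "finite R"
  shows "map g (slist R) = slist (g ` R)"
proof (rule slist_eqI)
  have "sorted_wrt (\<lambda>x y. g x < g y) (slist R)"
    by (rule sorted_wrt_mono_rel[where P = "(<)"])
       (use assms in \<open>auto simp: strict_mono_onD subset_iff\<close>)
  then show "sorted_wrt (<) (map g (slist R))"
    by (simp add: sorted_wrt_map)
qed (use assms in auto)

lemma strict_mono_on_nth_slist:
  assumes "finite S"
  shows "strict_mono_on {..<card S} ((!) (slist S))"
  by (rule strict_mono_onI) (use assms in \<open>auto intro: sorted_wrt_nth_less[of "(<)"]\<close>)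

lemma image_nth_slist: "finite S \<Longrightarrow> (!) (slist S) ` {..<card S} = S"
  using nth_image[of "card S" "slist S"] by (simp add: lessThan_atLeast0)

lemma slist_lessThan: "slist {..<n} = [0..<n]"
  using sorted_list_of_set_range[of 0 n] by (simp add: lessThan_atLeast0)

lemma nths_conv_slist:
  assumes "V \<subseteq> {..<length as}"
  shows "nths as V = map ((!) as) (slist V)"
proof -
  have "nths as V = map ((!) as) (nths [0..<length as] V)"
    by (metis map_nth nths_map)
  also have "nths [0..<length as] V = slist V"
  proof (rule slist_eqI)
    show "sorted_wrt (<) (nths [0..<length as] V)"
      by (simp add: strict_sorted_iff sorted_nths)
    show "set (nths [0..<length as] V) = V"
      using assms by (force simp: set_nths)
  qed
  finally show ?thesis .
qed

text \<open>The bridge from the modular enumeration in \<open>cyclic_arc\<close> to the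
  order-theoretic arcs: the walk around the circle from \<open>v\<close> is sorted by
  \<open>cyc v\<close>.\<close>

lemma cyclic_arc_conv_clist:
  assumes "v < n"  "v \<in> V" "V \<subseteq> {..<n}"
  shows "cyclic_arc n V v = clist v (arc {..<n} V v)"
proof (rule clist_eqI)
  define L where "L = map (\<lambda>t. (v + t) mod n) [1..<n]"
  have md: "(v + t) mod n = (if v + t < n then v + t else v + t - n)" if "t < n" for t
    using that assms(1) by (auto simp: mod_if)
  have srt: "sorted_wrt (cyc v) L"
    unfolding L_def sorted_wrt_map
    by (rule sorted_wrt_mono_rel[where P = "(<)"]) (use assms(1) in \<open>auto simp: md cyc_def\<close>)
  have setL: "set L = {..<n} - {v}"
  proof (intro set_eqI iffI)
    fix x assume "x \<in> {..<n} - {v}"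
    then have "x = (v + (if v < x then x - v else x + n - v)) mod n"
      "(if v < x then x - v else x + n - v) \<in> {1..<n}"
      using assms(1) by (auto simp: mod_if)
    then show "x \<in> set L"
      unfolding L_def set_map set_upt by blast
  qed (use assms(1) in \<open>auto simp: L_def md\<close>)
  have "sorted_wrt (cyc v) (takeWhile P L)" for P
    using srt sorted_wrt_append[of "cyc v" "takeWhile P L" "dropWhile P L"] by simp
  then show "sorted_wrt (cyc v) (cyclic_arc n V v)"
    by (simp add: cyclic_arc_def L_def)
  \<comment> \<open>In a list sorted by \<open>cyc v\<close>, \<open>takeWhile\<close> keeps exactly
    the entries outside \<open>V\<close> that no element of \<open>V\<close> precedes.\<close>
  have aux: "x \<in> set (takeWhile (\<lambda>i. i \<notin> V) M) \<longleftrightarrow> x \<in> set M - V \<and> (\<forall>u\<in>V \<inter> set M. \<not> cyc v u x)"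
    if "sorted_wrt (cyc v) M" for M x
    using that by (induction M) (auto dest: cyc_asym)
  have "set (cyclic_arc n V v) = {x \<in> set L - V. \<forall>u\<in>V \<inter> set L. \<not> cyc v u x}"
    using aux[OF srt] by (auto simp: cyclic_arc_def L_def)
  also have "\<dots> = arc {..<n} V v"
    using assms unfolding setL by (auto simp: arc_def cyc_def)
  finally show "set (cyclic_arc n V v) = arc {..<n} V v" .
  show "finite (arc {..<n} V v)" "v \<notin> arc {..<n} V v"
    using assms by (auto simp: arc_def)
qed

text \<open>The clockwise predecessor of \<open>x\<close> in \<open>V\<close> is the largest element
  below \<open>x\<close> or, if there is none, \<open>Max V\<close>, whose arc wraps around.\<close>

lemma arcs_cover:
  assumes "finite V" "V \<noteq> {}" "x \<in> S - V"
  shows "\<exists>v\<in>V. x \<in> arc S V v"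
proof (cases "\<exists>v\<in>V. v < x")
  case True
  define w where "w = Max {v \<in> V. v < x}"
  have "w \<in> {v \<in> V. v < x}"
    unfolding w_def by (rule Max_in) (use assms True in auto)
  then have w: "w \<in> V" "w < x"
    by auto
  have le: "u \<le> w" if "u \<in> V" "u < x" for u
    unfolding w_def by (rule Max_ge) (use assms(1) that in auto)
  have "\<not> cyc w u x" if "u \<in> V" for u
    using that le[of u] w by (auto simp: cyc_def)
  then have "x \<in> arc S V w"
    using assms(3) by (simp add: arc_def)
  with w show ?thesis by blast
next
  case False
  have M: "Max V \<in> V" "\<And>u. u \<in> V \<Longrightarrow> u \<le> Max V"
    using assms by auto
  have "\<not> cyc (Max V) u x" if "u \<in> V" for u
    using that M(2)[OF that] False M(1) by (auto simp: cyc_def)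
  then have "x \<in> arc S V (Max V)"
    using assms(3) by (simp add: arc_def)
  with M(1) show ?thesis by blast
qed

text \<open>Of two distinct points of \<open>V\<close>, one is met on the way from the other to
  \<open>x\<close>.\<close>

lemma arcs_disjoint: "x \<in> arc S V v \<Longrightarrow> x \<in> arc S V u \<Longrightarrow> v \<in> V \<Longrightarrow> u \<in> V \<Longrightarrow> v = u"
proof (rule ccontr)
  assume *: "x \<in> arc S V v" "x \<in> arc S V u" "v \<in> V" "u \<in> V" "v \<noteq> u"
  then have "x \<noteq> v" "x \<noteq> u"
    by (auto simp: arc_def)
  with \<open>v \<noteq> u\<close> have "cyc v u x \<or> cyc u v x"
    by (auto simp: cyc_def)
  with * show False
    by (auto simp: arc_def)
qed

lemma arcs_Union: "finite V \<Longrightarrow> V \<noteq> {} \<Longrightarrow> (\<Union>v\<in>V. arc S V v) = S - V"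
proof (intro set_eqI iffI)
  fix x assume "finite V" "V \<noteq> {}" "x \<in> S - V"
  from arcs_cover[OF this] show "x \<in> (\<Union>v\<in>V. arc S V v)"
    by blast
qed (auto simp: arc_def)

section \<open>Non-crossing partitions of finite sets\<close>

definition ncp :: "nat set \<Rightarrow> nat set set set" where
  "ncp S = {\<pi>. partition_on S \<pi> \<and> noncrossing \<pi>}"

definition nc_sum :: "nat set \<Rightarrow> (nat set \<Rightarrow> complex) \<Rightarrow> complex" where
  "nc_sum S f = (\<Sum>\<pi>\<in>ncp S. \<Prod>W\<in>\<pi>. f W)"

lemma NC_conv_ncp: "NC n = ncp {..<n}"
  by (simp add: NC_def ncp_def)

lemma finite_ncp [intro]: "finite S \<Longrightarrow> finite (ncp S)"
  unfolding ncp_def by (rule finite_subset[OF _ finitely_many_partition_on]) auto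

text \<open>A crossing is a pattern on the circle and may be cut open at any of its four points. In
  terms of \<open>cyc\<close>, being non-crossing is visibly invariant under rotation.\<close>

lemma noncrossing_conv_cyc:
  "noncrossing \<pi> \<longleftrightarrow> (\<forall>V\<in>\<pi>. \<forall>W\<in>\<pi>. V \<noteq> W \<longrightarrow>
     (\<forall>a\<in>V. \<forall>c\<in>V. \<forall>b\<in>W. \<forall>d\<in>W. \<not> (cyc a b c \<and> cyc c d a)))" (is "_ \<longleftrightarrow> ?R")
proof
  assume nc: "noncrossing \<pi>"
  have *: "a < b \<Longrightarrow> b < c \<Longrightarrow> c < d \<Longrightarrow> V \<in> \<pi> \<Longrightarrow> W \<in> \<pi> \<Longrightarrow> V \<noteq> W \<Longrightarrow>
      a \<in> V \<Longrightarrow> c \<in> V \<Longrightarrow> b \<in> W \<Longrightarrow> d \<in> W \<Longrightarrow> False" for a b c d V W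
    using nc unfolding noncrossing_def by metis
  show ?R
  proof (intro ballI impI notI)
    fix V W a b c d
    assume h: "V \<in> \<pi>" "W \<in> \<pi>" "V \<noteq> W" "a \<in> V" "c \<in> V" "b \<in> W" "d \<in> W" "cyc a b c \<and> cyc c d a"
    then have "a < b \<and> b < c \<and> c < d \<or> b < c \<and> c < d \<and> d < a \<or>
        c < d \<and> d < a \<and> a < b \<or> d < a \<and> a < b \<and> b < c"
      by (auto simp: cyc_def)
    \<comment> \<open>The cuts at \<open>b\<close> and at \<open>d\<close> start in
      \<open>W\<close>, which exchanges the roles of \<open>V\<close> and \<open>W\<close>.\<close>
    then show False
      using *[OF _ _ _ h(1) h(2) h(3) h(4) h(5) h(6) h(7)]
        *[OF _ _ _ h(2) h(1) h(3)[symmetric] h(6) h(7) h(5) h(4)]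
        *[OF _ _ _ h(1) h(2) h(3) h(5) h(4) h(7) h(6)]
        *[OF _ _ _ h(2) h(1) h(3)[symmetric] h(7) h(6) h(4) h(5)] by blast
  qed
next
  assume R: ?R
  show "noncrossing \<pi>"
    unfolding noncrossing_def
  proof (intro ballI impI notI, elim exE conjE)
    fix V W a b c d
    assume "V \<in> \<pi>" "W \<in> \<pi>" "V \<noteq> W" "a < b" "b < c" "c < d" "a \<in> V" "c \<in> V" "b \<in> W" "d \<in> W"
    moreover from this have "cyc a b c" "cyc c d a"
      by (auto simp: cyc_def)
    ultimately show False
      using R[rule_format, of V W a c b d] by simp
  qed
qed

lemma noncrossing_subset: "noncrossing \<pi> \<Longrightarrow> \<sigma> \<subseteq> \<pi> \<Longrightarrow> noncrossing \<sigma>"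
  unfolding noncrossing_def by (meson subsetD)

lemma noncrossing_image:
  assumes g: "cyc_preserving g S" and "\<Union>\<pi> \<subseteq> S"
  shows "noncrossing ((`) g ` \<pi>) \<longleftrightarrow> noncrossing \<pi>"
proof -
  have inj: "inj_on ((`) g) \<pi>"
    using assms unfolding cyc_preserving_def
    by (meson inj_on_image inj_on_subset)
  have "cyc (g a) (g b) (g c) \<longleftrightarrow> cyc a b c" if "a \<in> V" "b \<in> W" "c \<in> X" "V \<in> \<pi>" "W \<in> \<pi>" "X \<in> \<pi>"
    for a b c V W X
    using cyc_preserving_iff[OF g] assms(2) that by blast
  moreover have "g ` V = g ` W \<longleftrightarrow> V = W" if "V \<in> \<pi>" "W \<in> \<pi>" for V W
    using inj that by (meson inj_onD)
  ultimately show ?thesis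
    unfolding noncrossing_conv_cyc by simp
qed

text \<open>The inverse of \<open>g\<close> preserves the cyclic order as well, so taking images of
  blocks is invertible on non-crossing partitions.\<close>

lemma ncp_image:
  assumes g: "cyc_preserving g S"
  shows "bij_betw ((`) ((`) g)) (ncp S) (ncp (g ` S))"
proof -
  have inj: "inj_on g S"
    using g by (simp add: cyc_preserving_def)
  have part: "partition_on (g ` S) ((`) g ` \<pi>)" if "partition_on S \<pi>" for \<pi>
    using partition_on_inj_image[OF that inj] partition_onD3[OF that] by (simp add: image_iff)
  define h where "h = the_inv_into S g"
  have hg: "h ` g ` A = A" if "A \<subseteq> S" for A
    using that inj by (auto simp: h_def image_image subset_iff the_inv_into_f_f intro!: image_eqI)
  have gh: "g ` h ` B = B" if "B \<subseteq> g ` S" for B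
    using that inj by (fastforce simp: h_def image_image subset_iff f_the_inv_into_f)
  have hS: "cyc_preserving h (g ` S)"
    unfolding cyc_preserving_def
    using inj cyc_preserving_iff[OF g] by (auto simp: h_def the_inv_into_f_f intro!: inj_onI)
  have part': "partition_on S ((`) h ` \<pi>)" if "partition_on (g ` S) \<pi>" for \<pi>
  proof -
    have "inj_on h (g ` S)"
      using hS by (simp add: cyc_preserving_def)
    from partition_on_inj_image[OF that this]
    have "partition_on S ((`) h ` \<pi> - {{}})"
      by (simp add: hg)
    moreover have "{} \<notin> (`) h ` \<pi>"
      using partition_onD3[OF that] by force
    ultimately show ?thesis
      by simp
  qed
  have im: "(`) u ` (`) w ` \<pi> = \<pi>" if "\<pi> \<in> ncp T" "\<And>A. A \<subseteq> T \<Longrightarrow> u ` w ` A = A" for u w :: "nat \<Rightarrow> nat" and \<pi> T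
  proof -
    have "u ` w ` W = W" if "W \<in> \<pi>" for W
      using \<open>\<pi> \<in> ncp T\<close> that \<open>\<And>A. A \<subseteq> T \<Longrightarrow> u ` w ` A = A\<close>[of W]
      unfolding ncp_def partition_on_def by blast
    then show ?thesis
      unfolding image_image[of "(`) u"] by simp
  qed
  show ?thesis
  proof (rule bij_betw_byWitness[where f' = "(`) ((`) h)"])
    show "\<forall>\<pi>\<in>ncp S. (`) h ` (`) g ` \<pi> = \<pi>"
      using im[of _ S h g] hg by blast
    show "\<forall>\<pi>\<in>ncp (g ` S). (`) g ` (`) h ` \<pi> = \<pi>"
      using im[of _ "g ` S" g h] gh by blast
    show "(`) ((`) g) ` ncp S \<subseteq> ncp (g ` S)"
    proof (intro image_subsetI)
      fix \<pi> assume "\<pi> \<in> ncp S"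
      then show "(`) g ` \<pi> \<in> ncp (g ` S)"
        using part[of \<pi>] noncrossing_image[OF g, of \<pi>] by (simp add: ncp_def partition_on_def)
    qed
    show "(`) ((`) h) ` ncp (g ` S) \<subseteq> ncp S"
    proof (intro image_subsetI)
      fix \<pi> assume "\<pi> \<in> ncp (g ` S)"
      then show "(`) h ` \<pi> \<in> ncp S"
        using part'[of \<pi>] noncrossing_image[OF hS, of \<pi>] by (simp add: ncp_def partition_on_def)
    qed
  qed
qed

lemma nc_sum_image:
  assumes g: "cyc_preserving g S"
  shows "nc_sum (g ` S) f = nc_sum S (\<lambda>W. f (g ` W))"
proof -
  have inj: "inj_on ((`) g) \<pi>" if "\<pi> \<in> ncp S" for \<pi>
    using g that partition_onD1[of S \<pi>] unfolding cyc_preserving_def ncp_def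
    by (metis inj_on_image mem_Collect_eq)
  have "nc_sum (g ` S) f = (\<Sum>\<pi>\<in>ncp S. \<Prod>W\<in>(`) g ` \<pi>. f W)"
    unfolding nc_sum_def by (rule sum.reindex_bij_betw[symmetric, OF ncp_image[OF g]])
  also have "\<dots> = nc_sum S (\<lambda>W. f (g ` W))"
    unfolding nc_sum_def using inj by (intro sum.cong) (auto simp: prod.reindex)
  finally show ?thesis .
qed

lemma nc_sum_cong:
  assumes "\<And>W. W \<subseteq> S \<Longrightarrow> W \<noteq> {} \<Longrightarrow> f W = h W"
  shows "nc_sum S f = nc_sum S h"
  unfolding nc_sum_def
  by (intro sum.cong prod.cong assms) (auto simp: ncp_def partition_on_def)

text \<open>A block that meets two arcs of \<open>V\<close> crosses \<open>V\<close>, and blocks in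
  different arcs are kept apart by \<open>V\<close>. Being non-crossing thus splits into independent
  conditions, one for each arc.\<close>

lemma ncp_arcs_iff:
  assumes V: "V \<subseteq> S" "V \<noteq> {}" "finite S" and \<sigma>: "partition_on (S - V) \<sigma>"
  shows "noncrossing (insert V \<sigma>) \<longleftrightarrow>
    (\<forall>W\<in>\<sigma>. \<exists>v\<in>V. W \<subseteq> arc S V v) \<and> (\<forall>v\<in>V. noncrossing {W\<in>\<sigma>. W \<subseteq> arc S V v})"
proof (intro iffI conjI ballI)
  assume nc: "noncrossing (insert V \<sigma>)"
  have finV: "finite V"
    using V finite_subset by blast
  show "noncrossing {W\<in>\<sigma>. W \<subseteq> arc S V v}" for v
    by (rule noncrossing_subset[OF nc]) auto
  fix W assume W: "W \<in> \<sigma>"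
  then have W': "W \<subseteq> S - V" "W \<noteq> {}"
    using \<sigma> by (auto simp: partition_on_def)
  then obtain x where x: "x \<in> W" by blast
  then obtain v where v: "v \<in> V" "x \<in> arc S V v"
    using arcs_cover[OF finV V(2)] W' by blast
  have "y \<in> arc S V v" if y: "y \<in> W" for y
  proof -
    have "\<not> cyc v u y" if "u \<in> V" for u
    proof
      assume u: "cyc v u y"
      have "x \<noteq> v" "x \<noteq> u" "V \<noteq> W"
        using x W' v(1) that by auto
      moreover have "\<not> cyc v u x"
        using v that by (auto simp: arc_def)
      ultimately have "cyc v x u" "cyc u y v"
        using u by (auto simp: cyc_def)
      with nc[unfolded noncrossing_conv_cyc, rule_format, of V W v u x y] v(1) that x y W \<open>V \<noteq> W\<close>
      show False by simp
    qed
    then show ?thesis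
      using y W' by (auto simp: arc_def)
  qed
  with v show "\<exists>v\<in>V. W \<subseteq> arc S V v" by blast
next
  assume R: "(\<forall>W\<in>\<sigma>. \<exists>v\<in>V. W \<subseteq> arc S V v) \<and> (\<forall>v\<in>V. noncrossing {W\<in>\<sigma>. W \<subseteq> arc S V v})"
  \<comment> \<open>Seen from \<open>v\<close>, both \<open>b\<close> and \<open>d\<close> come
    before \<open>a\<close> and \<open>c\<close>, once \<open>a = v\<close> and \<open>c = v\<close>
    are excluded. The two halves of a crossing would then order \<open>a\<close> and
    \<open>c\<close> in opposite ways.\<close>
  have VW: "\<not> (cyc a b c \<and> cyc c d a)" if h: "W \<in> \<sigma>" "a \<in> V" "c \<in> V" "b \<in> W" "d \<in> W" for W a b c d
  proof -
    obtain v where "v \<in> V" "b \<in> arc S V v" "d \<in> arc S V v"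
      using conjunct1[OF R, rule_format, OF h(1)] h(4,5) by blast
    then have "\<not> cyc v a b" "\<not> cyc v a d" "\<not> cyc v c b" "\<not> cyc v c d" "b \<noteq> v" "d \<noteq> v"
      using h by (auto simp: arc_def)
    note n = this
    have comp: "cyc v b a" if "\<not> cyc v a b" "a \<noteq> v" "b \<noteq> v" "a \<noteq> b" for a b
      using cyc_total[of v b a] that by simp
    have trans: "cyc v c a" if "cyc v b a" "cyc v b c" "cyc a b c" for a b c
      using that unfolding cyc_def by (elim disjE conjE) simp_all
    have rot: "cyc z x y" if "cyc x y z" for x y z
      using that by (auto simp: cyc_def)
    show ?thesis
    proof
      assume c: "cyc a b c \<and> cyc c d a"
      then have "a \<noteq> v" "c \<noteq> v"
        using n rot rot[OF rot] by blast+
      moreover have "a \<noteq> b" "b \<noteq> c" "c \<noteq> d" "d \<noteq> a"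
        using c cyc_distinct by auto
      ultimately have "cyc v b a" "cyc v b c" "cyc v d a" "cyc v d c"
        using comp n by auto
      then show False
        using trans[of b a c] trans[of d c a] c cyc_asym by blast
    qed
  qed
  have WW: "\<not> (cyc a b c \<and> cyc c d a)"
    if W: "W \<in> \<sigma>" "X \<in> \<sigma>" "W \<noteq> X" "a \<in> W" "c \<in> W" "b \<in> X" "d \<in> X" for W X a b c d
  proof -
    obtain v u where vu: "v \<in> V" "W \<subseteq> arc S V v" "u \<in> V" "X \<subseteq> arc S V u"
      using conjunct1[OF R, rule_format, OF W(1)] conjunct1[OF R, rule_format, OF W(2)] by metis
    show ?thesis
    proof (cases "u = v")
      case True
      with vu have nc: "noncrossing {W \<in> \<sigma>. W \<subseteq> arc S V v}" and "X \<subseteq> arc S V v"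
        using R by auto
      then show ?thesis
        using nc[unfolded noncrossing_conv_cyc, rule_format, of W X a c b d] W vu by simp
    next
      case False
      \<comment> \<open>With \<open>u \<noteq> v\<close>, all of \<open>W\<close> lies on the way
        from \<open>v\<close> to \<open>u\<close> and all of \<open>X\<close> on the way
        back.\<close>
      have "\<not> cyc v u a" "\<not> cyc v u c" "\<not> cyc u v b" "\<not> cyc u v d"
        and "a \<noteq> v" "a \<noteq> u" "c \<noteq> v" "c \<noteq> u" "b \<noteq> v" "b \<noteq> u" "d \<noteq> v" "d \<noteq> u"
        using vu W by (auto simp: arc_def)
      with False have "cyc v a u" "cyc v c u" "cyc u b v" "cyc u d v"
        using cyc_total[of v u] cyc_total[of u v] by metis+
      moreover have "\<not> cyc u b v" if "cyc v a c" "cyc v c u" "cyc a b c" for a b c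
        using that unfolding cyc_def by (elim disjE conjE) simp_all
      ultimately show ?thesis
        using cyc_total[of v a c] \<open>a \<noteq> v\<close> \<open>c \<noteq> v\<close> by (auto dest: cyc_distinct)
    qed
  qed
  have VW': "\<not> (cyc a b c \<and> cyc c d a)" if "W \<in> \<sigma>" "a \<in> W" "c \<in> W" "b \<in> V" "d \<in> V" for W a b c d
  proof
    assume "cyc a b c \<and> cyc c d a"
    then have "cyc b c d \<and> cyc d a b"
      by (auto simp: cyc_def)
    with VW[OF that(1) that(4) that(5) that(3) that(2)] show False by blast
  qed
  show "noncrossing (insert V \<sigma>)"
    unfolding noncrossing_conv_cyc
  proof (intro ballI impI)
    fix A B a b c d
    assume "A \<in> insert V \<sigma>" "B \<in> insert V \<sigma>" "A \<noteq> B"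
      and *: "a \<in> A" "c \<in> A" "b \<in> B" "d \<in> B"
    then consider "A = V" "B \<in> \<sigma>" | "A \<in> \<sigma>" "B = V" | "A \<in> \<sigma>" "B \<in> \<sigma>" "A \<noteq> B"
      by blast
    then show "\<not> (cyc a b c \<and> cyc c d a)"
    proof cases
      case 1
      with VW[of B a c b d] * show ?thesis by simp
    next
      case 2
      with VW'[of A a c b d] * show ?thesis by simp
    next
      case 3
      with WW[of A B a c b d] * show ?thesis by simp
    qed
  qed
qed

text \<open>Completing \<open>V\<close> to a non-crossing partition means choosing a non-crossing
  partition of every arc, independently. An empty arc has only the empty partition and gives the
  factor 1.\<close>

lemma sum_ncp_with_block:
  assumes V: "V \<subseteq> S" "V \<noteq> {}" "finite S"
  shows "(\<Sum>\<pi> | \<pi> \<in> ncp S \<and> V \<in> \<pi>. \<Prod>W\<in>\<pi> - {V}. f W) = (\<Prod>v\<in>V. nc_sum (arc S V v) f)"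
proof -
  have finV: "finite V"
    using V finite_subset by blast
  define F where "F \<tau> = insert V (\<Union>v\<in>V. \<tau> v)" for \<tau> :: "nat \<Rightarrow> nat set set"
  define G where "G \<pi> = (\<lambda>v\<in>V. {W \<in> \<pi> - {V}. W \<subseteq> arc S V v})" for \<pi>
  have Vnot: "V \<notin> \<sigma>" if "partition_on (S - V) \<sigma>" for \<sigma>
    using that V by (auto simp: partition_on_def)
  have part: "partition_on (S - V) (\<Union>v\<in>V. \<tau> v)" and blocks: "\<And>v. v \<in> V \<Longrightarrow> {W \<in> (\<Union>v\<in>V. \<tau> v). W \<subseteq> arc S V v} = \<tau> v"
    and disj: "\<And>u v. u \<in> V \<Longrightarrow> v \<in> V \<Longrightarrow> u \<noteq> v \<Longrightarrow> \<tau> u \<inter> \<tau> v = {}"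
    if \<tau>: "\<tau> \<in> (\<Pi>\<^sub>E v\<in>V. ncp (arc S V v))" for \<tau>
  proof -
    have p: "partition_on (arc S V v) (\<tau> v)" if "v \<in> V" for v
      using \<tau> that by (auto simp: ncp_def PiE_iff)
    have own: "W \<in> \<tau> v \<Longrightarrow> v \<in> V \<Longrightarrow> W \<subseteq> arc S V v \<and> W \<noteq> {}" for W v
      using p[of v] by (auto simp: partition_on_def)
    \<comment> \<open>Arcs are disjoint, so blocks that share a point come from the same arc. As
      blocks are non-empty, the arc can be recovered from the block.\<close>
    have same: "W \<in> \<tau> v \<Longrightarrow> X \<in> \<tau> u \<Longrightarrow> v \<in> V \<Longrightarrow> u \<in> V \<Longrightarrow> x \<in> W \<Longrightarrow> x \<in> X \<Longrightarrow> v = u" for W X v u x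
      using own arcs_disjoint by (metis subsetD)
    show "partition_on (S - V) (\<Union>v\<in>V. \<tau> v)"
    proof (rule partition_onI)
      show "\<Union> (\<Union>v\<in>V. \<tau> v) = S - V"
        using partition_onD1[OF p] unfolding arcs_Union[OF finV V(2), of S, symmetric] by auto
      show "{} \<notin> (\<Union>v\<in>V. \<tau> v)"
        using own by blast
      fix W X assume "W \<in> (\<Union>v\<in>V. \<tau> v)" "X \<in> (\<Union>v\<in>V. \<tau> v)" "W \<noteq> X"
      then obtain v u where vu: "W \<in> \<tau> v" "X \<in> \<tau> u" "v \<in> V" "u \<in> V" "W \<noteq> X" by blast
      show "disjnt W X"
      proof (rule ccontr)
        assume "\<not> disjnt W X"
        then obtain x where "x \<in> W" "x \<in> X" by (auto simp: disjnt_def)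
        with same vu have "v = u" by blast
        with vu p[of u] \<open>\<not> disjnt W X\<close> show False
          by (auto simp: partition_on_def pairwise_def)
      qed
    qed
    show "{W \<in> (\<Union>v\<in>V. \<tau> v). W \<subseteq> arc S V v} = \<tau> v" if v: "v \<in> V" for v
    proof (intro set_eqI iffI)
      fix W assume "W \<in> {W \<in> (\<Union>v\<in>V. \<tau> v). W \<subseteq> arc S V v}"
      then obtain u where u: "u \<in> V" "W \<in> \<tau> u" "W \<subseteq> arc S V v" by blast
      then obtain x where "x \<in> W" "x \<in> arc S V u" "x \<in> arc S V v"
        using own by blast
      then show "W \<in> \<tau> v"
        using arcs_disjoint u v by metis
    qed (use own v in blast)
    show "\<tau> u \<inter> \<tau> v = {}" if uv: "u \<in> V" "v \<in> V" "u \<noteq> v" for u v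
    proof (rule ccontr)
      assume "\<tau> u \<inter> \<tau> v \<noteq> {}"
      then obtain W where W: "W \<in> \<tau> u" "W \<in> \<tau> v" by blast
      then obtain x where "x \<in> W" using own[of W u] uv by blast
      with W show False using same uv by blast
    qed
  qed
  have ins: "partition_on S \<pi> \<and> V \<in> \<pi> \<longleftrightarrow> partition_on (S - V) (\<pi> - {V}) \<and> V \<in> \<pi>" for \<pi>
  proof (cases "V \<in> \<pi>")
    case True
    then have eq: "insert V (\<pi> - {V}) = \<pi>"
      by blast
    have "disjnt V (\<Union>(\<pi> - {V}))" if "partition_on S \<pi> \<or> partition_on (S - V) (\<pi> - {V})"
      using that
    proof
      assume "partition_on S \<pi>"
      then have "disjnt V X" if "X \<in> \<pi> - {V}" for X
        using True that by (auto simp: partition_on_def pairwise_def)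
      then show ?thesis
        by (simp add: disjnt_def) blast
    next
      assume "partition_on (S - V) (\<pi> - {V})"
      then show ?thesis
        unfolding disjnt_def using partition_onD1[of "S - V" "\<pi> - {V}"] by blast
    qed
    then show ?thesis
      using partition_on_insert[of V "\<pi> - {V}" S] V True unfolding eq by blast
  qed simp
  have "(\<Prod>v\<in>V. nc_sum (arc S V v) f) =
      (\<Sum>\<tau>\<in>(\<Pi>\<^sub>E v\<in>V. ncp (arc S V v)). \<Prod>v\<in>V. \<Prod>W\<in>\<tau> v. f W)"
    unfolding nc_sum_def by (rule prod_sum_PiE) (use finV V in auto)
  also have "\<dots> = (\<Sum>\<pi> | \<pi> \<in> ncp S \<and> V \<in> \<pi>. \<Prod>W\<in>\<pi> - {V}. f W)"
  proof (rule sum.reindex_bij_witness[where i = G and j = F])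
    fix \<tau> assume \<tau>: "\<tau> \<in> (\<Pi>\<^sub>E v\<in>V. ncp (arc S V v))"
    have eq: "F \<tau> - {V} = (\<Union>v\<in>V. \<tau> v)"
      using Vnot[OF part[OF \<tau>]] unfolding F_def by blast
    show "G (F \<tau>) = \<tau>"
    proof (rule extensionalityI[where A = V])
      show "G (F \<tau>) \<in> extensional V"
        by (simp add: G_def)
      show "\<tau> \<in> extensional V"
        using \<tau> by (simp add: PiE_def)
      show "G (F \<tau>) v = \<tau> v" if "v \<in> V" for v
        unfolding G_def eq using blocks[OF \<tau> that] that by simp
    qed
    have "W \<subseteq> arc S V v" if "W \<in> \<tau> v" "v \<in> V" for v W
      using PiE_mem[OF \<tau> that(2)] that(1) unfolding ncp_def partition_on_def by blast
    moreover have "noncrossing (\<tau> v)" if "v \<in> V" for v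
      using PiE_mem[OF \<tau> that] by (simp add: ncp_def)
    ultimately have "noncrossing (F \<tau>)"
      unfolding F_def ncp_arcs_iff[OF V part[OF \<tau>]] using blocks[OF \<tau>] by auto
    then show "F \<tau> \<in> {\<pi>. \<pi> \<in> ncp S \<and> V \<in> \<pi>}"
      using ins[of "F \<tau>"] part[OF \<tau>] eq by (auto simp: ncp_def F_def)
    have "(\<Prod>W\<in>(\<Union>v\<in>V. \<tau> v). f W) = (\<Prod>v\<in>V. \<Prod>W\<in>\<tau> v. f W)"
    proof (rule prod.UNION_disjoint[OF finV])
      show "\<forall>v\<in>V. finite (\<tau> v)"
        using finite_elements[OF finite_arc[OF V(3)]] PiE_mem[OF \<tau>] unfolding ncp_def by blast
      show "\<forall>u\<in>V. \<forall>v\<in>V. u \<noteq> v \<longrightarrow> \<tau> u \<inter> \<tau> v = {}"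
        using disj[OF \<tau>] by blast
    qed
    then show "(\<Prod>W\<in>F \<tau> - {V}. f W) = (\<Prod>v\<in>V. \<Prod>W\<in>\<tau> v. f W)"
      unfolding eq .
  next
    fix \<pi> assume "\<pi> \<in> {\<pi>. \<pi> \<in> ncp S \<and> V \<in> \<pi>}"
    then have \<pi>: "V \<in> \<pi>" "partition_on (S - V) (\<pi> - {V})" "noncrossing (insert V (\<pi> - {V}))"
      using ins[of \<pi>] by (auto simp: ncp_def insert_absorb)
    note nc = ncp_arcs_iff[OF V \<pi>(2), THEN iffD1, OF \<pi>(3)]
    show "F (G \<pi>) = \<pi>"
      using nc \<pi>(1) by (auto simp: F_def G_def)
    have "partition_on (arc S V v) {W \<in> \<pi> - {V}. W \<subseteq> arc S V v}" if "v \<in> V" for v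
    proof (rule partition_onI)
      show "\<Union> {W \<in> \<pi> - {V}. W \<subseteq> arc S V v} = arc S V v"
      proof (intro set_eqI iffI)
        fix x assume x: "x \<in> arc S V v"
        then have "x \<in> S - V" using arc_subset by blast
        then obtain W where W: "x \<in> W" "W \<in> \<pi> - {V}"
          using partition_onD1[OF \<pi>(2)] by blast
        then obtain u where "u \<in> V" "W \<subseteq> arc S V u" using nc by blast
        then show "x \<in> \<Union> {W \<in> \<pi> - {V}. W \<subseteq> arc S V v}"
          using W x arcs_disjoint[of x S V v u] that by blast
      qed auto
      show "disjnt W X" if "W \<in> {W \<in> \<pi> - {V}. W \<subseteq> arc S V v}" "X \<in> {W \<in> \<pi> - {V}. W \<subseteq> arc S V v}" "W \<noteq> X" for W X
        using that \<pi>(2) by (simp add: partition_on_def pairwise_def)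
      show "{} \<notin> {W \<in> \<pi> - {V}. W \<subseteq> arc S V v}"
        using \<pi>(2) by (auto simp: partition_on_def)
    qed
    then show "G \<pi> \<in> (\<Pi>\<^sub>E v\<in>V. ncp (arc S V v))"
      using nc by (auto simp: G_def ncp_def)
  qed
  finally show ?thesis ..
qed

text \<open>Exactly one block contains \<open>p\<close>; after grouping by it, the sum over the
  remaining blocks factorises over its arcs.\<close>

lemma nc_sum_by_block:
  assumes "finite S" "p \<in> S"
  shows "nc_sum S f = (\<Sum>V | p \<in> V \<and> V \<subseteq> S. f V * (\<Prod>v\<in>V. nc_sum (arc S V v) f))"
proof -
  let ?B = "{V. p \<in> V \<and> V \<subseteq> S}"
  have ex1: "\<exists>!V. V \<in> \<pi> \<and> p \<in> V" if "\<pi> \<in> ncp S" for \<pi>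
    using that assms by (fastforce simp: ncp_def partition_on_def disjoint_def)
  have "nc_sum S f = (\<Sum>\<pi>\<in>ncp S. \<Sum>V | V \<in> ?B \<and> V \<in> \<pi>. \<Prod>W\<in>\<pi>. f W)"
    unfolding nc_sum_def
  proof (rule sum.cong[OF refl])
    fix \<pi> assume "\<pi> \<in> ncp S"
    then obtain V where "V \<in> \<pi>" "p \<in> V" "\<And>X. X \<in> \<pi> \<Longrightarrow> p \<in> X \<Longrightarrow> X = V"
      using ex1 by blast
    moreover from \<open>V \<in> \<pi>\<close> have "V \<subseteq> S"
      using \<open>\<pi> \<in> ncp S\<close> unfolding ncp_def partition_on_def by blast
    ultimately have "{X. X \<in> ?B \<and> X \<in> \<pi>} = {V}"
      by blast
    then show "(\<Prod>W\<in>\<pi>. f W) = (\<Sum>V | V \<in> ?B \<and> V \<in> \<pi>. \<Prod>W\<in>\<pi>. f W)"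
      by simp
  qed
  also have "\<dots> = (\<Sum>V\<in>?B. \<Sum>\<pi> | \<pi> \<in> ncp S \<and> V \<in> \<pi>. \<Prod>W\<in>\<pi>. f W)"
    by (rule sum.swap_restrict) (use assms in auto)
  also have "\<dots> = (\<Sum>V\<in>?B. \<Sum>\<pi> | \<pi> \<in> ncp S \<and> V \<in> \<pi>. f V * (\<Prod>W\<in>\<pi> - {V}. f W))"
  proof (intro sum.cong refl)
    fix V \<pi> assume "\<pi> \<in> {\<pi>. \<pi> \<in> ncp S \<and> V \<in> \<pi>}"
    then have "finite \<pi>" "V \<in> \<pi>"
      using assms finite_elements by (auto simp: ncp_def)
    then show "(\<Prod>W\<in>\<pi>. f W) = f V * (\<Prod>W\<in>\<pi> - {V}. f W)"
      by (simp add: prod.remove)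
  qed
  also have "\<dots> = (\<Sum>V\<in>?B. f V * (\<Prod>v\<in>V. nc_sum (arc S V v) f))"
    unfolding sum_distrib_left[symmetric]
    by (intro sum.cong refl arg_cong2[where f = "(*)"] sum_ncp_with_block) (use assms in auto)
  finally show ?thesis .
qed

section \<open>Moments as sums over the blocks\<close>

text \<open>
  Arguments are indexed by finite sets of positions instead of lists, so that multiplying two
  neighbouring arguments just deletes a position and no renumbering is needed.
\<close>

definition moment :: "('a::ring_1 \<Rightarrow> complex) \<Rightarrow> (nat \<Rightarrow> 'a) \<Rightarrow> nat set \<Rightarrow> complex" where
  "moment \<phi> a S = \<phi> (prod_list (map a (slist S)))"

definition cyclic_moment :: "('a::ring_1 \<Rightarrow> complex) \<Rightarrow> (nat \<Rightarrow> 'a) \<Rightarrow> nat \<Rightarrow> nat set \<Rightarrow> complex" where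
  "cyclic_moment \<phi> a v R = \<phi> (prod_list (map a (clist v R)))"

definition kappa :: "('a::ring_1 \<Rightarrow> complex) \<Rightarrow> (nat \<Rightarrow> 'a) \<Rightarrow> nat set \<Rightarrow> complex" where
  "kappa \<psi> a S = free_cumulant \<psi> (map a (slist S))"

definition Dkappa ::
    "('a::ring_1 \<Rightarrow> complex) \<Rightarrow> ('a \<Rightarrow> complex) \<Rightarrow> (nat \<Rightarrow> 'a) \<Rightarrow> nat set \<Rightarrow> complex" where
  "Dkappa \<psi> \<omega> a S = cyclic_free_cumulant \<psi> \<omega> (map a (slist S))"

definition cyclic_boolean_on :: "('a::ring_1 \<Rightarrow> complex) \<Rightarrow> (nat \<Rightarrow> 'a) \<Rightarrow> nat set \<Rightarrow> complex" where
  "cyclic_boolean_on \<psi> a S =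
     (\<Sum>V\<in>Pow S - {{}}. \<Prod>v\<in>V. boolean_cumulant \<psi> (map a (v # clist v (arc S V v))))"

lemma cyc_rotate: "cyc x y z \<Longrightarrow> cyc y z x"
  by (auto simp: cyc_def)

lemma cyc_trans: "cyc v x y \<Longrightarrow> cyc v y z \<Longrightarrow> cyc x y z"
  unfolding cyc_def by (elim disjE conjE) simp_all

lemma ncp_empty: "ncp {} = {{}}"
  by (auto simp: ncp_def partition_on_empty noncrossing_def)

text \<open>Listing \<open>R\<close> clockwise from \<open>v\<close> rotates and renumbers the
  circle. \<open>cyc_trans\<close> moves the base point from \<open>v\<close> to an entry of the
  list.\<close>

lemma cyc_preserving_nth_clist:
  assumes "finite R"
  shows "cyc_preserving ((!) (clist v R)) {..<length (clist v R)}"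
proof -
  let ?L = "clist v R"
  have less: "cyc v (?L ! i) (?L ! j)" if "i < j" "j < length ?L" for i j
    using sorted_wrt_nth_less[OF sorted_wrt_clist[OF assms]] that by blast
  have *: "cyc (?L ! i) (?L ! j) (?L ! k)" if "i < j" "j < k" "k < length ?L" for i j k
    using cyc_trans[OF less less] that by simp
  have "inj_on ((!) ?L) {..<length ?L}"
    using distinct_clist[OF assms, of v] by (auto simp: inj_on_def nth_eq_iff_index_eq)
  moreover have "cyc (?L ! i) (?L ! j) (?L ! k)"
    if "i < length ?L" "j < length ?L" "k < length ?L" "cyc i j k" for i j k
    using that(4)[unfolded cyc_def]
  proof (elim disjE conjE)
    assume "i < j" "j < k" with * that show ?thesis by blast
  next
    assume "j < k" "k < i"
    with * that have "cyc (?L ! j) (?L ! k) (?L ! i)" by blast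
    then show ?thesis by (blast intro: cyc_rotate)
  next
    assume "k < i" "i < j"
    with * that have "cyc (?L ! k) (?L ! i) (?L ! j)" by blast
    then show ?thesis by (blast intro: cyc_rotate)
  qed
  ultimately show ?thesis
    by (simp add: cyc_preserving_def)
qed

lemma filter_clist:
  assumes "finite R" "v \<notin> R" "W \<subseteq> R"
  shows "filter (\<lambda>x. x \<in> W) (clist v R) = clist v W"
proof (rule clist_eqI)
  show "sorted_wrt (cyc v) (filter (\<lambda>x. x \<in> W) (clist v R))"
    by (rule sorted_wrt_filter[OF sorted_wrt_clist[OF assms(1)]])
  show "set (filter (\<lambda>x. x \<in> W) (clist v R)) = W"
    using set_clist[OF assms(1,2)] assms(3) by auto
qed (use assms finite_subset in auto)

lemma nths_conv_filter:
  assumes "distinct L" "B \<subseteq> {..<length L}"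
  shows "nths L B = filter (\<lambda>x. x \<in> (!) L ` B) L"
proof -
  have "{i. i < length L \<and> L ! i \<in> (!) L ` B} = B"
    using assms by (auto simp: nth_eq_iff_index_eq subset_iff)
  then show ?thesis
    by (simp add: filter_eq_nths)
qed

text \<open>Non-crossing partitions are invariant under rotation, so the free moment-cumulant
  formula also holds when \<open>R\<close> and all its blocks are read clockwise from
  \<open>v\<close>.\<close>

lemma cyclic_moment_nc_sum:
  assumes "\<psi> 1 = 1" "finite R" "v \<notin> R"
  shows "cyclic_moment \<psi> a v R = nc_sum R (\<lambda>W. free_cumulant \<psi> (map a (clist v W)))"
proof (cases "R = {}")
  case True
  then show ?thesis
    using assms by (simp add: cyclic_moment_def nc_sum_def ncp_empty)
next
  case False
  let ?L = "clist v R"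
  have ne: "map a ?L \<noteq> []"
    using False set_clist[OF assms(2,3)] by auto
  have "cyclic_moment \<psi> a v R = nc_sum {..<length ?L} (\<lambda>B. free_cumulant \<psi> (nths (map a ?L) B))"
    using free_moment_cumulant[OF ne, of \<psi>] by (simp add: cyclic_moment_def nc_sum_def NC_conv_ncp)
  also have "\<dots> = nc_sum {..<length ?L} (\<lambda>B. free_cumulant \<psi> (map a (clist v ((!) ?L ` B))))"
  proof (rule nc_sum_cong)
    fix B assume B: "B \<subseteq> {..<length ?L}"
    have "nths ?L B = clist v ((!) ?L ` B)"
      unfolding nths_conv_filter[OF distinct_clist[OF assms(2)] B]
      by (rule filter_clist[OF assms(2,3)]) (use B nth_mem set_clist[OF assms(2,3)] in blast)
    then show "free_cumulant \<psi> (nths (map a ?L) B) = free_cumulant \<psi> (map a (clist v ((!) ?L ` B)))"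
      by (simp add: nths_map)
  qed
  also have "\<dots> = nc_sum ((!) ?L ` {..<length ?L}) (\<lambda>W. free_cumulant \<psi> (map a (clist v W)))"
    by (rule nc_sum_image[OF cyc_preserving_nth_clist[OF assms(2)], symmetric])
  also have "(!) ?L ` {..<length ?L} = R"
    using nth_image[of "length ?L" ?L] set_clist[OF assms(2,3)] by (simp add: lessThan_atLeast0)
  finally show ?thesis .
qed

lemma cyclic_moment_eq_moment:
  assumes "finite R" "(\<forall>x\<in>R. v < x) \<or> (\<forall>x\<in>R. x < v)"
  shows "cyclic_moment \<psi> a v R = moment \<psi> a R"
  using assms clist_greater[of R v] clist_less[of R v] by (auto simp: cyclic_moment_def moment_def)

lemma moment_nc_sum:
  assumes "\<psi> 1 = 1" "finite S"
  shows "moment \<psi> a S = nc_sum S (kappa \<psi> a)"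
proof -
  \<comment> \<open>Seen from a base point beyond \<open>S\<close>, the clockwise order is the
    increasing order.\<close>
  obtain v where v: "\<forall>x\<in>S. x < v"
    using assms(2) finite_nat_set_iff_bounded by blast
  have "moment \<psi> a S = cyclic_moment \<psi> a v S"
    using cyclic_moment_eq_moment assms v by metis
  also have "\<dots> = nc_sum S (\<lambda>W. free_cumulant \<psi> (map a (clist v W)))"
    by (rule cyclic_moment_nc_sum) (use assms v in auto)
  also have "\<dots> = nc_sum S (kappa \<psi> a)"
  proof (rule nc_sum_cong)
    fix W assume "W \<subseteq> S"
    then have "clist v W = slist W"
      by (intro clist_less) (use v assms finite_subset in auto)
    then show "free_cumulant \<psi> (map a (clist v W)) = kappa \<psi> a W"
      by (simp add: kappa_def)
  qed
  finally show ?thesis .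
qed

text \<open>The sum over the partitions of an arc is again a moment, so the system closes up on
  moments. Here even arcs that wrap around are read in increasing order, because the free formula
  lists every block increasingly.\<close>

lemma free_moment_by_block:
  assumes "\<psi> 1 = 1" "finite S" "p \<in> S"
  shows "moment \<psi> a S =
    (\<Sum>V | p \<in> V \<and> V \<subseteq> S. kappa \<psi> a V * (\<Prod>v\<in>V. moment \<psi> a (arc S V v)))"
  using assms by (simp add: moment_nc_sum nc_sum_by_block finite_arc)

text \<open>\<open>W\<close> is non-empty and hence lies in only one arc, which makes the definite
  description in \<open>arc_order\<close> well defined.\<close>

lemma arc_order_conv_clist:
  assumes V: "V \<subseteq> {..<n}" and v: "v \<in> V" and W: "W \<subseteq> arc {..<n} V v" "W \<noteq> {}"
  shows "arc_order n V W = clist v W"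
proof -
  have fin: "finite (arc {..<n} V u)" for u by auto
  have set_arc: "set (cyclic_arc n V u) = arc {..<n} V u" if "u \<in> V" for u
  proof -
    have "u \<notin> arc {..<n} V u"
      using that by (simp add: arc_def)
    then show ?thesis
      using cyclic_arc_conv_clist[of u n V] that V set_clist[OF fin] by auto
  qed
  have uniq: "u = v" if "u \<in> V" "W \<subseteq> arc {..<n} V u" for u
  proof -
    obtain x where "x \<in> W"
      using W by blast
    with W that show ?thesis
      using arcs_disjoint[of x "{..<n}" V u v] v by blast
  qed
  have "(THE u. u \<in> V \<and> W \<subseteq> set (cyclic_arc n V u)) = v"
  proof (rule the_equality)
    show "v \<in> V \<and> W \<subseteq> set (cyclic_arc n V v)"
      using set_arc v W by simp
    show "u = v" if "u \<in> V \<and> W \<subseteq> set (cyclic_arc n V u)" for u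
      using that set_arc[of u] uniq[of u] by simp
  qed
  then have "arc_order n V W = filter (\<lambda>w. w \<in> W) (clist v (arc {..<n} V v))"
    using cyclic_arc_conv_clist[of v n V] v V by (auto simp: arc_order_def)
  also have "\<dots> = clist v W"
    by (rule filter_clist) (use v W in \<open>auto simp: arc_def\<close>)
  finally show ?thesis .
qed

lemma sum_NC_with_block:
  assumes "\<psi> 1 = 1" and V: "V \<subseteq> {..<length as}" "V \<noteq> {}"
  shows "(\<Sum>\<pi> | \<pi> \<in> NC (length as) \<and> V \<in> \<pi>.
      \<Prod>W\<in>\<pi> - {V}. free_cumulant \<psi> (map ((!) as) (arc_order (length as) V W))) =
    (\<Prod>v\<in>V. cyclic_moment \<psi> ((!) as) v (arc {..<length as} V v))"
proof -
  let ?n = "length as"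
  let ?f = "\<lambda>W. free_cumulant \<psi> (map ((!) as) (arc_order ?n V W))"
  have "nc_sum (arc {..<?n} V v) ?f = cyclic_moment \<psi> ((!) as) v (arc {..<?n} V v)" if "v \<in> V" for v
  proof -
    have "nc_sum (arc {..<?n} V v) ?f =
        nc_sum (arc {..<?n} V v) (\<lambda>W. free_cumulant \<psi> (map ((!) as) (clist v W)))"
      using arc_order_conv_clist[OF V(1) that] by (intro nc_sum_cong) simp
    also have "\<dots> = cyclic_moment \<psi> ((!) as) v (arc {..<?n} V v)"
      by (rule cyclic_moment_nc_sum[symmetric]) (use assms that in \<open>auto simp: arc_def\<close>)
    finally show ?thesis .
  qed
  then show ?thesis
    unfolding NC_conv_ncp sum_ncp_with_block[OF V finite_lessThan] by (rule prod.cong[OF refl])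
qed

text \<open>Exchanging the sum over partitions with the sum over the block that carries
  \<open>Dkappa\<close> leaves, for each \<open>V\<close>, the partitions that contain it, and these
  factorise over the arcs.\<close>

lemma cyclic_moment_by_block_list:
  assumes "\<psi> 1 = 1" "as \<noteq> []"
  shows "\<omega> (prod_list as) = \<omega> 1 * cyclic_boolean_on \<psi> ((!) as) {..<length as} +
    (\<Sum>V\<in>Pow {..<length as} - {{}}. Dkappa \<psi> \<omega> ((!) as) V *
       (\<Prod>v\<in>V. cyclic_moment \<psi> ((!) as) v (arc {..<length as} V v)))"
proof -
  let ?n = "length as" and ?P = "Pow {..<length as} - {{}}"
  let ?D = "\<lambda>V. cyclic_free_cumulant \<psi> \<omega> (nths as V)"
  let ?K = "\<lambda>\<pi> V. \<Prod>W\<in>\<pi> - {V}. free_cumulant \<psi> (map ((!) as) (arc_order (length as) V W))"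
  have "(\<Sum>\<pi>\<in>NC ?n. cyclic_block_sum (free_cumulant \<psi>) (cyclic_free_cumulant \<psi> \<omega>) \<pi> as) =
      (\<Sum>\<pi>\<in>NC ?n. \<Sum>V | V \<in> ?P \<and> V \<in> \<pi>. ?D V * ?K \<pi> V)"
  proof (rule sum.cong[OF refl])
    fix \<pi> assume "\<pi> \<in> NC ?n"
    then have "\<pi> \<subseteq> ?P"
      by (auto simp: NC_def partition_on_def)
    then have "{V. V \<in> ?P \<and> V \<in> \<pi>} = \<pi>"
      by blast
    then show "cyclic_block_sum (free_cumulant \<psi>) (cyclic_free_cumulant \<psi> \<omega>) \<pi> as =
        (\<Sum>V | V \<in> ?P \<and> V \<in> \<pi>. ?D V * ?K \<pi> V)"
      unfolding cyclic_block_sum_def by presburger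
  qed
  also have "\<dots> = (\<Sum>V\<in>?P. \<Sum>\<pi> | \<pi> \<in> NC ?n \<and> V \<in> \<pi>. ?D V * ?K \<pi> V)"
    by (rule sum.swap_restrict) (auto simp: finite_NC)
  also have "\<dots> = (\<Sum>V\<in>?P. Dkappa \<psi> \<omega> ((!) as) V *
       (\<Prod>v\<in>V. cyclic_moment \<psi> ((!) as) v (arc {..<?n} V v)))"
  proof (rule sum.cong[OF refl])
    fix V assume "V \<in> ?P"
    then have V: "V \<subseteq> {..<?n}" "V \<noteq> {}" by auto
    show "(\<Sum>\<pi> | \<pi> \<in> NC ?n \<and> V \<in> \<pi>. ?D V * ?K \<pi> V) = Dkappa \<psi> \<omega> ((!) as) V *
       (\<Prod>v\<in>V. cyclic_moment \<psi> ((!) as) v (arc {..<?n} V v))"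
      unfolding sum_distrib_left[symmetric] sum_NC_with_block[where as = as and \<psi> = \<psi>, OF assms(1) V]
      by (simp add: Dkappa_def nths_conv_slist[OF V(1)])
  qed
  finally have "(\<Sum>\<pi>\<in>NC ?n. cyclic_block_sum (free_cumulant \<psi>) (cyclic_free_cumulant \<psi> \<omega>) \<pi> as) = \<dots>" .
  moreover have "cyclic_boolean \<psi> as = cyclic_boolean_on \<psi> ((!) as) {..<?n}"
    unfolding cyclic_boolean_def cyclic_boolean_on_def
  proof (intro sum.cong prod.cong refl)
    fix V i assume "V \<in> ?P" "i \<in> V"
    then show "boolean_cumulant \<psi> (map ((!) as) (i # cyclic_arc ?n V i)) =
        boolean_cumulant \<psi> (map ((!) as) (i # clist i (arc {..<?n} V i)))"
      using cyclic_arc_conv_clist[of i ?n V] by auto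
  qed
  ultimately show ?thesis
    using cyclic_moment_cumulant[OF assms(2), of \<omega> \<psi>] by simp
qed

section \<open>Transport along maps that preserve the cyclic order\<close>

lemma sum_Pow_image:
  assumes "inj_on g A"
  shows "(\<Sum>V\<in>Pow (g ` A) - {{}}. h V) = (\<Sum>V\<in>Pow A - {{}}. h (g ` V))"
proof -
  have "inj_on ((`) g) (Pow A - {{}})"
    using inj_on_image_Pow[OF assms] by (rule inj_on_subset) auto
  moreover have "(`) g ` (Pow A - {{}}) = Pow (g ` A) - {{}}"
  proof (intro set_eqI iffI)
    fix X assume "X \<in> Pow (g ` A) - {{}}"
    then obtain Y where "Y \<subseteq> A" "X = g ` Y" "X \<noteq> {}"
      using subset_imageE by (metis DiffE PowD singletonI)
    then show "X \<in> (`) g ` (Pow A - {{}})"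
      by blast
  qed auto
  ultimately show ?thesis
    by (metis (no_types, lifting) sum.reindex_cong)
qed

lemma arc_not_self: "v \<in> V \<Longrightarrow> v \<notin> arc S V v"
  by (simp add: arc_def)

lemma clist_arc_image:
  assumes "cyc_preserving g S" "finite S" "V \<subseteq> S" "v \<in> V"
  shows "clist (g v) (arc (g ` S) (g ` V) (g v)) = map g (clist v (arc S V v))"
proof -
  have "v \<in> S"
    using assms by blast
  moreover have "arc S V v \<subseteq> S"
    using arc_subset by blast
  ultimately show ?thesis
    using map_clist[OF assms(1), of v "arc S V v"] arc_image[OF assms(1,3), of v] assms
      arc_not_self[of v V S] finite_arc[of S V v] by simp
qed

lemma cyclic_boolean_on_image:
  assumes g: "cyc_preserving g S" "finite S"
  shows "cyclic_boolean_on \<psi> a (g ` S) = cyclic_boolean_on \<psi> (a \<circ> g) S"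
proof -
  have inj: "inj_on g S"
    using g by (simp add: cyc_preserving_def)
  show ?thesis
    unfolding cyclic_boolean_on_def sum_Pow_image[OF inj]
  proof (rule sum.cong[OF refl])
    fix V assume "V \<in> Pow S - {{}}"
    then have V: "V \<subseteq> S" by auto
    show "(\<Prod>v\<in>g ` V. boolean_cumulant \<psi> (map a (v # clist v (arc (g ` S) (g ` V) v)))) =
        (\<Prod>v\<in>V. boolean_cumulant \<psi> (map (a \<circ> g) (v # clist v (arc S V v))))"
      unfolding prod.reindex[OF inj_on_subset[OF inj V]]
      using clist_arc_image[OF g V] by (intro prod.cong) simp_all
  qed
qed

lemma cyclic_moments_image:
  assumes g: "cyc_preserving g S" "finite S" "V \<subseteq> S"
  shows "(\<Prod>v\<in>g ` V. cyclic_moment \<phi> a v (arc (g ` S) (g ` V) v)) =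
    (\<Prod>v\<in>V. cyclic_moment \<phi> (a \<circ> g) v (arc S V v))"
proof -
  have inj: "inj_on g V"
    using g inj_on_subset by (auto simp: cyc_preserving_def)
  show ?thesis
    unfolding prod.reindex[OF inj]
    using clist_arc_image[OF g] by (intro prod.cong) (simp_all add: cyclic_moment_def)
qed

lemma map_slist_nth:
  assumes "finite S" "V \<subseteq> {..<card S}"
  shows "map ((!) (map a (slist S))) (slist V) = map a (slist ((!) (slist S) ` V))"
proof -
  have fin: "finite V"
    using assms(2) finite_subset by blast
  have "map ((!) (map a (slist S))) (slist V) = map a (map ((!) (slist S)) (slist V))"
    using assms fin by (auto simp: subset_iff)
  also have "map ((!) (slist S)) (slist V) = slist ((!) (slist S) ` V)"
    by (rule map_slist[OF strict_mono_on_nth_slist]) (use assms fin in auto)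
  finally show ?thesis .
qed

lemma clist_cong_map: "finite R \<Longrightarrow> (\<And>x. x \<in> R \<Longrightarrow> a x = b x) \<Longrightarrow> map a (clist v R) = map b (clist v R)"
  by (auto simp: clist_def)

lemma cyclic_moment_cong: "finite R \<Longrightarrow> (\<And>x. x \<in> R \<Longrightarrow> a x = b x) \<Longrightarrow> cyclic_moment \<phi> a v R = cyclic_moment \<phi> b v R"
  unfolding cyclic_moment_def by (subst clist_cong_map[of R a b]) simp_all

lemma moment_cong: "finite R \<Longrightarrow> (\<And>x. x \<in> R \<Longrightarrow> a x = b x) \<Longrightarrow> moment \<phi> a R = moment \<phi> b R"
  unfolding moment_def by (rule arg_cong[of _ _ "\<lambda>l. \<phi> (prod_list l)"]) simp

lemma Dkappa_cong: "finite R \<Longrightarrow> (\<And>x. x \<in> R \<Longrightarrow> a x = b x) \<Longrightarrow> Dkappa \<psi> \<omega> a R = Dkappa \<psi> \<omega> b R"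
  unfolding Dkappa_def by (rule arg_cong[of _ _ "cyclic_free_cumulant \<psi> \<omega>"]) simp

lemma cyclic_boolean_on_cong:
  assumes "finite S" "\<And>x. x \<in> S \<Longrightarrow> a x = b x"
  shows "cyclic_boolean_on \<psi> a S = cyclic_boolean_on \<psi> b S"
  unfolding cyclic_boolean_on_def
proof (intro sum.cong prod.cong refl)
  fix V v assume "V \<in> Pow S - {{}}" "v \<in> V"
  then have "map a (v # clist v (arc S V v)) = map b (v # clist v (arc S V v))"
    using assms arc_subset[of S V v] clist_cong_map[of "arc S V v" a b v] by auto
  then show "boolean_cumulant \<psi> (map a (v # clist v (arc S V v))) =
      boolean_cumulant \<psi> (map b (v # clist v (arc S V v)))"
    by (rule arg_cong)
qed

lemma cyclic_moment_by_block:
  assumes "\<psi> 1 = 1" "finite S" "S \<noteq> {}"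
  shows "moment \<omega> a S = \<omega> 1 * cyclic_boolean_on \<psi> a S +
    (\<Sum>V\<in>Pow S - {{}}. Dkappa \<psi> \<omega> a V * (\<Prod>v\<in>V. cyclic_moment \<psi> a v (arc S V v)))"
proof -
  \<comment> \<open>The increasing enumeration of \<open>S\<close> preserves the cyclic order, so
    the formula for lists carries over to arbitrary finite sets of positions.\<close>
  define g where "g = (!) (slist S)"
  let ?N = "{..<card S}"
  define as where "as = map a (slist S)"
  have as: "length as = card S" "as \<noteq> []"
    using assms by (auto simp: as_def)
  have g: "cyc_preserving g ?N" "g ` ?N = S" "inj_on g ?N"
    using assms strict_mono_on_nth_slist[of S] image_nth_slist[of S]
    by (auto simp: g_def cyc_preserving_strict_mono strict_mono_on_imp_inj_on)
  have ag: "as ! i = (a \<circ> g) i" if "i < card S" for i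
    using that by (simp add: as_def g_def)
  have "moment \<omega> a S = \<omega> (prod_list as)"
    by (simp add: moment_def as_def)
  also have "\<dots> = \<omega> 1 * cyclic_boolean_on \<psi> ((!) as) ?N +
    (\<Sum>V\<in>Pow ?N - {{}}. Dkappa \<psi> \<omega> ((!) as) V *
       (\<Prod>v\<in>V. cyclic_moment \<psi> ((!) as) v (arc ?N V v)))"
    using cyclic_moment_by_block_list[where as = as and \<omega> = \<omega> and \<psi> = \<psi>, OF assms(1) as(2)] unfolding as(1) .
  also have "cyclic_boolean_on \<psi> ((!) as) ?N = cyclic_boolean_on \<psi> a S"
    using cyclic_boolean_on_image[OF g(1), of \<psi> a] cyclic_boolean_on_cong[of ?N "(!) as" "a \<circ> g"] ag g(2)
    by simp
  also have "(\<Sum>V\<in>Pow ?N - {{}}. Dkappa \<psi> \<omega> ((!) as) V *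
       (\<Prod>v\<in>V. cyclic_moment \<psi> ((!) as) v (arc ?N V v))) =
     (\<Sum>V\<in>Pow ?N - {{}}. Dkappa \<psi> \<omega> a (g ` V) *
       (\<Prod>v\<in>g ` V. cyclic_moment \<psi> a v (arc S (g ` V) v)))"
  proof (rule sum.cong[OF refl])
    fix V assume "V \<in> Pow ?N - {{}}"
    then have V: "V \<subseteq> ?N" by auto
    have "Dkappa \<psi> \<omega> ((!) as) V = Dkappa \<psi> \<omega> a (g ` V)"
      by (simp only: Dkappa_def as_def g_def map_slist_nth[OF assms(2) V])
    moreover have "(\<Prod>v\<in>V. cyclic_moment \<psi> ((!) as) v (arc ?N V v)) =
        (\<Prod>v\<in>V. cyclic_moment \<psi> (a \<circ> g) v (arc ?N V v))"
      by (intro prod.cong refl cyclic_moment_cong) (use ag in \<open>auto simp: arc_def\<close>)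
    ultimately show "Dkappa \<psi> \<omega> ((!) as) V * (\<Prod>v\<in>V. cyclic_moment \<psi> ((!) as) v (arc ?N V v)) =
      Dkappa \<psi> \<omega> a (g ` V) * (\<Prod>v\<in>g ` V. cyclic_moment \<psi> a v (arc S (g ` V) v))"
      using cyclic_moments_image[OF g(1) _ V, of \<psi> a] g(2) by simp
  qed
  also have "\<dots> = (\<Sum>V\<in>Pow S - {{}}. Dkappa \<psi> \<omega> a V * (\<Prod>v\<in>V. cyclic_moment \<psi> a v (arc S V v)))"
    by (rule sum_Pow_image[OF g(3), unfolded g(2), symmetric])
  finally show ?thesis .
qed

section \<open>Arcs at two adjacent positions\<close>

text \<open>The first premise says that \<open>p\<close> is the next position clockwise after
  \<open>m\<close>. It covers neighbours \<open>m < p\<close> as well as the last position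
  \<open>m\<close> followed by the first position \<open>p\<close>.\<close>

lemma arc_adjacent_first:
  assumes "\<forall>x\<in>S. \<not> cyc m x p" "m \<noteq> p" "m \<in> U" "p \<in> U"
  shows "arc S U m = {}"
proof -
  have False if "x \<in> arc S U m" for x
  proof -
    have "x \<in> S" "x \<noteq> m" "x \<noteq> p" "\<not> cyc m p x"
      using that assms by (auto simp: arc_def)
    then show False
      using assms cyc_total[of m p x] by auto
  qed
  then show ?thesis by blast
qed

text \<open>Once \<open>p\<close> is deleted, the walk from \<open>m\<close> continues into what was
  the arc of \<open>p\<close>.\<close>

lemma arc_adjacent_second:
  assumes adj: "\<forall>x\<in>S. \<not> cyc m x p" and U: "m \<noteq> p" "m \<in> U" "p \<in> U" "U \<subseteq> S"
  shows "arc S U p = arc (S - {p}) (U - {p}) m"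
proof -
  have "cyc p u x \<longleftrightarrow> u \<noteq> p \<and> cyc m u x" if "x \<in> S" "x \<notin> U" "u \<in> U" for u x
  proof -
    have "\<not> cyc m x p" "\<not> cyc m u p" "x \<noteq> m" "x \<noteq> p" "x \<noteq> u"
      using that U adj by auto
    note h = this
    show ?thesis
    proof (cases "u = m \<or> u = p")
      case True
      with h(1) show ?thesis
        by (auto simp: cyc_def)
    next
      case False
      then have "cyc m p x" "cyc m p u"
        using h \<open>m \<noteq> p\<close> cyc_total[of m p x] cyc_total[of m p u] by blast+
      then have "cyc m u x" if "cyc p u x"
        using that unfolding cyc_def by (elim disjE conjE) simp_all
      moreover have "cyc p u x" if "cyc m u x"
        using cyc_trans[OF \<open>cyc m p u\<close> that] .
      ultimately show ?thesis
        using False by blast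
    qed
  qed
  then show ?thesis
    using U by (auto simp: arc_def)
qed

text \<open>A walk from \<open>v\<close> reaches \<open>m\<close> before \<open>p\<close>, so
  \<open>p\<close> never ends an arc that \<open>m\<close> has not ended already.\<close>

lemma arc_adjacent_other:
  assumes adj: "\<forall>x\<in>S. \<not> cyc m x p" and U: "m \<noteq> p" "m \<in> U" "p \<in> U" "U \<subseteq> S"
    and v: "v \<in> U" "v \<noteq> m" "v \<noteq> p"
  shows "arc S U v = arc (S - {p}) (U - {p}) v"
proof -
  have "cyc v m x" if "x \<in> S" "x \<notin> U" "cyc v p x" for x
  proof -
    have "\<not> cyc m v p"
      using that U v adj by auto
    then have "cyc m p v"
      using \<open>m \<noteq> p\<close> v cyc_total[of m p v] by auto
    with \<open>cyc v p x\<close> show ?thesis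
      unfolding cyc_def by (elim disjE conjE) simp_all
  qed
  then show ?thesis
    using U by (auto simp: arc_def)
qed

text \<open>On its own, \<open>arc S V m\<close> is a small circle whose end is joined to its first
  position \<open>p\<close>. As \<open>p \<in> W\<close>, the arc of the last element of
  \<open>W\<close> stops at this joint and takes in nothing new.\<close>

lemma arc_nested_inner:
  assumes adj: "\<forall>x\<in>S. \<not> cyc m x p" and V: "m \<in> V" "V \<subseteq> S"
    and W: "p \<in> W" "W \<subseteq> arc S V m" "w \<in> W"
  shows "arc S (V \<union> W) w = arc (arc S V m) W w"
proof (intro set_eqI iffI)
  have w: "w \<in> S" "w \<notin> V" "w \<noteq> m" "\<And>u. u \<in> V \<Longrightarrow> \<not> cyc m u w"
    and p: "p \<in> S" "p \<notin> V" "p \<noteq> m" "\<And>u. u \<in> V \<Longrightarrow> \<not> cyc m u p"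
    using W V by (auto simp: arc_def)
  fix x
  {
    assume "x \<in> arc S (V \<union> W) w"
    then have x: "x \<in> S" "x \<notin> V" "x \<notin> W" "\<And>u. u \<in> V \<union> W \<Longrightarrow> \<not> cyc w u x"
      by (auto simp: arc_def)
    have "\<not> cyc m u x" if "u \<in> V" for u
    proof -
      have "\<not> cyc m u w" "\<not> cyc w u x" "x \<noteq> w" "u \<noteq> w"
        using that x w W by auto
      with \<open>w \<noteq> m\<close> show ?thesis
        unfolding cyc_def by presburger
    qed
    with x show "x \<in> arc (arc S V m) W w"
      by (auto simp: arc_def)
  next
    assume "x \<in> arc (arc S V m) W w"
    then have x: "x \<in> S" "x \<notin> V" "x \<notin> W" "\<And>u. u \<in> V \<Longrightarrow> \<not> cyc m u x"
        "\<And>u. u \<in> W \<Longrightarrow> \<not> cyc w u x"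
      by (auto simp: arc_def)
    have "\<not> cyc w u x" if "u \<in> V" for u
    proof -
      have "\<not> cyc m u w" "\<not> cyc m u x" "\<not> cyc w p x" "\<not> cyc m x p" "\<not> cyc m w p"
          "x \<noteq> w" "x \<noteq> p" "x \<noteq> m" "u \<noteq> w" "u \<noteq> x"
        using that x w p W V adj by auto
      note h = this
      show ?thesis
      proof
        \<comment> \<open>If \<open>u\<close> came between \<open>w\<close> and \<open>x\<close>,
          then \<open>x\<close> would precede \<open>w\<close> in the arc of \<open>m\<close>. That
          arc begins with \<open>p\<close>, so \<open>p\<close> would lie between \<open>w\<close>
          and \<open>x\<close>.\<close>
        assume c: "cyc w u x"
        have "cyc m x w"
        proof (cases "u = m")
          case True
          with c show ?thesis
            by (auto simp: cyc_def)
        next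
          case False
          then have "cyc m w u" "cyc m x u"
            using h \<open>w \<noteq> m\<close> cyc_total[of m u w] cyc_total[of m u x] by blast+
          with c show ?thesis
            unfolding cyc_def by (elim disjE conjE) simp_all
        qed
        moreover have "cyc m p x"
          using h(4,7,8) \<open>p \<noteq> m\<close> cyc_total[of m p x] by blast
        ultimately have "cyc w p x"
          unfolding cyc_def by (elim disjE conjE) simp_all
        then show False
          using h(3) by blast
      qed
    qed
    with x show "x \<in> arc S (V \<union> W) w"
      by (auto simp: arc_def)
  }
qed

text \<open>A walk from \<open>v\<close> that reaches \<open>W\<close> has passed \<open>m\<close>
  before.\<close>

lemma arc_nested_outer:
  assumes V: "m \<in> V" "V \<subseteq> S" and W: "W \<subseteq> arc S V m" and v: "v \<in> V" "v \<noteq> m"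
  shows "arc S (V \<union> W) v = arc S V v"
proof (intro set_eqI iffI)
  fix x assume x: "x \<in> arc S V v"
  have "x \<notin> W"
    using arcs_disjoint[OF x, of m] W V v by blast
  moreover have "\<not> cyc v w x" if "w \<in> W" for w
  proof -
    have "w \<in> arc S V m"
      using W that by blast
    then have "\<not> cyc m v w" "\<not> cyc v m x" "x \<noteq> m" "x \<noteq> v" "w \<noteq> v" "w \<noteq> m"
      using x v V by (auto simp: arc_def)
    with \<open>v \<noteq> m\<close> show ?thesis
      unfolding cyc_def by presburger
  qed
  ultimately show "x \<in> arc S (V \<union> W) v"
    using x by (auto simp: arc_def)
qed (auto simp: arc_def)

text \<open>Deleting \<open>p\<close> removes the empty arc of \<open>m\<close> and hands the arc of
  \<open>p\<close> to \<open>m\<close>. The base point is an argument of \<open>M\<close> because a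
  clockwise reading depends on it; hence the condition that \<open>m\<close> and \<open>p\<close>
  give this arc the same value.\<close>

lemma prod_arcs_delete:
  fixes M :: "nat \<Rightarrow> nat set \<Rightarrow> complex"
  assumes adj: "\<forall>x\<in>S. \<not> cyc m x p" and U: "m \<noteq> p" "m \<in> U" "p \<in> U" "U \<subseteq> S" "finite S"
    and M: "M m {} = 1" "M m (arc S U p) = M p (arc S U p)"
  shows "(\<Prod>v\<in>U - {p}. M v (arc (S - {p}) (U - {p}) v)) = (\<Prod>v\<in>U. M v (arc S U v))"
proof -
  have fin: "finite U"
    using U finite_subset by blast
  have "(\<Prod>v\<in>U. M v (arc S U v)) = M p (arc S U p) * (\<Prod>v\<in>U - {p}. M v (arc S U v))"
    using prod.remove[OF fin \<open>p \<in> U\<close>] by simp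
  also have "(\<Prod>v\<in>U - {p}. M v (arc S U v)) =
      M m (arc S U m) * (\<Prod>v\<in>U - {p} - {m}. M v (arc S U v))"
    by (rule prod.remove) (use fin U in auto)
  also have "(\<Prod>v\<in>U - {p} - {m}. M v (arc S U v)) =
      (\<Prod>v\<in>U - {p} - {m}. M v (arc (S - {p}) (U - {p}) v))"
    using arc_adjacent_other[OF adj U(1-4)] by (intro prod.cong) auto
  also have "M p (arc S U p) * (M m (arc S U m) * \<dots>) =
      M m (arc (S - {p}) (U - {p}) m) * \<dots>"
    using arc_adjacent_first[OF adj U(1-3)] arc_adjacent_second[OF adj U(1-4)] M by simp
  also have "\<dots> = (\<Prod>v\<in>U - {p}. M v (arc (S - {p}) (U - {p}) v))"
    by (rule prod.remove[symmetric]) (use fin U in auto)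
  finally show ?thesis ..
qed

text \<open>Adding \<open>W\<close> empties the arc of \<open>m\<close>, since \<open>p\<close>
  follows at once, and replaces its factor by those of the arcs that \<open>W\<close> cuts out of
  it.\<close>

lemma prod_arcs_nested:
  fixes M :: "nat \<Rightarrow> nat set \<Rightarrow> complex"
  assumes adj: "\<forall>x\<in>S. \<not> cyc m x p" and V: "m \<in> V" "V \<subseteq> S" "finite S"
    and W: "p \<in> W" "W \<subseteq> arc S V m" and M: "M m {} = 1"
  shows "(\<Prod>v\<in>V \<union> W. M v (arc S (V \<union> W) v)) =
    (\<Prod>v\<in>V - {m}. M v (arc S V v)) * (\<Prod>w\<in>W. M w (arc (arc S V m) W w))"
proof -
  have WV: "W \<inter> V = {}"
    using W by (auto simp: arc_def)
  have fin: "finite V" "finite W"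
    using V W finite_subset finite_arc by blast+
  have "m \<noteq> p"
    using WV V W by blast
  have "(\<Prod>v\<in>V \<union> W. M v (arc S (V \<union> W) v)) =
      (\<Prod>v\<in>V. M v (arc S (V \<union> W) v)) * (\<Prod>v\<in>W. M v (arc S (V \<union> W) v))"
    by (rule prod.union_disjoint) (use fin WV in auto)
  also have "(\<Prod>v\<in>V. M v (arc S (V \<union> W) v)) =
      M m (arc S (V \<union> W) m) * (\<Prod>v\<in>V - {m}. M v (arc S (V \<union> W) v))"
    by (rule prod.remove) (use fin V in auto)
  also have "arc S (V \<union> W) m = {}"
    by (rule arc_adjacent_first[OF adj \<open>m \<noteq> p\<close>]) (use V W in auto)
  also have "(\<Prod>v\<in>V - {m}. M v (arc S (V \<union> W) v)) = (\<Prod>v\<in>V - {m}. M v (arc S V v))"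
    using arc_nested_outer[OF V(1,2) W(2)] by (intro prod.cong) auto
  also have "(\<Prod>v\<in>W. M v (arc S (V \<union> W) v)) = (\<Prod>w\<in>W. M w (arc (arc S V m) W w))"
    using arc_nested_inner[OF adj V(1,2) W] by (intro prod.cong) auto
  finally show ?thesis
    using M by simp
qed

section \<open>Multiplying two consecutive arguments of a moment\<close>

lemma moment_empty: "\<psi> 1 = 1 \<Longrightarrow> moment \<psi> a {} = 1"
  by (simp add: moment_def)

lemma slist_split:
  assumes "finite S" "m \<in> S"
  shows "slist S = slist {x \<in> S. x < m} @ m # slist {x \<in> S. m < x}"
  by (rule slist_eqI[symmetric]) (use assms in \<open>auto simp: sorted_wrt_append\<close>)

lemma slist_split2:
  assumes "finite S" "m \<in> S" "p \<in> S" "m < p" "\<And>x. x \<in> S \<Longrightarrow> \<not> (m < x \<and> x < p)"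
  shows "slist S = slist {x \<in> S. x < m} @ [m, p] @ slist {x \<in> S. p < x}"
proof (rule slist_eqI[symmetric])
  have "x < m \<or> x = m \<or> x = p \<or> p < x" if "x \<in> S" for x
    using assms(4) assms(5)[OF that] by linarith
  then show "set (slist {x \<in> S. x < m} @ [m, p] @ slist {x \<in> S. p < x}) = S"
    using assms by auto
qed (use assms in \<open>auto simp: sorted_wrt_append\<close>)

lemma moment_merge:
  fixes a :: "nat \<Rightarrow> 'a::ring_1"
  assumes "finite S" "m \<in> S" "p \<in> S" "m < p" "\<And>x. x \<in> S \<Longrightarrow> \<not> (m < x \<and> x < p)"
  shows "moment \<phi> (a(m := a m * a p)) (S - {p}) = moment \<phi> a S"
proof -
  let ?b = "a(m := a m * a p)"
  have "{x \<in> S - {p}. x < m} = {x \<in> S. x < m}" "{x \<in> S - {p}. m < x} = {x \<in> S. p < x}"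
    using assms by (auto simp: linorder_neq_iff)
  then have "slist (S - {p}) = slist {x \<in> S. x < m} @ m # slist {x \<in> S. p < x}"
    using slist_split[of "S - {p}" m] assms by auto
  moreover have "map ?b (slist {x \<in> S. x < m}) = map a (slist {x \<in> S. x < m})"
    "map ?b (slist {x \<in> S. p < x}) = map a (slist {x \<in> S. p < x})"
    using assms by auto
  ultimately show ?thesis
    using slist_split2[OF assms] by (simp add: moment_def mult.assoc del: map_eq_conv)
qed

section \<open>Free cumulants with products as arguments\<close>

lemma sum_nested_blocks:
  fixes h :: "nat set \<Rightarrow> nat set \<Rightarrow> complex"
  assumes "finite S" "m \<in> S" "p \<in> S" "m \<noteq> p"
    and G: "\<And>V. G S V \<subseteq> S - V" "\<And>U V. U \<subseteq> S \<Longrightarrow> G U V = G S V \<inter> U"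
  shows "(\<Sum>V | m \<in> V \<and> V \<subseteq> S - {p}. \<Sum>W | p \<in> W \<and> W \<subseteq> G S V. h V W) =
    (\<Sum>U | m \<in> U \<and> p \<in> U \<and> U \<subseteq> S. \<Sum>V | m \<in> V \<and> V \<subseteq> U - {p} \<and> U - V \<subseteq> G U V. h V (U - V))"
proof -
  have fin: "finite {X. P X \<and> X \<subseteq> T}" if "finite T" for P and T :: "nat set"
    using that by (rule finite_subset[rotated, OF finite_Pow_iff[THEN iffD2]]) auto
  have "(\<Sum>V | m \<in> V \<and> V \<subseteq> S - {p}. \<Sum>W | p \<in> W \<and> W \<subseteq> G S V. h V W) =
      (\<Sum>(V, W)\<in>(SIGMA V:{V. m \<in> V \<and> V \<subseteq> S - {p}}. {W. p \<in> W \<and> W \<subseteq> G S V}). h V W)"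
    by (rule sum.Sigma) (use assms(1) finite_subset[OF G(1)] in \<open>auto intro!: fin\<close>)
  also have "\<dots> = (\<Sum>(U, V)\<in>(SIGMA U:{U. m \<in> U \<and> p \<in> U \<and> U \<subseteq> S}.
      {V. m \<in> V \<and> V \<subseteq> U - {p} \<and> U - V \<subseteq> G U V}). h V (U - V))"
  proof (rule sum.reindex_bij_witness[where j = "\<lambda>(V, W). (V \<union> W, V)" and i = "\<lambda>(U, V). (V, U - V)"],
      goal_cases)
    case (1 x)
    then have "snd x \<subseteq> G S (fst x)"
      by auto
    then have "fst x \<union> snd x - fst x = snd x"
      using G(1)[of "fst x"] by blast
    then show ?case by (simp add: case_prod_beta)
  next
    case (2 x)
    then have "m \<in> fst x" "fst x \<subseteq> S - {p}" "p \<in> snd x" "snd x \<subseteq> G S (fst x)"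
      by auto
    then show ?case
      using G(1)[of "fst x"] G(2)[of "fst x \<union> snd x" "fst x"] by (auto simp: case_prod_beta)
  next
    case (3 x)
    then show ?case by auto
  next
    case (4 x)
    then show ?case using G(2)[of "fst x" "snd x"] by auto
  next
    case (5 x)
    then have "snd x \<subseteq> G S (fst x)"
      by auto
    then have "fst x \<union> snd x - fst x = snd x"
      using G(1)[of "fst x"] by blast
    then show ?case by (simp add: case_prod_beta)
  qed
  also have "\<dots> = (\<Sum>U | m \<in> U \<and> p \<in> U \<and> U \<subseteq> S.
      \<Sum>V | m \<in> V \<and> V \<subseteq> U - {p} \<and> U - V \<subseteq> G U V. h V (U - V))"
  proof (rule sum.Sigma[symmetric])
    show "finite {U. m \<in> U \<and> p \<in> U \<and> U \<subseteq> S}"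
      using fin[OF assms(1), of "\<lambda>U. m \<in> U \<and> p \<in> U"] by simp
    show "\<forall>U\<in>{U. m \<in> U \<and> p \<in> U \<and> U \<subseteq> S}. finite {V. m \<in> V \<and> V \<subseteq> U - {p} \<and> U - V \<subseteq> G U V}"
    proof
      fix U assume "U \<in> {U. m \<in> U \<and> p \<in> U \<and> U \<subseteq> S}"
      then have "finite (Pow U)"
        using assms(1) finite_subset by auto
      then show "finite {V. m \<in> V \<and> V \<subseteq> U - {p} \<and> U - V \<subseteq> G U V}"
        by (rule finite_subset[rotated]) auto
    qed
  qed
  finally show ?thesis .
qed

text \<open>Refining by a block through \<open>p\<close> turns a sum over sets that avoid
  \<open>p\<close> into one over sets \<open>U\<close> that contain both positions, with weights
  \<open>T U\<close>. In this form its coefficients can be compared with those of other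
  expansions.\<close>

lemma sum_refined_blocks:
  fixes d k T :: "nat set \<Rightarrow> complex"
  assumes S: "finite S" "m \<in> S" "p \<in> S" "m \<noteq> p"
    and G: "\<And>V. G S V \<subseteq> S - V" "\<And>U V. U \<subseteq> S \<Longrightarrow> G U V = G S V \<inter> U"
    and T: "\<And>V. m \<in> V \<Longrightarrow> V \<subseteq> S - {p} \<Longrightarrow> T V = (\<Sum>W | p \<in> W \<and> W \<subseteq> G S V. k W * T (V \<union> W))"
  shows "(\<Sum>V | m \<in> V \<and> V \<subseteq> S - {p}. d V * T V) = (\<Sum>U | m \<in> U \<and> p \<in> U \<and> U \<subseteq> S.
    (\<Sum>V | m \<in> V \<and> V \<subseteq> U - {p} \<and> U - V \<subseteq> G U V. d V * k (U - V)) * T U)"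
proof -
  have "(\<Sum>V | m \<in> V \<and> V \<subseteq> S - {p}. d V * T V) =
      (\<Sum>V | m \<in> V \<and> V \<subseteq> S - {p}. \<Sum>W | p \<in> W \<and> W \<subseteq> G S V. d V * (k W * T (V \<union> W)))"
  proof (rule sum.cong[OF refl])
    fix V assume "V \<in> {V. m \<in> V \<and> V \<subseteq> S - {p}}"
    then show "d V * T V = (\<Sum>W | p \<in> W \<and> W \<subseteq> G S V. d V * (k W * T (V \<union> W)))"
      using T[of V] by (simp add: sum_distrib_left)
  qed
  also have "\<dots> = (\<Sum>U | m \<in> U \<and> p \<in> U \<and> U \<subseteq> S. \<Sum>V | m \<in> V \<and> V \<subseteq> U - {p} \<and> U - V \<subseteq> G U V.
      d V * (k (U - V) * T (V \<union> (U - V))))"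
    by (rule sum_nested_blocks[OF S G])
  also have "\<dots> = (\<Sum>U | m \<in> U \<and> p \<in> U \<and> U \<subseteq> S.
      (\<Sum>V | m \<in> V \<and> V \<subseteq> U - {p} \<and> U - V \<subseteq> G U V. d V * k (U - V)) * T U)"
    unfolding sum_distrib_right
  proof (intro sum.cong refl)
    fix U V assume "V \<in> {V. m \<in> V \<and> V \<subseteq> U - {p} \<and> U - V \<subseteq> G U V}"
    then have "V \<union> (U - V) = U" by blast
    then show "d V * (k (U - V) * T (V \<union> (U - V))) = d V * k (U - V) * T U"
      by simp
  qed
  finally show ?thesis .
qed

text \<open>Here \<open>k\<close> stands for \<open>kappa\<close> of a family with the entry 1 at
  \<open>p\<close>: the second block can only be \<open>{p}\<close>, which leaves a single
  term.\<close>

lemma sum_singleton_complement: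
  fixes d k :: "nat set \<Rightarrow> complex"
  assumes S: "finite S" "m \<in> S" "p \<in> S" "m \<noteq> p" and adj: "\<And>u. u \<in> S \<Longrightarrow> \<not> cyc m u p"
    and k: "\<And>W. p \<in> W \<Longrightarrow> W \<subseteq> S - {m} \<Longrightarrow> k W = (if W = {p} then 1 else 0)"
  shows "(\<Sum>V | m \<in> V \<and> V \<subseteq> S - {p} \<and> S - V \<subseteq> arc S V m. d V * k (S - V)) = d (S - {p})"
    (is "(\<Sum>V\<in>?X. _) = _")
proof -
  have fin: "finite ?X"
    by (rule finite_subset[of _ "Pow S"]) (use S in auto)
  have "(\<Sum>V\<in>?X. d V * k (S - V)) = (\<Sum>V\<in>?X. if V = S - {p} then d (S - {p}) else 0)"
  proof (rule sum.cong[OF refl])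
    fix V assume V: "V \<in> ?X"
    then have "k (S - V) = (if S - V = {p} then 1 else 0)"
      using S by (intro k) auto
    moreover have "S - V = {p} \<longleftrightarrow> V = S - {p}"
      using V S by auto
    ultimately show "d V * k (S - V) = (if V = S - {p} then d (S - {p}) else 0)"
      by simp
  qed
  moreover have "S - {p} \<in> ?X"
    using adj S by (auto simp: arc_def)
  ultimately show ?thesis
    using fin by simp
qed

lemma sum_insert_block:
  assumes "finite S" "p \<in> S" "m \<noteq> p"
  shows "(\<Sum>V | m \<in> V \<and> V \<subseteq> S - {p}. h V) = (\<Sum>U | m \<in> U \<and> p \<in> U \<and> U \<subseteq> S. h (U - {p}))"
  by (rule sum.reindex_bij_witness[where j = "insert p" and i = "\<lambda>U. U - {p}"])
     (use assms in \<open>auto simp: insert_absorb subset_Diff_insert\<close>)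

lemma sum_split_block:
  fixes h :: "nat set \<Rightarrow> complex"
  assumes "finite S"
  shows "(\<Sum>V | m \<in> V \<and> V \<subseteq> S. h V) =
    (\<Sum>V | m \<in> V \<and> p \<in> V \<and> V \<subseteq> S. h V) + (\<Sum>V | m \<in> V \<and> V \<subseteq> S - {p}. h V)"
proof -
  have "{V. m \<in> V \<and> V \<subseteq> S} = {V. m \<in> V \<and> p \<in> V \<and> V \<subseteq> S} \<union> {V. m \<in> V \<and> V \<subseteq> S - {p}}"
    by auto
  moreover have "finite {V. m \<in> V \<and> p \<in> V \<and> V \<subseteq> S}" "finite {V. m \<in> V \<and> V \<subseteq> S - {p}}"
    by (rule finite_subset[of _ "Pow S"]; use assms in auto)+
  moreover have "{V. m \<in> V \<and> p \<in> V \<and> V \<subseteq> S} \<inter> {V. m \<in> V \<and> V \<subseteq> S - {p}} = {}"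
    by auto
  ultimately show ?thesis
    by (simp add: sum.union_disjoint)
qed

text \<open>The weights \<open>T\<close> belong to the top set \<open>S\<close>, so only the
  coefficient of \<open>S\<close> is read off; for smaller sets the vanishing is supplied by an
  induction hypothesis.\<close>

lemma triangular_system:
  fixes T h :: "nat set \<Rightarrow> complex"
  assumes "finite S" "P S" "(\<Sum>U | P U \<and> U \<subseteq> S. h U * T U) = 0" "T S = 1"
    and "\<And>U. P U \<Longrightarrow> U \<subset> S \<Longrightarrow> h U = 0"
  shows "h S = 0"
proof -
  have "(\<Sum>U | P U \<and> U \<subseteq> S. h U * T U) = (\<Sum>U\<in>{S}. h U * T U)"
  proof (rule sum.mono_neutral_right)
    show "finite {U. P U \<and> U \<subseteq> S}"
      by (rule finite_subset[of _ "Pow S"]) (use assms in auto)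
    show "\<forall>U\<in>{U. P U \<and> U \<subseteq> S} - {S}. h U * T U = 0"
      using assms(5) by auto
  qed (use assms in auto)
  with assms show ?thesis by simp
qed

definition arc_moments :: "('a::ring_1 \<Rightarrow> complex) \<Rightarrow> (nat \<Rightarrow> 'a) \<Rightarrow> nat set \<Rightarrow> nat set \<Rightarrow> complex" where
  "arc_moments \<psi> a S V = (\<Prod>v\<in>V. moment \<psi> a (arc S V v))"

text \<open>The position \<open>p\<close> comes first in the arc of \<open>m\<close>; the moment of
  this arc is expanded along the block through \<open>p\<close>.\<close>

lemma arc_moments_refine:
  assumes \<psi>: "\<psi> 1 = 1" and adj: "\<forall>x\<in>S. \<not> cyc m x p" and S: "finite S" "p \<in> S"
    and V: "m \<in> V" "V \<subseteq> S - {p}"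
  shows "arc_moments \<psi> a S V =
    (\<Sum>W | p \<in> W \<and> W \<subseteq> arc S V m. kappa \<psi> a W * arc_moments \<psi> a S (V \<union> W))"
proof -
  have finV: "finite V"
    using V S(1) finite_subset by blast
  have "p \<in> arc S V m"
    using V adj S(2) by (auto simp: arc_def)
  then have "moment \<psi> a (arc S V m) = (\<Sum>W | p \<in> W \<and> W \<subseteq> arc S V m.
      kappa \<psi> a W * (\<Prod>w\<in>W. moment \<psi> a (arc (arc S V m) W w)))"
    using free_moment_by_block[where \<psi> = \<psi>, OF \<psi>, of "arc S V m" p a] S(1) by blast
  moreover have "arc_moments \<psi> a S V = (\<Prod>v\<in>V - {m}. moment \<psi> a (arc S V v)) * moment \<psi> a (arc S V m)"
    unfolding arc_moments_def using prod.remove[OF finV V(1), of "\<lambda>v. moment \<psi> a (arc S V v)"]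
    by (simp add: mult.commute)
  ultimately have "arc_moments \<psi> a S V = (\<Sum>W | p \<in> W \<and> W \<subseteq> arc S V m. (\<Prod>v\<in>V - {m}. moment \<psi> a (arc S V v)) *
      (kappa \<psi> a W * (\<Prod>w\<in>W. moment \<psi> a (arc (arc S V m) W w))))"
    by (simp add: sum_distrib_left)
  also have "\<dots> = (\<Sum>W | p \<in> W \<and> W \<subseteq> arc S V m. kappa \<psi> a W * arc_moments \<psi> a S (V \<union> W))"
  proof (rule sum.cong[OF refl])
    fix W assume "W \<in> {W. p \<in> W \<and> W \<subseteq> arc S V m}"
    then have "arc_moments \<psi> a S (V \<union> W) = (\<Prod>v\<in>V - {m}. moment \<psi> a (arc S V v)) *
        (\<Prod>w\<in>W. moment \<psi> a (arc (arc S V m) W w))"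
      unfolding arc_moments_def
      by (intro prod_arcs_nested[OF adj, of V W "\<lambda>_. moment \<psi> a"])
         (use V S(1) \<psi> in \<open>auto simp: moment_empty\<close>)
    then show "(\<Prod>v\<in>V - {m}. moment \<psi> a (arc S V v)) *
        (kappa \<psi> a W * (\<Prod>w\<in>W. moment \<psi> a (arc (arc S V m) W w))) = kappa \<psi> a W * arc_moments \<psi> a S (V \<union> W)"
      by simp
  qed
  finally show ?thesis .
qed

text \<open>
  The pairs \<open>V\<close>, \<open>S - V\<close> are the two-block non-crossing partitions of \<open>S\<close> that separate
  \<open>m\<close> from \<open>p\<close>.
\<close>

lemma kappa_merge:
  fixes a :: "nat \<Rightarrow> 'a::ring_1"
  assumes \<psi>: "\<psi> 1 = 1"
    and "finite S" "m \<in> S" "p \<in> S" "m < p" "\<And>x. x \<in> S \<Longrightarrow> \<not> (m < x \<and> x < p)"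
  shows "kappa \<psi> (a(m := a m * a p)) (S - {p}) = kappa \<psi> a S +
    (\<Sum>V | m \<in> V \<and> V \<subseteq> S - {p} \<and> S - V \<subseteq> arc S V m. kappa \<psi> a V * kappa \<psi> a (S - V))"
  using assms(2-)
proof (induction S rule: finite_psubset_induct)
  case (psubset S)
  let ?b = "a(m := a m * a p)"
  let ?spl = "\<lambda>U. \<Sum>V | m \<in> V \<and> V \<subseteq> U - {p} \<and> U - V \<subseteq> arc U V m. kappa \<psi> a V * kappa \<psi> a (U - V)"
  define T where "T = arc_moments \<psi> a S"
  have mp: "m \<noteq> p" and adj: "\<forall>x\<in>S. \<not> cyc m x p"
    using psubset.prems by (auto simp: cyc_def)
  \<comment> \<open>Both moments are expanded around the block through \<open>m\<close>. For the
    merged family, adjoining \<open>p\<close> to this block does not change the product over its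
    arcs.\<close>
  have "moment \<psi> ?b (S - {p}) = (\<Sum>V | m \<in> V \<and> V \<subseteq> S - {p}.
      kappa \<psi> ?b V * (\<Prod>v\<in>V. moment \<psi> ?b (arc (S - {p}) V v)))"
    by (rule free_moment_by_block) (use psubset \<psi> mp in auto)
  also have "\<dots> = (\<Sum>U | m \<in> U \<and> p \<in> U \<and> U \<subseteq> S.
      kappa \<psi> ?b (U - {p}) * (\<Prod>v\<in>U - {p}. moment \<psi> ?b (arc (S - {p}) (U - {p}) v)))"
    by (rule sum_insert_block) (use psubset mp in auto)
  also have "\<dots> = (\<Sum>U | m \<in> U \<and> p \<in> U \<and> U \<subseteq> S. kappa \<psi> ?b (U - {p}) * T U)"
  proof (rule sum.cong[OF refl])
    fix U assume "U \<in> {U. m \<in> U \<and> p \<in> U \<and> U \<subseteq> S}"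
    then have U: "m \<in> U" "p \<in> U" "U \<subseteq> S" by auto
    have "moment \<psi> ?b (arc (S - {p}) (U - {p}) v) = moment \<psi> a (arc (S - {p}) (U - {p}) v)" for v
      by (rule moment_cong) (use psubset.hyps U mp in \<open>auto simp: arc_def\<close>)
    moreover have "(\<Prod>v\<in>U - {p}. moment \<psi> a (arc (S - {p}) (U - {p}) v)) = T U"
      unfolding T_def arc_moments_def
      by (rule prod_arcs_delete[OF adj mp U psubset.hyps, of "\<lambda>_. moment \<psi> a"])
         (simp_all add: moment_empty \<psi>)
    ultimately show "kappa \<psi> ?b (U - {p}) * (\<Prod>v\<in>U - {p}. moment \<psi> ?b (arc (S - {p}) (U - {p}) v)) =
        kappa \<psi> ?b (U - {p}) * T U"
      by simp
  qed
  finally have eq1: "moment \<psi> a S = (\<Sum>U | m \<in> U \<and> p \<in> U \<and> U \<subseteq> S. kappa \<psi> ?b (U - {p}) * T U)"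
    using moment_merge[where a = a and \<phi> = \<psi>, OF psubset.hyps psubset.prems] by simp
  have refine: "T V = (\<Sum>W | p \<in> W \<and> W \<subseteq> arc S V m. kappa \<psi> a W * T (V \<union> W))"
    if "m \<in> V" "V \<subseteq> S - {p}" for V
    unfolding T_def by (rule arc_moments_refine) (use adj psubset \<psi> that in auto)
  have "moment \<psi> a S = (\<Sum>V | m \<in> V \<and> V \<subseteq> S. kappa \<psi> a V * T V)"
    unfolding T_def arc_moments_def by (rule free_moment_by_block) (use psubset \<psi> in auto)
  also have "\<dots> = (\<Sum>V | m \<in> V \<and> p \<in> V \<and> V \<subseteq> S. kappa \<psi> a V * T V) +
      (\<Sum>V | m \<in> V \<and> V \<subseteq> S - {p}. kappa \<psi> a V * T V)"
    by (rule sum_split_block[OF psubset.hyps])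
  \<comment> \<open>A block with \<open>m\<close> but without \<open>p\<close> has \<open>p\<close>
    at the head of the arc of \<open>m\<close>; expanding this arc around \<open>p\<close> produces
    the two-block terms.\<close>
  also have "(\<Sum>V | m \<in> V \<and> V \<subseteq> S - {p}. kappa \<psi> a V * T V) =
      (\<Sum>U | m \<in> U \<and> p \<in> U \<and> U \<subseteq> S. ?spl U * T U)"
    by (rule sum_refined_blocks) (use psubset.hyps psubset.prems mp refine in \<open>auto simp: arc_def\<close>)
  finally have eq2: "moment \<psi> a S = (\<Sum>U | m \<in> U \<and> p \<in> U \<and> U \<subseteq> S. (kappa \<psi> a U + ?spl U) * T U)"
    by (simp add: sum.distrib distrib_right)
  have "kappa \<psi> ?b (S - {p}) - (kappa \<psi> a S + ?spl S) = 0"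
  proof (rule triangular_system[where P = "\<lambda>U. m \<in> U \<and> p \<in> U"
        and h = "\<lambda>U. kappa \<psi> ?b (U - {p}) - (kappa \<psi> a U + ?spl U)" and T = T])
    show "(\<Sum>U | (m \<in> U \<and> p \<in> U) \<and> U \<subseteq> S. (kappa \<psi> ?b (U - {p}) - (kappa \<psi> a U + ?spl U)) * T U) = 0"
      using eq1 eq2 by (simp add: left_diff_distrib sum_subtractf)
    show "T S = 1"
      by (simp add: T_def arc_moments_def moment_empty \<psi>)
    show "kappa \<psi> ?b (U - {p}) - (kappa \<psi> a U + ?spl U) = 0" if "m \<in> U \<and> p \<in> U" "U \<subset> S" for U
    proof -
      have "\<not> (m < x \<and> x < p)" if "x \<in> U" for x
        using psubset.prems(4)[of x] that \<open>U \<subset> S\<close> by blast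
      then have "kappa \<psi> ?b (U - {p}) = kappa \<psi> a U + ?spl U"
        by (intro psubset.IH[OF that(2) _ _ psubset.prems(3)]) (use that(1) in auto)
      then show ?thesis
        by (simp only: diff_self)
    qed
  qed (use psubset in auto)
  then show ?case
    by (rule eq_iff_diff_eq_0[THEN iffD2])
qed

section \<open>Units and multilinearity\<close>

lemma kappa_singleton:
  assumes "\<psi> 1 = 1"
  shows "kappa \<psi> a {k} = \<psi> (a k)"
proof -
  have "{V. k \<in> V \<and> V \<subseteq> {k}} = {{k}}"
    by auto
  then show ?thesis
    using free_moment_by_block[where \<psi> = \<psi>, OF assms, of "{k}" k a] moment_empty[where \<psi> = \<psi>, OF assms]
    by (simp add: moment_def)
qed

text \<open>Multiplying the 1 into a neighbour deletes it, so by \<open>kappa_merge\<close> the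
  cumulant without the 1 equals \<open>kappa \<psi> a S\<close> plus the two-block terms. By
  induction only the term with the block \<open>{k}\<close> survives, and it too is the cumulant
  without the 1.\<close>

lemma kappa_one:
  fixes a :: "nat \<Rightarrow> 'a::ring_1"
  assumes \<psi>: "\<psi> 1 = 1" and "finite S" "k \<in> S" "a k = 1" "S \<noteq> {k}"
  shows "kappa \<psi> a S = 0"
  using assms(2-)
proof (induction S rule: finite_psubset_induct)
  case (psubset S)
  have k1: "kappa \<psi> a {k} = 1"
    using kappa_singleton[where \<psi> = \<psi>, OF \<psi>] psubset.prems \<psi> by simp
  have IH: "kappa \<psi> a U = (if U = {k} then 1 else 0)" if "k \<in> U" "U \<subset> S" for U
    using psubset.IH[OF that(2,1)] psubset.prems k1 by auto
  show ?case
  proof (cases "\<exists>x\<in>S. x < k")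
    case True
    define m where "m = Max {x \<in> S. x < k}"
    have "m \<in> {x \<in> S. x < k}"
      unfolding m_def by (rule Max_in) (use True psubset.hyps in auto)
    then have m: "m \<in> S" "m < k" by auto
    have gap: "\<not> (m < x \<and> x < k)" if "x \<in> S" for x
    proof
      assume "m < x \<and> x < k"
      moreover from this have "x \<le> m"
        unfolding m_def by (intro Max_ge) (use that psubset.hyps in auto)
      ultimately show False by simp
    qed
    have sum: "(\<Sum>V | m \<in> V \<and> V \<subseteq> S - {k} \<and> S - V \<subseteq> arc S V m. kappa \<psi> a V * kappa \<psi> a (S - V)) =
        kappa \<psi> a (S - {k})"
    proof (rule sum_singleton_complement[OF psubset.hyps m(1) psubset.prems(1)])
      show "\<not> cyc m u k" if "u \<in> S" for u
        using gap[OF that] m by (auto simp: cyc_def)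
      show "kappa \<psi> a W = (if W = {k} then 1 else 0)" if "k \<in> W" "W \<subseteq> S - {m}" for W
        by (rule IH) (use that m in auto)
    qed (use m in simp)
    have "a(m := a m * a k) = a"
      using psubset.prems by auto
    then show ?thesis
      using kappa_merge[where \<psi> = \<psi> and a = a, OF \<psi> psubset.hyps m(1) psubset.prems(1) m(2) gap] sum by simp
  next
    case False
    \<comment> \<open>Without a left neighbour, the 1 at \<open>k\<close> is multiplied by its right
      neighbour, and \<open>{k}\<close> becomes the block of the left factor.\<close>
    define p where "p = Min {x \<in> S. k < x}"
    have kmin: "k \<le> x" if "x \<in> S" for x
      using False that by (auto simp: not_less)
    have "p \<in> {x \<in> S. k < x}"
      unfolding p_def
    proof (rule Min_in)
      obtain x where "x \<in> S" "x \<noteq> k"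
        using psubset.prems by blast
      then show "{x \<in> S. k < x} \<noteq> {}"
        using kmin[of x] by auto
    qed (use psubset.hyps in auto)
    then have p: "p \<in> S" "k < p" by auto
    have gap: "\<not> (k < x \<and> x < p)" if "x \<in> S" for x
    proof
      assume "k < x \<and> x < p"
      moreover from this have "p \<le> x"
        unfolding p_def by (intro Min_le) (use that psubset.hyps in auto)
      ultimately show False by simp
    qed
    let ?X = "{V. k \<in> V \<and> V \<subseteq> S - {p} \<and> S - V \<subseteq> arc S V k}"
    have "(\<Sum>V\<in>?X. kappa \<psi> a V * kappa \<psi> a (S - V)) =
        (\<Sum>V\<in>?X. if V = {k} then kappa \<psi> a (S - {k}) else 0)"
    proof (rule sum.cong[OF refl])
      fix V assume V: "V \<in> ?X"
      then have "kappa \<psi> a V = (if V = {k} then 1 else 0)"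
        using psubset.prems p by (intro IH) auto
      then show "kappa \<psi> a V * kappa \<psi> a (S - V) = (if V = {k} then kappa \<psi> a (S - {k}) else 0)"
        by simp
    qed
    also have "\<dots> = kappa \<psi> a (S - {k})"
    proof -
      have "finite ?X"
        by (rule finite_subset[of _ "Pow S"]) (use psubset.hyps in auto)
      moreover have "{k} \<in> ?X"
        using p psubset.prems by (auto simp: arc_def cyc_def)
      ultimately show ?thesis by simp
    qed
    finally have sum: "(\<Sum>V\<in>?X. kappa \<psi> a V * kappa \<psi> a (S - V)) = kappa \<psi> a (S - {k})" .
    \<comment> \<open>Position \<open>k\<close> takes over the value at \<open>p\<close>: the two
      sets differ, but the lists of their values agree.\<close>
    have "kappa \<psi> (a(k := a k * a p)) (S - {p}) = kappa \<psi> a (S - {k})"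
    proof -
      let ?R = "{x \<in> S. p < x}"
      have cases: "x = k \<or> x = p \<or> p < x" if "x \<in> S" for x
        using kmin[OF that] gap[OF that] by linarith
      have "slist (S - {p}) = k # slist ?R"
        by (rule slist_eqI[symmetric]) (use cases p psubset in auto)
      moreover have "slist (S - {k}) = p # slist ?R"
        by (rule slist_eqI[symmetric]) (use cases p psubset in auto)
      moreover have "map (a(k := a k * a p)) (slist ?R) = map a (slist ?R)"
        using p psubset.hyps by auto
      ultimately show ?thesis
        using psubset.prems by (simp add: kappa_def del: map_eq_conv)
    qed
    then show ?thesis
      using kappa_merge[where \<psi> = \<psi> and a = a, OF \<psi> psubset.hyps psubset.prems(1) p(1) p(2) gap] sum by simp
  qed
qed

section \<open>Multilinearity and centring\<close>

context unital_complex_algebra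
begin

lemma prod_list_linear:
  assumes "distinct xs" "k \<in> set xs"
  shows "prod_list (map (a(k := x + c *s y)) xs) =
    prod_list (map (a(k := x)) xs) + c *s prod_list (map (a(k := y)) xs)"
proof -
  obtain us vs where xs: "xs = us @ k # vs"
    using assms(2) by (meson split_list)
  then have "k \<notin> set us" "k \<notin> set vs"
    using assms(1) by auto
  then show ?thesis
    by (simp add: xs scale_mult_left scale_mult_right algebra_simps)
qed

lemma functional_linear:
  assumes "linear_functional scale \<phi>"
  shows "\<phi> (x + c *s y) = \<phi> x + c * \<phi> y"
proof -
  interpret f: Vector_Spaces.linear scale "(*)" \<phi>
    using assms by (simp add: linear_functional_def)
  show ?thesis
    by (simp add: f.add f.scale)
qed

lemma moment_linear:
  assumes "linear_functional scale \<phi>" "finite S" "k \<in> S"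
  shows "moment \<phi> (a(k := x + c *s y)) S = moment \<phi> (a(k := x)) S + c * moment \<phi> (a(k := y)) S"
  unfolding moment_def
  by (subst prod_list_linear) (use assms in \<open>simp_all add: functional_linear\<close>)

lemma cyclic_moment_linear:
  assumes "linear_functional scale \<phi>" "finite R" "k \<in> R" "v \<notin> R"
  shows "cyclic_moment \<phi> (a(k := x + c *s y)) v R =
    cyclic_moment \<phi> (a(k := x)) v R + c * cyclic_moment \<phi> (a(k := y)) v R"
  unfolding cyclic_moment_def
  by (subst prod_list_linear)
     (use assms set_clist[of R v] in \<open>simp_all add: functional_linear distinct_clist\<close>)

text \<open>Expanding around the block that contains \<open>k\<close> keeps \<open>k\<close> out of
  all arcs. The weights are then common constants, and linearity passes from the moment to the top
  coefficient.\<close>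

lemma kappa_linear:
  assumes \<psi>: "linear_functional scale \<psi>" "\<psi> 1 = 1" and "finite S" "k \<in> S"
  shows "kappa \<psi> (a(k := x + c *s y)) S = kappa \<psi> (a(k := x)) S + c * kappa \<psi> (a(k := y)) S"
  using assms(3-)
proof (induction S rule: finite_psubset_induct)
  case (psubset S)
  define T where "T V = (\<Prod>v\<in>V. moment \<psi> a (arc S V v))" for V
  let ?X = "{V. k \<in> V \<and> V \<subseteq> S} - {S}"
  have eq: "kappa \<psi> (a(k := z)) S = moment \<psi> (a(k := z)) S - (\<Sum>V\<in>?X. kappa \<psi> (a(k := z)) V * T V)" for z
  proof -
    have fin: "finite {V. k \<in> V \<and> V \<subseteq> S}"
      by (rule finite_subset[of _ "Pow S"]) (use psubset.hyps in auto)
    have "moment \<psi> (a(k := z)) S = (\<Sum>V | k \<in> V \<and> V \<subseteq> S. kappa \<psi> (a(k := z)) V *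
        (\<Prod>v\<in>V. moment \<psi> (a(k := z)) (arc S V v)))"
      by (rule free_moment_by_block) (use \<psi> psubset in auto)
    also have "\<dots> = (\<Sum>V | k \<in> V \<and> V \<subseteq> S. kappa \<psi> (a(k := z)) V * T V)"
      unfolding T_def
      by (intro sum.cong refl arg_cong2[where f = "(*)"] prod.cong moment_cong)
         (use psubset.hyps in \<open>auto simp: arc_def\<close>)
    also have "\<dots> = kappa \<psi> (a(k := z)) S * T S + (\<Sum>V\<in>?X. kappa \<psi> (a(k := z)) V * T V)"
      by (rule sum.remove[OF fin]) (use psubset.prems in auto)
    finally show ?thesis
      by (simp add: T_def moment_empty \<psi>)
  qed
  have "kappa \<psi> (a(k := x + c *s y)) V * T V =
      kappa \<psi> (a(k := x)) V * T V + c * (kappa \<psi> (a(k := y)) V * T V)" if "V \<in> ?X" for V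
  proof -
    have "kappa \<psi> (a(k := x + c *s y)) V = kappa \<psi> (a(k := x)) V + c * kappa \<psi> (a(k := y)) V"
      by (rule psubset.IH) (use that in auto)
    then show ?thesis
      by (simp add: algebra_simps)
  qed
  then have "(\<Sum>V\<in>?X. kappa \<psi> (a(k := x + c *s y)) V * T V) =
      (\<Sum>V\<in>?X. kappa \<psi> (a(k := x)) V * T V) + c * (\<Sum>V\<in>?X. kappa \<psi> (a(k := y)) V * T V)"
    by (simp add: sum.distrib sum_distrib_left)
  moreover have "moment \<psi> (a(k := x + c *s y)) S =
      moment \<psi> (a(k := x)) S + c * moment \<psi> (a(k := y)) S"
    by (rule moment_linear) (use \<psi> psubset in auto)
  ultimately show ?case
    unfolding eq by (simp add: algebra_simps)
qed

text \<open>Shifting one entry by a multiple of 1 adds a term that has 1 as an entry and so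
  vanishes; the entries are shifted one at a time.\<close>

lemma centering:
  fixes F :: "(nat \<Rightarrow> 'a) \<Rightarrow> complex"
  assumes lin: "\<And>a k x c y. k \<in> S \<Longrightarrow> F (a(k := x + c *s y)) = F (a(k := x)) + c * F (a(k := y))"
    and one: "\<And>a k. k \<in> S \<Longrightarrow> a k = 1 \<Longrightarrow> F a = 0"
    and "finite S" "X \<subseteq> S"
  shows "F (\<lambda>i. if i \<in> X then a i + t i *s 1 else a i) = F a"
  using \<open>finite S\<close>[THEN finite_subset[OF \<open>X \<subseteq> S\<close>]] \<open>X \<subseteq> S\<close>
proof (induction X rule: finite_induct)
  case (insert k X)
  let ?b = "\<lambda>i. if i \<in> X then a i + t i *s 1 else a i"
  have "(\<lambda>i. if i \<in> insert k X then a i + t i *s 1 else a i) = ?b(k := a k + t k *s 1)"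
    by auto
  moreover have "?b(k := a k) = ?b"
    using insert.hyps by auto
  ultimately show ?case
    using lin[of k ?b "a k" "t k" 1] one[of k "?b(k := 1)"] insert by auto
qed simp

end

section \<open>Boolean cumulants\<close>

lemma nths_atLeastLessThan: "k \<le> length as \<Longrightarrow> nths as {k..<length as} = drop k as"
proof -
  assume "k \<le> length as"
  have "nths as {k..<length as} = map ((!) as) [k..<length as]"
    by (subst nths_conv_slist) (auto simp: sorted_list_of_set_range)
  also have "\<dots> = drop k as"
    by (rule nth_equalityI) auto
  finally show ?thesis .
qed

lemma nths_take:
  assumes "W \<subseteq> {..<k}" "k \<le> length as"
  shows "nths as W = nths (take k as) W"
proof -
  have fin: "finite W"
    using assms(1) finite_subset by blast
  have "nths as W = map ((!) as) (slist W)"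
    by (rule nths_conv_slist) (use assms in auto)
  also have "\<dots> = map ((!) (take k as)) (slist W)"
    using assms fin by auto
  also have "\<dots> = nths (take k as) W"
    by (rule nths_conv_slist[symmetric]) (use assms in auto)
  finally show ?thesis .
qed

text \<open>
  Splitting off the last block, unlike the first, leaves an initial segment of the positions, so
  the recursion needs no shift of indices.
\<close>

lemma sum_interval_partitions_last:
  assumes "\<psi> 1 = 1" "k < length as"
  shows "(\<Sum>\<pi> | \<pi> \<in> interval_partitions (length as) \<and> {k..<length as} \<in> \<pi>.
      \<Prod>V\<in>\<pi>. boolean_cumulant \<psi> (nths as V)) =
    \<psi> (prod_list (take k as)) * boolean_cumulant \<psi> (drop k as)"
proof -
  let ?n = "length as" and ?B = "{k..<length as}"
  have B: "\<exists>i j. ?B = {i..j}"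
    by (rule exI[of _ k], rule exI[of _ "?n - 1"]) (use assms(2) in auto)
  have rest: "{..<?n} - ?B = {..<k}"
    using assms(2) by auto
  have notin: "?B \<notin> \<sigma>" if "\<sigma> \<in> interval_partitions k" for \<sigma>
  proof
    assume "?B \<in> \<sigma>"
    then have "?B \<subseteq> {..<k}"
      using that unfolding interval_partitions_def partition_on_def by blast
    then show False
      using assms(2) by auto
  qed
  have ins: "insert ?B \<sigma> \<in> interval_partitions ?n" if \<sigma>: "\<sigma> \<in> interval_partitions k" for \<sigma>
  proof -
    have "\<Union>\<sigma> = {..<k}"
      using \<sigma> by (simp add: interval_partitions_def partition_on_def)
    then have "disjnt ?B (\<Union>\<sigma>)"
      by (auto simp: disjnt_def)
    then have "partition_on {..<?n} (insert ?B \<sigma>)"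
      using \<sigma> assms(2) partition_on_insert[of ?B \<sigma> "{..<?n}"] rest
      by (auto simp: interval_partitions_def)
    with \<sigma> B show ?thesis
      unfolding interval_partitions_def by blast
  qed
  have del: "\<pi> - {?B} \<in> interval_partitions k" if "\<pi> \<in> interval_partitions ?n" "?B \<in> \<pi>" for \<pi>
  proof -
    have p: "partition_on {..<?n} \<pi>"
      using that by (simp add: interval_partitions_def)
    have "disjnt ?B X" if "X \<in> \<pi> - {?B}" for X
      using p that \<open>?B \<in> \<pi>\<close> by (auto simp: partition_on_def pairwise_def)
    then have "disjnt ?B (\<Union>(\<pi> - {?B}))"
      by (simp add: disjnt_def) blast
    moreover have "insert ?B (\<pi> - {?B}) = \<pi>"
      using that by blast
    ultimately have "partition_on {..<k} (\<pi> - {?B})"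
      using p partition_on_insert[of ?B "\<pi> - {?B}" "{..<?n}"] unfolding rest by simp
    with that show ?thesis
      unfolding interval_partitions_def by blast
  qed
  have "(\<Sum>\<pi> | \<pi> \<in> interval_partitions ?n \<and> ?B \<in> \<pi>. \<Prod>V\<in>\<pi>. boolean_cumulant \<psi> (nths as V)) =
      (\<Sum>\<sigma>\<in>interval_partitions k.
        (\<Prod>V\<in>\<sigma>. boolean_cumulant \<psi> (nths (take k as) V)) * boolean_cumulant \<psi> (drop k as))"
  proof (rule sum.reindex_bij_witness[where i = "insert ?B" and j = "\<lambda>\<pi>. \<pi> - {?B}"], goal_cases)
    case (1 \<pi>)
    then show ?case by blast
  next
    case (2 \<pi>)
    then show ?case using del by blast
  next
    case (3 \<sigma>)
    then show ?case using notin by blast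
  next
    case (4 \<sigma>)
    then show ?case using ins by blast
  next
    case (5 \<pi>)
    then have \<pi>: "\<pi> \<in> interval_partitions ?n" "?B \<in> \<pi>" by auto
    then have "finite \<pi>"
      using finite_elements[of "{..<?n}" \<pi>] by (simp add: interval_partitions_def)
    then have "(\<Prod>V\<in>\<pi>. boolean_cumulant \<psi> (nths as V)) =
        boolean_cumulant \<psi> (drop k as) * (\<Prod>V\<in>\<pi> - {?B}. boolean_cumulant \<psi> (nths as V))"
      using prod.remove[OF _ \<pi>(2), of "\<lambda>V. boolean_cumulant \<psi> (nths as V)"] assms(2)
      by (simp add: nths_atLeastLessThan)
    moreover have "nths as V = nths (take k as) V" if "V \<in> \<pi> - {?B}" for V
    proof (rule nths_take)
      show "V \<subseteq> {..<k}"
        using del[OF \<pi>] that unfolding interval_partitions_def partition_on_def by blast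
    qed (use assms in auto)
    ultimately show ?case
      by (simp add: mult.commute)
  qed
  also have "(\<Sum>\<sigma>\<in>interval_partitions k.
        (\<Prod>V\<in>\<sigma>. boolean_cumulant \<psi> (nths (take k as) V)) * boolean_cumulant \<psi> (drop k as)) =
      \<psi> (prod_list (take k as)) * boolean_cumulant \<psi> (drop k as)"
  proof (cases "k = 0")
    case True
    \<comment> \<open>The empty prefix has one empty partition, in accordance with
      \<open>\<psi> 1 = 1\<close>.\<close>
    have "interval_partitions 0 = {{}}"
      by (auto simp: interval_partitions_def partition_on_empty)
    with True assms show ?thesis by simp
  next
    case False
    then have "take k as \<noteq> []"
      using assms by auto
    from boolean_moment_cumulant[OF this, of \<psi>] assms(2) show ?thesis
      by (simp add: sum_distrib_right)
  qed
  finally show ?thesis .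
qed

text \<open>The last position lies in exactly one block, a final segment starting at some
  \<open>k\<close>; the partitions of the positions before \<open>k\<close> sum to the moment of the
  prefix.\<close>

lemma boolean_moment_last:
  assumes "\<psi> 1 = 1" "as \<noteq> []"
  shows "\<psi> (prod_list as) =
    (\<Sum>k<length as. \<psi> (prod_list (take k as)) * boolean_cumulant \<psi> (drop k as))"
proof -
  let ?n = "length as"
  let ?f = "\<lambda>\<pi>. \<Prod>V\<in>\<pi>. boolean_cumulant \<psi> (nths as V)"
  have uniq: "\<exists>k. {k. k \<in> {..<?n} \<and> {k..<?n} \<in> \<pi>} = {k}" if \<pi>: "\<pi> \<in> interval_partitions ?n" for \<pi>
  proof -
    have p: "partition_on {..<?n} \<pi>"
      using \<pi> by (simp add: interval_partitions_def)
    then obtain V where V: "V \<in> \<pi>" "?n - 1 \<in> V" "V \<subseteq> {..<?n}"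
      using assms(2) unfolding partition_on_def by (metis UnionE Union_upper diff_less length_greater_0_conv lessThan_iff zero_less_one)
    then obtain i j where "V = {i..j}"
      using \<pi> unfolding interval_partitions_def by blast
    with V have i: "V = {i..<?n}" "i < ?n"
      using assms(2) by auto
    have "k = i" if "k < ?n" "{k..<?n} \<in> \<pi>" for k
    proof -
      have "?n - 1 \<in> {k..<?n}"
        using that(1) by auto
      then have "{k..<?n} \<inter> V \<noteq> {}"
        using V(2) by blast
      then have "{k..<?n} = V"
        using p that V unfolding partition_on_def disjoint_def by blast
      then show ?thesis
        using i that by (simp add: atLeastLessThan_eq_iff)
    qed
    moreover have "{i..<?n} \<in> \<pi>"
      using i V(1) by simp
    ultimately have "{k. k \<in> {..<?n} \<and> {k..<?n} \<in> \<pi>} = {i}"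
      using i(2) by blast
    then show ?thesis by blast
  qed
  have "\<psi> (prod_list as) = (\<Sum>\<pi>\<in>interval_partitions ?n. \<Sum>k | k \<in> {..<?n} \<and> {k..<?n} \<in> \<pi>. ?f \<pi>)"
    unfolding boolean_moment_cumulant[OF assms(2), of \<psi>]
  proof (rule sum.cong[OF refl])
    fix \<pi> assume "\<pi> \<in> interval_partitions ?n"
    then obtain k where "{k. k \<in> {..<?n} \<and> {k..<?n} \<in> \<pi>} = {k}"
      using uniq by blast
    then show "?f \<pi> = (\<Sum>k | k \<in> {..<?n} \<and> {k..<?n} \<in> \<pi>. ?f \<pi>)"
      by simp
  qed
  also have "\<dots> = (\<Sum>k\<in>{..<?n}. \<Sum>\<pi> | \<pi> \<in> interval_partitions ?n \<and> {k..<?n} \<in> \<pi>. ?f \<pi>)"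
    by (rule sum.swap_restrict) (auto simp: finite_interval_partitions)
  also have "\<dots> = (\<Sum>k<?n. \<psi> (prod_list (take k as)) * boolean_cumulant \<psi> (drop k as))"
    by (intro sum.cong refl sum_interval_partitions_last) (use assms in auto)
  finally show ?thesis .
qed

lemma boolean_cumulant_rec:
  assumes "\<psi> 1 = 1" "as \<noteq> []"
  shows "boolean_cumulant \<psi> as = \<psi> (prod_list as) -
    (\<Sum>k\<in>{0<..<length as}. \<psi> (prod_list (take k as)) * boolean_cumulant \<psi> (drop k as))"
proof -
  have "{..<length as} = insert 0 {0<..<length as}"
    using assms(2) by auto
  then show ?thesis
    using boolean_moment_last[where \<psi> = \<psi>, OF assms] assms(1) by simp
qed

text \<open>Each product in the recursion contains the moment of a proper non-empty prefix.\<close>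

lemma boolean_cumulant_vanish:
  assumes "\<psi> 1 = 1" "as \<noteq> []"
    and "\<And>k. 0 < k \<Longrightarrow> k \<le> length as \<Longrightarrow> \<psi> (prod_list (take k as)) = 0"
  shows "boolean_cumulant \<psi> as = 0"
proof -
  have "\<psi> (prod_list as) = 0"
    using assms(3)[of "length as"] assms(2) by simp
  then show ?thesis
    using assms by (simp add: boolean_cumulant_rec)
qed

text \<open>The product formula for Boolean cumulants; the second summand accounts for the interval
  partitions that cut between \<open>x\<close> and \<open>y\<close>. It results from expanding one
  and the same moment by its last block, before and after the multiplication.\<close>

lemma boolean_cumulant_merge:
  assumes "\<psi> 1 = 1"
  shows "boolean_cumulant \<psi> (us @ [x * y] @ ws) =
    boolean_cumulant \<psi> (us @ [x, y] @ ws) +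
    boolean_cumulant \<psi> (us @ [x]) * boolean_cumulant \<psi> (y # ws)"
proof (induction us rule: length_induct)
  case (1 us)
  let ?u = "length us" and ?w = "length ws"
  let ?b = "boolean_cumulant \<psi>" and ?M = "\<lambda>l. \<psi> (prod_list l)"
  let ?L = "us @ [x * y] @ ws" and ?L2 = "us @ [x, y] @ ws"
  \<comment> \<open>Last blocks that begin behind \<open>y\<close>, which the multiplication does
    not affect.\<close>
  define A where "A = (\<Sum>k<?w. ?M (us @ [x, y] @ take k ws) * ?b (drop k ws))"
  have split: "(\<Sum>k<i + j. f k) = (\<Sum>k<i. f k) + (\<Sum>k<j. f (i + k))" for i j :: nat and f :: "nat \<Rightarrow> complex"
    by (induction j) auto
  have "?M ?L = (\<Sum>k<Suc ?u + ?w. ?M (take k ?L) * ?b (drop k ?L))"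
    using boolean_moment_last[where \<psi> = \<psi>, OF assms, of ?L] by simp
  also have "\<dots> = (\<Sum>k<Suc ?u. ?M (take k ?L) * ?b (drop k ?L)) + A"
    unfolding split A_def by (simp add: mult.assoc)
  also have "(\<Sum>k<Suc ?u. ?M (take k ?L) * ?b (drop k ?L)) =
      (\<Sum>k<Suc ?u. ?M (take k us) * ?b (drop k us @ [x * y] @ ws))"
    by (intro sum.cong) auto
  finally have eq1: "?M ?L = (\<Sum>k<Suc ?u. ?M (take k us) * ?b (drop k us @ [x * y] @ ws)) + A" .
  have "?M ?L2 = (\<Sum>k<Suc ?u + 1 + ?w. ?M (take k ?L2) * ?b (drop k ?L2))"
    using boolean_moment_last[where \<psi> = \<psi>, OF assms, of ?L2] by simp
  also have "\<dots> = (\<Sum>k<Suc ?u. ?M (take k ?L2) * ?b (drop k ?L2)) + ?M (us @ [x]) * ?b (y # ws) + A"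
    unfolding split A_def by (simp add: numeral_2_eq_2)
  also have "(\<Sum>k<Suc ?u. ?M (take k ?L2) * ?b (drop k ?L2)) =
      (\<Sum>k<Suc ?u. ?M (take k us) * ?b (drop k us @ [x, y] @ ws))"
    by (intro sum.cong) auto
  \<comment> \<open>The last block that begins at \<open>y\<close> leaves the moment of
    \<open>us @ [x]\<close>. It is expanded in turn, so that all weights are prefix moments of
    \<open>us\<close>.\<close>
  also have "?M (us @ [x]) = (\<Sum>k<Suc ?u. ?M (take k us) * ?b (drop k us @ [x]))"
    using boolean_moment_last[where \<psi> = \<psi>, OF assms, of "us @ [x]"] by simp
  finally have eq2: "?M ?L2 = (\<Sum>k<Suc ?u. ?M (take k us) * ?b (drop k us @ [x, y] @ ws)) +
      (\<Sum>k<Suc ?u. ?M (take k us) * ?b (drop k us @ [x])) * ?b (y # ws) + A" .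
  let ?h = "\<lambda>us. ?b (us @ [x * y] @ ws) - ?b (us @ [x, y] @ ws) - ?b (us @ [x]) * ?b (y # ws)"
  have "(\<Sum>k<Suc ?u. ?M (take k us) * ?h (drop k us)) = ?M ?L - ?M ?L2"
    unfolding eq1 eq2 by (simp only: right_diff_distrib sum_subtractf sum_distrib_right mult.assoc) simp
  also have "\<dots> = 0"
    by (simp add: mult.assoc)
  finally have "(\<Sum>k<Suc ?u. ?M (take k us) * ?h (drop k us)) = 0" .
  \<comment> \<open>For \<open>k > 0\<close> the remaining suffix of \<open>us\<close> is shorter
    and satisfies the formula by induction.\<close>
  moreover have "(\<Sum>k<Suc ?u. ?M (take k us) * ?h (drop k us)) = (\<Sum>k\<in>{0}. ?M (take k us) * ?h (drop k us))"
  proof (rule sum.mono_neutral_right)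
    show "\<forall>k\<in>{..<Suc ?u} - {0}. ?M (take k us) * ?h (drop k us) = 0"
    proof
      fix k assume "k \<in> {..<Suc ?u} - {0}"
      then have "length (drop k us) < length us" by auto
      then show "?M (take k us) * ?h (drop k us) = 0"
        using 1[rule_format, of "drop k us"] by simp
    qed
  qed auto
  ultimately have "?h us = 0"
    using assms by (simp only: sum.insert sum.empty finite.emptyI empty_iff take_0 drop_0 prod_list.Nil if_False) simp
  then show ?case
    by (simp only: diff_diff_eq right_minus_eq)
qed

section \<open>Boolean cumulants in terms of free cumulants\<close>

lemma moment_by_last_boolean:
  assumes "\<psi> 1 = 1" "finite S" "S \<noteq> {}"
  shows "moment \<psi> a S =
    (\<Sum>k\<in>S. moment \<psi> a {x \<in> S. x < k} * boolean_cumulant \<psi> (map a (slist {x \<in> S. k \<le> x})))"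
proof -
  let ?L = "slist S"
  have bij: "bij_betw ((!) ?L) {..<length ?L} S"
    by (rule bij_betw_nth) (use assms in auto)
  have parts: "take i ?L = slist {x \<in> S. x < ?L ! i}" "drop i ?L = slist {x \<in> S. ?L ! i \<le> x}"
    if i: "i < length ?L" for i
  proof -
    obtain k where k: "k = ?L ! i" by blast
    then have "k \<in> S"
      using nth_mem[OF i] assms by simp
    note L = slist_split[OF assms(2) this]
    have "?L ! length (slist {x \<in> S. x < k}) = k"
      unfolding L by (rule nth_append_length)
    moreover have "length (slist {x \<in> S. x < k}) < length ?L"
      unfolding L by simp
    ultimately have len: "length (slist {x \<in> S. x < k}) = i"
      using nth_eq_iff_index_eq[of ?L] i k by simp
    have "take i ?L = slist {x \<in> S. x < k}"
      unfolding L using len by simp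
    then show "take i ?L = slist {x \<in> S. x < ?L ! i}"
      using k by simp
    have "drop i ?L = k # slist {x \<in> S. k < x}"
      unfolding L using len by simp
    also have "\<dots> = slist {x \<in> S. k \<le> x}"
      by (rule slist_eqI) (use assms \<open>k \<in> S\<close> in auto)
    finally show "drop i ?L = slist {x \<in> S. ?L ! i \<le> x}"
      using k by simp
  qed
  have "moment \<psi> a S = (\<Sum>i<length ?L. \<psi> (prod_list (map a (take i ?L))) *
      boolean_cumulant \<psi> (map a (drop i ?L)))"
    using boolean_moment_last[where \<psi> = \<psi>, OF assms(1), of "map a ?L"] assms
    by (simp add: moment_def take_map drop_map)
  also have "\<dots> = (\<Sum>i<length ?L. moment \<psi> a {x \<in> S. x < ?L ! i} *
      boolean_cumulant \<psi> (map a (slist {x \<in> S. ?L ! i \<le> x})))"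
    using parts by (intro sum.cong) (simp_all add: moment_def)
  also have "\<dots> = (\<Sum>k\<in>S. moment \<psi> a {x \<in> S. x < k} *
      boolean_cumulant \<psi> (map a (slist {x \<in> S. k \<le> x})))"
    by (rule sum.reindex_bij_betw[OF bij])
  finally show ?thesis .
qed

text \<open>The arc of \<open>Max S\<close> wraps around and consists of the positions below the
  minimum \<open>k\<close> of \<open>V\<close>; cutting these off leaves the other arcs
  unchanged.\<close>

lemma arc_moments_truncate:
  assumes \<psi>: "\<psi> 1 = 1" and S: "finite S" and V: "V \<subseteq> S" "Max S \<in> V" "k \<in> V" "\<And>u. u \<in> V \<Longrightarrow> k \<le> u"
  shows "arc_moments \<psi> a S V = moment \<psi> a {x \<in> S. x < k} * arc_moments \<psi> a {x \<in> S. k \<le> x} V"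
proof -
  let ?m = "Max S" and ?S = "{x \<in> S. k \<le> x}"
  have finV: "finite V"
    using V S finite_subset by blast
  have max: "x \<le> ?m" if "x \<in> S" for x
    using S that by simp
  have "arc S V ?m = {x \<in> S. x < k}"
  proof (intro set_eqI iffI)
    fix x assume x: "x \<in> arc S V ?m"
    then have "x \<in> S" "x \<noteq> ?m" "x \<noteq> k" "\<not> cyc ?m k x"
      using V by (auto simp: arc_def)
    then show "x \<in> {x \<in> S. x < k}"
      using max[of x] by (auto simp: cyc_def)
  next
    fix x assume "x \<in> {x \<in> S. x < k}"
    then have "x \<in> S" "x < k" by auto
    moreover have "\<not> cyc ?m u x" if "u \<in> V" for u
    proof -
      have "x < u" "u \<le> ?m"
        using V(4)[OF that] \<open>x < k\<close> max[of u] V(1) that by auto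
      then show ?thesis
        by (auto simp: cyc_def)
    qed
    moreover have "x \<notin> V"
      using V(4)[of x] \<open>x < k\<close> by auto
    ultimately show "x \<in> arc S V ?m"
      by (simp add: arc_def)
  qed
  moreover have "arc ?S V ?m = {}"
  proof -
    have False if "x \<in> arc ?S V ?m" for x
    proof -
      from that have "x \<in> S" "k \<le> x" "x \<noteq> ?m" "x \<noteq> k" "\<not> cyc ?m k x"
        using V by (auto simp: arc_def)
      then show False
        using max[of x] by (auto simp: cyc_def)
    qed
    then show ?thesis by blast
  qed
  moreover have "arc S V v = arc ?S V v" if "v \<in> V - {?m}" for v
  proof -
    have "k \<le> x" if "x \<in> arc S V v" for x
    proof (rule ccontr)
      assume "\<not> k \<le> x"
      moreover have "k \<le> v" "v < ?m"
        using V(4)[of v] max[of v] \<open>v \<in> V - {?m}\<close> V(1) by (auto simp: less_le)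
      ultimately have "cyc v ?m x"
        by (auto simp: cyc_def)
      with that V show False
        by (auto simp: arc_def)
    qed
    then show ?thesis
      by (auto simp: arc_def)
  qed
  ultimately show ?thesis
    unfolding arc_moments_def
    using prod.remove[OF finV V(2), of "\<lambda>v. moment \<psi> a (arc S V v)"]
      prod.remove[OF finV V(2), of "\<lambda>v. moment \<psi> a (arc ?S V v)"] \<psi>
    by (simp add: moment_empty)
qed

text \<open>A Boolean cumulant collects the non-crossing partitions with the first and the last
  position in one block. Grouping the blocks through \<open>Max S\<close> by their minimum
  reproduces the recursion \<open>moment_by_last_boolean\<close>, so the coefficients agree.\<close>

lemma boolean_cumulant_eq_sum_kappa:
  assumes \<psi>: "\<psi> 1 = 1" and "finite S" "S \<noteq> {}"
  shows "boolean_cumulant \<psi> (map a (slist S)) =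
    (\<Sum>V | Max S \<in> V \<and> Min S \<in> V \<and> V \<subseteq> S. kappa \<psi> a V * arc_moments \<psi> a S V)"
  using assms(2-)
proof (induction S rule: finite_psubset_induct)
  case (psubset S)
  let ?m = "Max S" and ?p = "Min S"
  let ?b = "\<lambda>S. boolean_cumulant \<psi> (map a (slist S))"
  define I where "I S = (\<Sum>V | Max S \<in> V \<and> Min S \<in> V \<and> V \<subseteq> S. kappa \<psi> a V * arc_moments \<psi> a S V)" for S
  let ?G = "\<lambda>k. {x \<in> S. k \<le> x}"
  have finV: "finite V" if "V \<subseteq> S" for V
    using that psubset.hyps finite_subset by blast
  have fin: "finite {V. ?m \<in> V \<and> V \<subseteq> S}"
    by (rule finite_subset[of _ "Pow S"]) (use psubset.hyps in auto)
  have group: "(\<Sum>V\<in>{V \<in> {V. ?m \<in> V \<and> V \<subseteq> S}. Min V = k}. kappa \<psi> a V * arc_moments \<psi> a S V) =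
      moment \<psi> a {x \<in> S. x < k} * I (?G k)" if k: "k \<in> S" for k
  proof -
    have maxG: "Max (?G k) = ?m"
      by (rule Max_eqI) (use psubset.hyps psubset.prems k in auto)
    have minG: "Min (?G k) = k"
      by (rule Min_eqI) (use psubset.hyps k in auto)
    have "{V \<in> {V. ?m \<in> V \<and> V \<subseteq> S}. Min V = k} = {V. ?m \<in> V \<and> k \<in> V \<and> V \<subseteq> ?G k}"
    proof (intro set_eqI iffI)
      fix V assume V: "V \<in> {V \<in> {V. ?m \<in> V \<and> V \<subseteq> S}. Min V = k}"
      then have "finite V" "V \<noteq> {}" using finV by auto
      with V show "V \<in> {V. ?m \<in> V \<and> k \<in> V \<and> V \<subseteq> ?G k}"
        using Min_in[of V] Min_le[of V] by auto
    next
      fix V assume V: "V \<in> {V. ?m \<in> V \<and> k \<in> V \<and> V \<subseteq> ?G k}"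
      then have "V \<subseteq> S" by auto
      moreover have "Min V = k"
        by (rule Min_eqI) (use finV[OF \<open>V \<subseteq> S\<close>] V in auto)
      ultimately show "V \<in> {V \<in> {V. ?m \<in> V \<and> V \<subseteq> S}. Min V = k}"
        using V by auto
    qed
    then have "(\<Sum>V\<in>{V \<in> {V. ?m \<in> V \<and> V \<subseteq> S}. Min V = k}. kappa \<psi> a V * arc_moments \<psi> a S V) =
        (\<Sum>V | ?m \<in> V \<and> k \<in> V \<and> V \<subseteq> ?G k. kappa \<psi> a V * arc_moments \<psi> a S V)"
      by simp
    also have "\<dots> = (\<Sum>V | ?m \<in> V \<and> k \<in> V \<and> V \<subseteq> ?G k.
        moment \<psi> a {x \<in> S. x < k} * (kappa \<psi> a V * arc_moments \<psi> a (?G k) V))"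
    proof (rule sum.cong[OF refl])
      fix V assume V: "V \<in> {V. ?m \<in> V \<and> k \<in> V \<and> V \<subseteq> ?G k}"
      have "arc_moments \<psi> a S V = moment \<psi> a {x \<in> S. x < k} * arc_moments \<psi> a (?G k) V"
        by (rule arc_moments_truncate) (use V psubset.hyps \<psi> in auto)
      then show "kappa \<psi> a V * arc_moments \<psi> a S V =
          moment \<psi> a {x \<in> S. x < k} * (kappa \<psi> a V * arc_moments \<psi> a (?G k) V)"
        by simp
    qed
    finally show ?thesis
      unfolding I_def maxG minG by (simp add: sum_distrib_left)
  qed
  have "moment \<psi> a S = (\<Sum>V | ?m \<in> V \<and> V \<subseteq> S. kappa \<psi> a V * arc_moments \<psi> a S V)"
    unfolding arc_moments_def by (rule free_moment_by_block) (use psubset.hyps psubset.prems \<psi> in auto)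
  also have "\<dots> = (\<Sum>k\<in>S. \<Sum>V\<in>{V \<in> {V. ?m \<in> V \<and> V \<subseteq> S}. Min V = k}. kappa \<psi> a V * arc_moments \<psi> a S V)"
  proof (rule sum.group[symmetric, OF fin psubset.hyps])
    show "Min ` {V. ?m \<in> V \<and> V \<subseteq> S} \<subseteq> S"
    proof
      fix k assume "k \<in> Min ` {V. ?m \<in> V \<and> V \<subseteq> S}"
      then obtain V where V: "k = Min V" "?m \<in> V" "V \<subseteq> S" by blast
      then have "Min V \<in> V"
        using finV[OF V(3)] by (intro Min_in) auto
      with V show "k \<in> S" by blast
    qed
  qed
  also have "\<dots> = (\<Sum>k\<in>S. moment \<psi> a {x \<in> S. x < k} * I (?G k))"
    using group by (rule sum.cong[OF refl])
  finally have "(\<Sum>k\<in>S. moment \<psi> a {x \<in> S. x < k} * (?b (?G k) - I (?G k))) = 0"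
    using moment_by_last_boolean[where \<psi> = \<psi> and a = a, OF \<psi> psubset.hyps psubset.prems]
    by (simp add: right_diff_distrib sum_subtractf)
  \<comment> \<open>Above the minimum, induction applies to the final segment of \<open>S\<close>
    from \<open>k\<close>. The minimum itself remains, with an empty prefix.\<close>
  moreover have "(\<Sum>k\<in>S. moment \<psi> a {x \<in> S. x < k} * (?b (?G k) - I (?G k))) =
      (\<Sum>k\<in>{?p}. moment \<psi> a {x \<in> S. x < k} * (?b (?G k) - I (?G k)))"
  proof (rule sum.mono_neutral_right)
    show "\<forall>k\<in>S - {?p}. moment \<psi> a {x \<in> S. x < k} * (?b (?G k) - I (?G k)) = 0"
    proof
      fix k assume k: "k \<in> S - {?p}"
      then have "?p < k"
        using psubset.hyps by (auto simp: less_le)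
      moreover have "?p \<in> S"
        using Min_in[OF psubset.hyps psubset.prems] .
      ultimately have "?p \<in> S - ?G k"
        by simp
      then have "?G k \<subset> S"
        by blast
      moreover have "?G k \<noteq> {}"
        using k by blast
      ultimately have "?b (?G k) = I (?G k)"
        unfolding I_def by (rule psubset.IH)
      then show "moment \<psi> a {x \<in> S. x < k} * (?b (?G k) - I (?G k)) = 0"
        by simp
    qed
  next
    show "{?p} \<subseteq> S"
      using Min_in[OF psubset.hyps psubset.prems] by simp
  qed (rule psubset.hyps)
  moreover have "{x \<in> S. x < ?p} = {}" "?G ?p = S"
    using Min_le[OF psubset.hyps] by (auto simp: leD)
  ultimately have "?b S - I S = 0"
    by (simp add: moment_empty \<psi>)
  then show ?case
    unfolding I_def by (rule eq_iff_diff_eq_0[THEN iffD2])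
qed

text \<open>In every product of the recursion, \<open>k\<close> occurs in the prefix or in the
  suffix but not in both; the other factor is constant.\<close>

lemma (in unital_complex_algebra) boolean_cumulant_linear:
  assumes \<psi>: "linear_functional scale \<psi>" "\<psi> 1 = 1" and "distinct L" "k \<in> set L"
  shows "boolean_cumulant \<psi> (map (a(k := x + c *s y)) L) =
    boolean_cumulant \<psi> (map (a(k := x)) L) + c * boolean_cumulant \<psi> (map (a(k := y)) L)"
  using assms(3-)
proof (induction L rule: length_induct)
  case (1 L)
  let ?n = "length L"
  let ?M = "\<lambda>a j. \<psi> (prod_list (map a (take j L)))" and ?B = "\<lambda>a j. boolean_cumulant \<psi> (map a (drop j L))"
  have "L \<noteq> []"
    using 1(3) by auto
  then have rec: "boolean_cumulant \<psi> (map b L) = \<psi> (prod_list (map b L)) - (\<Sum>j\<in>{0<..<?n}. ?M b j * ?B b j)" for b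
    using boolean_cumulant_rec[where \<psi> = \<psi>, OF \<psi>(2), of "map b L"]
    by (simp add: take_map drop_map)
  have summand: "?M (a(k := x + c *s y)) j * ?B (a(k := x + c *s y)) j =
      ?M (a(k := x)) j * ?B (a(k := x)) j + c * (?M (a(k := y)) j * ?B (a(k := y)) j)"
    if j: "j \<in> {0<..<?n}" for j
  proof -
    have dist: "distinct (take j L)" "distinct (drop j L)"
      using 1(2) by auto
    have disj: "set (take j L) \<inter> set (drop j L) = {}"
      using 1(2) by (metis append_take_drop_id distinct_append)
    have un: "set L = set (take j L) \<union> set (drop j L)"
      by (metis append_take_drop_id set_append)
    show ?thesis
    proof (cases "k \<in> set (take j L)")
      case True
      then have "k \<notin> set (drop j L)"
        using disj by blast
      then have "map (a(k := z)) (drop j L) = map a (drop j L)" for z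
        by simp
      moreover have "?M (a(k := x + c *s y)) j = ?M (a(k := x)) j + c * ?M (a(k := y)) j"
        using prod_list_linear[OF dist(1) True] functional_linear[OF \<psi>(1)] by simp
      ultimately show ?thesis
        by (simp add: algebra_simps del: map_eq_conv map_fun_upd)
    next
      case False
      then have "k \<in> set (drop j L)"
        using un 1(3) by blast
      moreover have "length (drop j L) < length L"
        using j by auto
      ultimately have "?B (a(k := x + c *s y)) j = ?B (a(k := x)) j + c * ?B (a(k := y)) j"
        using 1(1) dist(2) by blast
      moreover have "map (a(k := z)) (take j L) = map a (take j L)" for z
        using False by simp
      ultimately show ?thesis
        by (simp add: algebra_simps del: map_eq_conv map_fun_upd)
    qed
  qed
  have "(\<Sum>j\<in>{0<..<?n}. ?M (a(k := x + c *s y)) j * ?B (a(k := x + c *s y)) j) =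
      (\<Sum>j\<in>{0<..<?n}. ?M (a(k := x)) j * ?B (a(k := x)) j) +
      c * (\<Sum>j\<in>{0<..<?n}. ?M (a(k := y)) j * ?B (a(k := y)) j)"
    by (simp add: summand sum.distrib sum_distrib_left)
  then show ?case
    unfolding rec using prod_list_linear[OF 1(2,3)] functional_linear[OF \<psi>(1)]
    by (simp add: algebra_simps)
qed

section \<open>Merging the last and the first argument\<close>

text \<open>The walk from \<open>v\<close> meets \<open>w\<close> before it could wrap
  around.\<close>

lemma arc_before_last:
  assumes "v \<in> V" "w \<in> V" "v < w"
  shows "arc S V v \<subseteq> {x \<in> S. v < x \<and> x < w}"
proof
  fix x assume "x \<in> arc S V v"
  then have "x \<in> S" "x \<noteq> v" "x \<noteq> w" "\<not> cyc v w x"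
    using assms by (auto simp: arc_def)
  then show "x \<in> {x \<in> S. v < x \<and> x < w}"
    using assms(3) by (auto simp: cyc_def)
qed

text \<open>Only the arc of the largest element of \<open>V\<close> can wrap around: it runs to the
  end of \<open>S\<close> and resumes at the beginning.\<close>

lemma clist_arc_last:
  assumes "v \<in> V" "\<And>u. u \<in> V \<Longrightarrow> u \<le> v"
  shows "clist v (arc S V v) = slist {x \<in> S. v < x} @ slist {x \<in> S. \<forall>u\<in>V. x < u}"
proof -
  have "{x \<in> arc S V v. v < x} = {x \<in> S. v < x}"
  proof (intro set_eqI iffI)
    fix x assume "x \<in> {x \<in> S. v < x}"
    then have x: "x \<in> S" "v < x" by auto
    have "x \<notin> V"
      using assms(2)[of x] x(2) by auto
    moreover have "\<not> cyc v u x" if "u \<in> V" for u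
      using assms(2)[OF that] x(2) by (auto simp: cyc_def)
    ultimately show "x \<in> {x \<in> arc S V v. v < x}"
      using x by (auto simp: arc_def)
  qed (auto simp: arc_def)
  moreover have "{x \<in> arc S V v. x < v} = {x \<in> S. \<forall>u\<in>V. x < u}"
  proof (intro set_eqI iffI)
    fix x assume "x \<in> {x \<in> arc S V v. x < v}"
    then have x: "x \<in> S" "x \<notin> V" "x < v" "\<And>u. u \<in> V \<Longrightarrow> \<not> cyc v u x"
      by (auto simp: arc_def)
    have "x < u" if "u \<in> V" for u
    proof -
      have "x \<noteq> u"
        using x(2) that by blast
      with x(3) x(4)[OF that] show ?thesis
        by (auto simp: cyc_def)
    qed
    with x show "x \<in> {x \<in> S. \<forall>u\<in>V. x < u}" by auto
  next
    fix x assume "x \<in> {x \<in> S. \<forall>u\<in>V. x < u}"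
    then have x: "x \<in> S" "\<And>u. u \<in> V \<Longrightarrow> x < u" by auto
    have "\<not> cyc v u x" if "u \<in> V" for u
      using assms(2)[OF that] x(2)[OF that] by (auto simp: cyc_def)
    then show "x \<in> {x \<in> arc S V v. x < v}"
      using x assms(1) by (auto simp: arc_def)
  qed
  ultimately show ?thesis
    by (simp add: clist_def)
qed

lemma slist_Min:
  assumes "finite S" "p \<in> S" "\<And>x. x \<in> S \<Longrightarrow> p \<le> x"
  shows "slist S = p # slist (S - {p})"
proof (rule slist_eqI[symmetric])
  show "sorted_wrt (<) (p # slist (S - {p}))"
    using assms(1) assms(3) by (auto simp: less_le)
qed (use assms in auto)

lemma slist_Max:
  assumes "finite S" "m \<in> S" "\<And>x. x \<in> S \<Longrightarrow> x \<le> m"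
  shows "slist S = slist (S - {m}) @ [m]"
proof (rule slist_eqI[symmetric])
  show "sorted_wrt (<) (slist (S - {m}) @ [m])"
    using assms(1) assms(3) by (auto simp: less_le sorted_wrt_append)
qed (use assms in auto)

text \<open>Traciality moves the first argument to the end, next to \<open>a m\<close>.\<close>

lemma moment_merge_ends:
  assumes "tracial \<omega>" and S: "finite S" "m \<in> S" "p \<in> S" "p < m" "\<And>x. x \<in> S \<Longrightarrow> p \<le> x \<and> x \<le> m"
  shows "moment \<omega> (a(m := a m * a p)) (S - {p}) = moment \<omega> a S"
proof -
  let ?X = "slist (S - {p} - {m})"
  have "slist (S - {p}) = ?X @ [m]"
    by (rule slist_Max) (use S in auto)
  moreover have "slist S = p # slist (S - {p})"
    by (rule slist_Min) (use S in auto)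
  moreover have "map (a(m := a m * a p)) ?X = map a ?X"
    using S by auto
  ultimately have "moment \<omega> (a(m := a m * a p)) (S - {p}) = \<omega> ((prod_list (map a ?X) * a m) * a p)"
    and "moment \<omega> a S = \<omega> (a p * (prod_list (map a ?X) * a m))"
    by (simp_all add: moment_def mult.assoc del: map_eq_conv)
  then show ?thesis
    using assms(1) unfolding tracial_def by metis
qed

text \<open>The lists that see the ends of \<open>S\<close>, for \<open>v\<close> the maximum of
  \<open>V\<close>: with \<open>p\<close> deleted, with \<open>p\<close> present, and with
  \<open>p\<close> as an additional cut, which breaks the list between \<open>m\<close> and
  \<open>p\<close>. They have the shapes that occur in
  \<open>boolean_cumulant_merge\<close>.\<close>

lemma merge_ends_lists:
  assumes S: "finite S" "m \<in> S" "p \<in> S" "p < m" "\<And>x. x \<in> S \<Longrightarrow> p \<le> x \<and> x \<le> m"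
    and V: "V \<subseteq> S - {p}" "v \<in> V" "\<And>u. u \<in> V \<Longrightarrow> u \<le> v"
  defines "X \<equiv> slist {x \<in> S. v \<le> x \<and> x < m}" and "Y \<equiv> slist {x \<in> S - {p}. \<forall>u\<in>V. x < u}"
  shows "v # clist v (arc (S - {p}) V v) = X @ [m] @ Y"
    and "v # clist v (arc S V v) = X @ [m, p] @ Y"
    and "v # clist v (arc S (insert p V) v) = X @ [m]"
    and "p # clist p (arc S (insert p V) p) = p # Y"
    and "m \<notin> set X" "m \<notin> set Y"
proof -
  let ?A = "{x \<in> S. v < x}" and ?Y = "{x \<in> S - {p}. \<forall>u\<in>V. x < u}"
  have v: "v \<in> S" "p < v" "v \<le> m"
    using V S(5)[of v] by (auto simp: less_le)
  \<comment> \<open>If \<open>v = m\<close>, then \<open>X\<close> is empty and the final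
    \<open>m\<close> is \<open>v\<close> itself.\<close>
  have A: "v # slist ?A = X @ [m]"
  proof (rule sorted_wrt_unique[of "(<)"])
    show "sorted_wrt (<) (v # slist ?A)" "sorted_wrt (<) (X @ [m])"
      using S(1) by (auto simp: X_def sorted_wrt_append)
    have "x < m" if "x \<in> S" "x \<noteq> m" for x
      using S(5)[OF that(1)] that(2) by simp
    then show "set (v # slist ?A) = set (X @ [m])"
      using v S by (auto simp: X_def less_le)
  qed auto
  have "{x \<in> S - {p}. v < x} = ?A"
    using v by auto
  moreover have "clist v (arc (S - {p}) V v) =
      slist {x \<in> S - {p}. v < x} @ slist {x \<in> S - {p}. \<forall>u\<in>V. x < u}"
    by (rule clist_arc_last[OF V(2,3)])
  ultimately have "clist v (arc (S - {p}) V v) = slist ?A @ Y"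
    by (simp only: Y_def)
  then show "v # clist v (arc (S - {p}) V v) = X @ [m] @ Y"
    using A by simp
  have "slist {x \<in> S. \<forall>u\<in>V. x < u} = p # Y"
    unfolding Y_def
  proof (rule slist_eqI[symmetric])
    show "sorted_wrt (<) (p # slist ?Y)"
      using S(1) S(5) by (auto simp: less_le)
    have "p < u" if "u \<in> V" for u
      using V(1) that S(5)[of u] by (auto simp: less_le)
    then show "set (p # slist ?Y) = {x \<in> S. \<forall>u\<in>V. x < u}"
      using S by auto
  qed
  moreover have "clist v (arc S V v) = slist ?A @ slist {x \<in> S. \<forall>u\<in>V. x < u}"
    by (rule clist_arc_last[OF V(2,3)])
  ultimately have "clist v (arc S V v) = slist ?A @ p # Y"
    by simp
  then show "v # clist v (arc S V v) = X @ [m, p] @ Y"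
    using A by simp
  have none: "{x \<in> S. \<forall>u\<in>insert p V. x < u} = {}"
    using S(5) by (auto simp: leD)
  have "clist v (arc S (insert p V) v) = slist ?A @ slist {x \<in> S. \<forall>u\<in>insert p V. x < u}"
    by (rule clist_arc_last) (use V v in auto)
  then show "v # clist v (arc S (insert p V) v) = X @ [m]"
    unfolding none using A by simp
  have "arc S (insert p V) p = ?Y"
  proof (intro set_eqI iffI)
    fix x assume x: "x \<in> arc S (insert p V) p"
    have "x < u" if "u \<in> V" for u
      using arc_before_last[of p "insert p V" u S] x that V(1) S(5)[of u] by (auto simp: less_le)
    with x show "x \<in> ?Y"
      by (auto simp: arc_def)
  next
    fix x assume x: "x \<in> ?Y"
    then have "p < x"
      using S(5)[of x] by (auto simp: less_le)
    moreover have "\<not> cyc p u x" if "u \<in> V" for u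
    proof -
      have "p \<le> u" "x < u"
        using S(5)[of u] V(1) that x by auto
      with \<open>p < x\<close> show ?thesis
        by (auto simp: cyc_def)
    qed
    ultimately show "x \<in> arc S (insert p V) p"
      using x by (auto simp: arc_def cyc_def)
  qed
  moreover have "clist p ?Y = slist ?Y"
    by (rule clist_greater) (use S in \<open>auto simp: less_le\<close>)
  ultimately show "p # clist p (arc S (insert p V) p) = p # Y"
    by (simp add: Y_def)
  show "m \<notin> set X"
    using S(1) by (auto simp: X_def)
  show "m \<notin> set Y"
  proof
    assume "m \<in> set Y"
    then have "m < v"
      using S(1) V(2) by (simp add: Y_def)
    with v(3) show False by simp
  qed
qed

text \<open>This arc stays strictly between \<open>v\<close> and \<open>u\<close>, so it does not
  notice whether \<open>p\<close> is deleted or becomes a cut point.\<close>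

lemma arc_not_last_merge:
  assumes S: "finite S" "p \<in> S" "\<And>x. x \<in> S \<Longrightarrow> p \<le> x \<and> x \<le> m"
    and V: "V \<subseteq> S - {p}" "v \<in> V" "u \<in> V" "v < u"
  shows "arc (S - {p}) V v = arc S V v" "arc S (insert p V) v = arc S V v" "m \<notin> arc S V v"
proof -
  have sub: "arc S V v \<subseteq> {x \<in> S. v < x \<and> x < u}"
    by (rule arc_before_last[OF V(2-4)])
  have v: "p < v"
    using V(1,2) S(3)[of v] by (auto simp: less_le)
  have "p \<notin> arc S V v"
    using sub v by auto
  then show "arc (S - {p}) V v = arc S V v"
    by (auto simp: arc_def)
  have "\<not> cyc v p x" if "x \<in> arc S V v" for x
    using sub that v by (auto simp: cyc_def)
  then show "arc S (insert p V) v = arc S V v"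
    using \<open>p \<notin> arc S V v\<close> by (auto simp: arc_def)
  have "u \<le> m"
    using S(3)[of u] V by blast
  with sub show "m \<notin> arc S V v" by auto
qed

text \<open>For a cut set \<open>V\<close> without \<open>p\<close>, the Boolean product formula
  splits the merged term into the terms of \<open>V\<close> and of \<open>insert p V\<close>. Only
  the cut set \<open>{p}\<close> is not reached in this way; its term is the Boolean cumulant of the
  whole list.\<close>

lemma cyclic_boolean_on_merge:
  assumes \<psi>: "\<psi> 1 = 1"
    and S: "finite S" "m \<in> S" "p \<in> S" "p < m" "\<And>x. x \<in> S \<Longrightarrow> p \<le> x \<and> x \<le> m"
  shows "cyclic_boolean_on \<psi> a S =
    cyclic_boolean_on \<psi> (a(m := a m * a p)) (S - {p}) + boolean_cumulant \<psi> (map a (slist S))"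
proof -
  let ?b = "a(m := a m * a p)"
  define t where "t a S V = (\<Prod>v\<in>V. boolean_cumulant \<psi> (map a (v # clist v (arc S V v))))"
    for a :: "nat \<Rightarrow> 'a" and S V
  let ?P = "Pow (S - {p}) - {{}}"
  have summand: "t ?b (S - {p}) V = t a S V + t a S (insert p V)" if V: "V \<in> ?P" for V
  proof -
    have finV: "finite V"
      using V S(1) finite_subset[of V S] by auto
    define v where "v = Max V"
    have v: "v \<in> V" "\<And>u. u \<in> V \<Longrightarrow> u \<le> v"
      using finV V by (auto simp: v_def)
    have V': "V \<subseteq> S - {p}" using V by auto
    note L = merge_ends_lists[OF S V' v]
    let ?X = "slist {x \<in> S. v \<le> x \<and> x < m}" and ?Y = "slist {x \<in> S - {p}. \<forall>u\<in>V. x < u}"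
    \<comment> \<open>The factors of the lists that avoid both ends, common to all three
      terms.\<close>
    let ?r = "\<Prod>v\<in>V - {v}. boolean_cumulant \<psi> (map a (v # clist v (arc S V v)))"
    have other: "boolean_cumulant \<psi> (map ?b (w # clist w (arc (S - {p}) V w))) =
          boolean_cumulant \<psi> (map a (w # clist w (arc S V w)))"
        "boolean_cumulant \<psi> (map a (w # clist w (arc S (insert p V) w))) =
          boolean_cumulant \<psi> (map a (w # clist w (arc S V w)))" if w: "w \<in> V - {v}" for w
    proof -
      have wv: "w \<in> V" "w < v"
        using w v(2)[of w] by auto
      note arcs = arc_not_last_merge[OF S(1,3,5) V' wv(1) v(1) wv(2)]
      have "w \<noteq> m"
        using wv V' v(1) S(5)[of v] by auto
      moreover have "map ?b (clist w (arc S V w)) = map a (clist w (arc S V w))"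
        by (rule clist_cong_map) (use arcs(3) S(1) in auto)
      ultimately have "map ?b (w # clist w (arc S V w)) = map a (w # clist w (arc S V w))"
        by (simp del: map_eq_conv map_fun_upd)
      then show "boolean_cumulant \<psi> (map ?b (w # clist w (arc (S - {p}) V w))) =
          boolean_cumulant \<psi> (map a (w # clist w (arc S V w)))"
        by (simp only: arcs(1))
      show "boolean_cumulant \<psi> (map a (w # clist w (arc S (insert p V) w))) =
          boolean_cumulant \<psi> (map a (w # clist w (arc S V w)))"
        by (simp only: arcs(2))
    qed
    have XY: "map ?b ?X = map a ?X" "map ?b ?Y = map a ?Y"
      using L(5,6) by simp_all
    have "t ?b (S - {p}) V = boolean_cumulant \<psi> (map ?b (v # clist v (arc (S - {p}) V v))) *
        (\<Prod>w\<in>V - {v}. boolean_cumulant \<psi> (map ?b (w # clist w (arc (S - {p}) V w))))"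
      unfolding t_def by (rule prod.remove[OF finV v(1)])
    also have "\<dots> = boolean_cumulant \<psi> (map a ?X @ [a m * a p] @ map a ?Y) * ?r"
    proof -
      have "map ?b (v # clist v (arc (S - {p}) V v)) = map a ?X @ [a m * a p] @ map a ?Y"
        by (simp only: L(1) map_append XY) simp
      moreover have "(\<Prod>w\<in>V - {v}. boolean_cumulant \<psi> (map ?b (w # clist w (arc (S - {p}) V w)))) = ?r"
        by (rule prod.cong[OF refl other(1)])
      ultimately show ?thesis
        by (simp only:)
    qed
    finally have 1: "t ?b (S - {p}) V = boolean_cumulant \<psi> (map a ?X @ [a m * a p] @ map a ?Y) * ?r" .
    have "t a S V = boolean_cumulant \<psi> (map a (v # clist v (arc S V v))) * ?r"
      unfolding t_def by (rule prod.remove[OF finV v(1)])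
    then have 2: "t a S V = boolean_cumulant \<psi> (map a ?X @ [a m, a p] @ map a ?Y) * ?r"
      by (simp only: L(2) map_append list.map)
    have "t a S (insert p V) = boolean_cumulant \<psi> (map a (p # clist p (arc S (insert p V) p))) *
        (\<Prod>w\<in>V. boolean_cumulant \<psi> (map a (w # clist w (arc S (insert p V) w))))"
      unfolding t_def by (rule prod.insert) (use finV V in auto)
    also have "(\<Prod>w\<in>V. boolean_cumulant \<psi> (map a (w # clist w (arc S (insert p V) w)))) =
        boolean_cumulant \<psi> (map a (v # clist v (arc S (insert p V) v))) *
        (\<Prod>w\<in>V - {v}. boolean_cumulant \<psi> (map a (w # clist w (arc S (insert p V) w))))"
      by (rule prod.remove[OF finV v(1)])
    also have "boolean_cumulant \<psi> (map a (p # clist p (arc S (insert p V) p))) *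
        (boolean_cumulant \<psi> (map a (v # clist v (arc S (insert p V) v))) *
        (\<Prod>w\<in>V - {v}. boolean_cumulant \<psi> (map a (w # clist w (arc S (insert p V) w))))) =
        boolean_cumulant \<psi> (a p # map a ?Y) * (boolean_cumulant \<psi> (map a ?X @ [a m]) * ?r)"
    proof -
      have "(\<Prod>w\<in>V - {v}. boolean_cumulant \<psi> (map a (w # clist w (arc S (insert p V) w)))) = ?r"
        by (rule prod.cong[OF refl other(2)])
      then show ?thesis
        by (simp only: L(3,4) map_append list.map)
    qed
    finally have 3: "t a S (insert p V) =
        boolean_cumulant \<psi> (a p # map a ?Y) * (boolean_cumulant \<psi> (map a ?X @ [a m]) * ?r)" .
    show ?thesis
      unfolding 1 2 3 boolean_cumulant_merge[where \<psi> = \<psi>, OF \<psi>] by (simp add: algebra_simps)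
  qed
  have fin: "finite ?P"
    using S(1) by simp
  have inj: "inj_on (insert p) ?P"
    by (rule inj_onI) (auto dest: insert_ident[THEN iffD1, rotated 2])
  have "Pow S - {{}} = insert {p} (?P \<union> insert p ` ?P)"
  proof (intro set_eqI iffI)
    fix V assume V: "V \<in> Pow S - {{}}"
    show "V \<in> insert {p} (?P \<union> insert p ` ?P)"
    proof (cases "p \<in> V \<and> V \<noteq> {p}")
      case True
      then have "V = insert p (V - {p})" "V - {p} \<in> ?P"
        using V by auto
      then show ?thesis by blast
    next
      case False
      then show ?thesis using V by auto
    qed
  qed (use S in auto)
  moreover have "{p} \<notin> ?P \<union> insert p ` ?P"
    by auto
  moreover have "?P \<inter> insert p ` ?P = {}"
    by auto
  ultimately have "(\<Sum>V\<in>Pow S - {{}}. t a S V) = t a S {p} + ((\<Sum>V\<in>?P. t a S V) + (\<Sum>V\<in>insert p ` ?P. t a S V))"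
    using fin by (simp add: sum.union_disjoint)
  also have "(\<Sum>V\<in>insert p ` ?P. t a S V) = (\<Sum>V\<in>?P. t a S (insert p V))"
    using sum.reindex[OF inj, of "t a S"] by simp
  also have "(\<Sum>V\<in>?P. t a S V) + (\<Sum>V\<in>?P. t a S (insert p V)) = (\<Sum>V\<in>?P. t ?b (S - {p}) V)"
    by (simp add: summand sum.distrib)
  also have "t a S {p} = boolean_cumulant \<psi> (map a (slist S))"
  proof -
    have "arc S {p} p = S - {p}"
      by (auto simp: arc_def cyc_def)
    moreover have "clist p (S - {p}) = slist (S - {p})"
      by (rule clist_greater) (use S in \<open>auto simp: less_le\<close>)
    moreover have "slist S = p # slist (S - {p})"
      by (rule slist_Min) (use S in auto)
    ultimately show ?thesis
      by (simp add: t_def)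
  qed
  finally show ?thesis
    by (simp only: cyclic_boolean_on_def t_def add.commute)
qed

text \<open>Mirror image of \<open>arc_moments_refine\<close>: \<open>m\<close> is now the last
  position of the arc of \<open>Max V\<close>, and this arc is expanded around \<open>m\<close>. As
  \<open>p \<in> V\<close>, the arc does not wrap around and consists of the positions beyond all of
  \<open>V\<close>.\<close>

lemma arc_moments_refine_last:
  assumes \<psi>: "\<psi> 1 = 1"
    and S: "finite S" "m \<in> S" "p \<in> S" "p < m" "\<And>x. x \<in> S \<Longrightarrow> p \<le> x \<and> x \<le> m"
    and V: "p \<in> V" "V \<subseteq> S - {m}"
  shows "arc_moments \<psi> a S V =
    (\<Sum>W | m \<in> W \<and> W \<subseteq> {x \<in> S. \<forall>u\<in>V. u < x}. kappa \<psi> a W * arc_moments \<psi> a S (V \<union> W))"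
proof -
  let ?M = "moment \<psi> a" and ?G = "{x \<in> S. \<forall>u\<in>V. u < x}"
  have finV: "finite V"
    using V S(1) finite_subset by blast
  define v where "v = Max V"
  have v: "v \<in> V" "\<And>u. u \<in> V \<Longrightarrow> u \<le> v"
    using Max_in[OF finV] Max_ge[OF finV] V(1) by (auto simp: v_def)
  have less_m: "u < m" if "u \<in> V" for u
    using V that S(5)[of u] by (auto simp: less_le)
  have G: "?G = {x \<in> S. v < x}"
    using v by fastforce
  have arc: "arc S V v = ?G"
  proof (intro set_eqI iffI)
    fix x assume x: "x \<in> arc S V v"
    have "v < x"
    proof (rule ccontr)
      assume "\<not> v < x"
      then have "x < v" "x \<noteq> p" "\<not> cyc v p x" "p \<le> x"
        using x v(1) V(1) S(5)[of x] by (auto simp: arc_def not_less le_less)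
      then show False
        by (auto simp: cyc_def)
    qed
    then show "x \<in> ?G"
      using x unfolding G by (auto simp: arc_def)
  next
    fix x assume x: "x \<in> ?G"
    then have "x \<notin> V"
      by blast
    moreover have "\<not> cyc v u x" if "u \<in> V" for u
      using x v(2)[OF that] unfolding G by (auto simp: cyc_def)
    ultimately show "x \<in> arc S V v"
      using x by (simp add: arc_def)
  qed
  have step: "arc_moments \<psi> a S (V \<union> W) = (\<Prod>u\<in>V - {v}. ?M (arc S V u)) * (\<Prod>w\<in>W. ?M (arc ?G W w))"
    if W: "m \<in> W" "W \<subseteq> ?G" for W
  proof -
    have finW: "finite W"
      by (rule finite_subset[OF W(2)]) (use S(1) in simp)
    have disj: "V \<inter> W = {}"
      using W(2) by blast
    have less: "u < w" if "u \<in> V" "w \<in> W" for u w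
      using W(2) that by blast
    have wm: "w < m" if "w \<in> W - {m}" for w
      using W(2) that S(5)[of w] by (auto simp: less_le)
    have outer: "arc S (V \<union> W) u = arc S V u" if "u \<in> V - {v}" for u
      by (rule arc_nested_outer[of v]) (use v V W that arc in auto)
    have last: "arc S (V \<union> W) m = {}"
    proof (rule arc_adjacent_first[of S m p])
      show "\<forall>x\<in>S. \<not> cyc m x p"
        using S(5) by (auto simp: cyc_def leD)
    qed (use S V W in auto)
    \<comment> \<open>On the small circle \<open>?G\<close>, the arc of \<open>m\<close> wraps
      around to the positions below all of \<open>W\<close>; in \<open>S\<close> these lie between
      \<open>v\<close> and the first element of \<open>W\<close>.\<close>
    have mid: "arc S (V \<union> W) v = arc ?G W m"
    proof (intro set_eqI iffI)
      fix x assume x: "x \<in> arc S (V \<union> W) v"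
      then have vx: "v < x" "x < m"
        using arc_before_last[of v "V \<union> W" m S] v(1) W(1) less_m by auto
      have "\<not> cyc m u x" if "u \<in> W" for u
      proof -
        have "\<not> cyc v u x" "v < u"
          using x that less[OF v(1) that] by (auto simp: arc_def)
        then show ?thesis
          using vx S(5)[of u] W(2) that by (auto simp: cyc_def)
      qed
      moreover have "x \<in> ?G"
        using x vx unfolding G by (simp add: arc_def)
      ultimately show "x \<in> arc ?G W m"
        using x by (simp add: arc_def)
    next
      fix x assume x: "x \<in> arc ?G W m"
      then have xG: "x \<in> S" "v < x" "x \<notin> W" "x < m"
        using S(5)[of x] W(1) unfolding G by (auto simp: arc_def less_le)
      have "\<not> cyc v u x" if "u \<in> W" for u
      proof -
        have "\<not> cyc m u x" "v < u"
          using x that less[OF v(1) that] by (auto simp: arc_def)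
        then show ?thesis
          using xG by (auto simp: cyc_def)
      qed
      moreover have "\<not> cyc v u x" if "u \<in> V" for u
        using xG v(2)[OF that] by (auto simp: cyc_def)
      moreover have "x \<notin> V"
        using xG(2) v(2)[of x] by auto
      ultimately show "x \<in> arc S (V \<union> W) v"
        using xG by (auto simp: arc_def)
    qed
    have inner: "arc S (V \<union> W) w = arc ?G W w" if w: "w \<in> W - {m}" for w
    proof (intro set_eqI iffI)
      have vw: "v < w"
        using less[OF v(1)] w by blast
      fix x assume x: "x \<in> arc S (V \<union> W) w"
      then have "w < x"
        using arc_before_last[of w "V \<union> W" m S] w W(1) wm[OF w] by auto
      then have "x \<in> ?G"
        using vw x unfolding G by (simp add: arc_def)
      then show "x \<in> arc ?G W w"
        using x by (simp add: arc_def)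
    next
      have vw: "v < w"
        using less[OF v(1)] w by blast
      fix x assume x: "x \<in> arc ?G W w"
      then have wx: "w < x"
        using arc_before_last[of w W m ?G] w W(1) wm[OF w] by auto
      have "\<not> cyc w u x" if "u \<in> V" for u
        using v(2)[OF that] vw wx by (auto simp: cyc_def)
      moreover have "x \<notin> V"
        using wx vw v(2)[of x] by auto
      ultimately show "x \<in> arc S (V \<union> W) w"
        using x by (auto simp: arc_def)
    qed
    have "arc_moments \<psi> a S (V \<union> W) = (\<Prod>u\<in>V. ?M (arc S (V \<union> W) u)) * (\<Prod>u\<in>W. ?M (arc S (V \<union> W) u))"
      unfolding arc_moments_def by (rule prod.union_disjoint[OF finV finW disj])
    also have "(\<Prod>u\<in>V. ?M (arc S (V \<union> W) u)) =
        ?M (arc S (V \<union> W) v) * (\<Prod>u\<in>V - {v}. ?M (arc S (V \<union> W) u))"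
      by (rule prod.remove[OF finV v(1)])
    also have "(\<Prod>u\<in>V - {v}. ?M (arc S (V \<union> W) u)) = (\<Prod>u\<in>V - {v}. ?M (arc S V u))"
      using outer by (intro prod.cong) auto
    also have "(\<Prod>u\<in>W. ?M (arc S (V \<union> W) u)) =
        ?M (arc S (V \<union> W) m) * (\<Prod>u\<in>W - {m}. ?M (arc S (V \<union> W) u))"
      by (rule prod.remove[OF finW W(1)])
    also have "(\<Prod>u\<in>W - {m}. ?M (arc S (V \<union> W) u)) = (\<Prod>u\<in>W - {m}. ?M (arc ?G W u))"
      using inner by (intro prod.cong) auto
    finally show ?thesis
      using prod.remove[OF finW W(1), of "\<lambda>w. ?M (arc ?G W w)"] mid last
      by (simp add: moment_empty[where \<psi> = \<psi>, OF \<psi>])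
  qed
  have "m \<in> ?G"
    using S(2) less_m by auto
  then have "?M ?G = (\<Sum>W | m \<in> W \<and> W \<subseteq> ?G. kappa \<psi> a W * (\<Prod>w\<in>W. ?M (arc ?G W w)))"
    by (intro free_moment_by_block) (use S(1) \<psi> in auto)
  moreover have "arc_moments \<psi> a S V = ?M ?G * (\<Prod>u\<in>V - {v}. ?M (arc S V u))"
    unfolding arc_moments_def using prod.remove[OF finV v(1), of "\<lambda>u. ?M (arc S V u)"] arc by simp
  ultimately show ?thesis
    using step by (simp add: sum_distrib_left mult_ac)
qed

section \<open>Cyclic free cumulants with products as arguments\<close>

lemma cyclic_moment_empty: "\<psi> 1 = 1 \<Longrightarrow> cyclic_moment \<psi> a v {} = 1"
  by (simp add: cyclic_moment_def)

text \<open>If \<open>V\<close> contains an end of \<open>S\<close>, no arc has positions on both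
  sides of its base point, so clockwise and increasing order agree on it.\<close>

lemma cyclic_moment_arc:
  assumes S: "finite S" "\<And>x. x \<in> S \<Longrightarrow> p \<le> x \<and> x \<le> m" and V: "V \<subseteq> S" "v \<in> V" "m \<in> V \<or> p \<in> V"
  shows "cyclic_moment \<psi> a v (arc S V v) = moment \<psi> a (arc S V v)"
proof (rule cyclic_moment_eq_moment[OF finite_arc[OF S(1)]])
  have False if x: "x \<in> arc S V v" "x < v" and not_max: "v \<noteq> m \<or> p \<in> V" for x
  proof -
    have xS: "x \<in> S" "x \<notin> V" "p \<le> x" "x \<le> m" "p \<le> v" "v \<le> m" and "\<And>u. u \<in> V \<Longrightarrow> \<not> cyc v u x"
      using x S(2)[of x] S(2)[of v] V(1,2) by (auto simp: arc_def)
    then have "m \<in> V \<Longrightarrow> \<not> cyc v m x" "p \<in> V \<Longrightarrow> \<not> cyc v p x" by blast+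
    moreover have "p \<in> V \<Longrightarrow> p < x"
      using xS by (auto simp: le_less)
    ultimately show False
      using x(2) xS V(3) not_max by (auto simp: cyc_def le_less)
  qed
  moreover have "x \<noteq> v" if "x \<in> arc S V v" for x
    using that V(2) by (auto simp: arc_def)
  moreover have "x < v" if "x \<in> arc S V v" "v = m" for x
    using that S(2)[of x] calculation(2)[OF that(1)] by (auto simp: arc_def)
  ultimately show "(\<forall>x\<in>arc S V v. v < x) \<or> (\<forall>x\<in>arc S V v. x < v)"
    by (metis linorder_neqE_nat)
qed

lemma prod_cyclic_moment_arc:
  assumes "finite S" "\<And>x. x \<in> S \<Longrightarrow> p \<le> x \<and> x \<le> m" "V \<subseteq> S" "m \<in> V \<or> p \<in> V"
  shows "(\<Prod>v\<in>V. cyclic_moment \<psi> a v (arc S V v)) = arc_moments \<psi> a S V"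
  unfolding arc_moments_def using cyclic_moment_arc[OF assms(1-3) _ assms(4)] by (rule prod.cong[OF refl])

text \<open>If \<open>V\<close> avoids both ends, then \<open>m\<close> and \<open>p\<close> are
  consecutive in the clockwise list of the arc of \<open>Max V\<close>, and multiplying them there
  does not change the moment.\<close>

lemma prod_cyclic_moment_merge:
  assumes S: "finite S" "m \<in> S" "p \<in> S" "p < m" "\<And>x. x \<in> S \<Longrightarrow> p \<le> x \<and> x \<le> m"
    and V: "V \<subseteq> S - {m, p}" "V \<noteq> {}"
  shows "(\<Prod>v\<in>V. cyclic_moment \<psi> (a(m := a m * a p)) v (arc (S - {p}) V v)) =
    (\<Prod>v\<in>V. cyclic_moment \<psi> a v (arc S V v))"
proof (rule prod.cong[OF refl])
  let ?b = "a(m := a m * a p)"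
  fix v assume v: "v \<in> V"
  have finV: "finite V"
    using V(1) S(1) finite_subset by blast
  have V': "V \<subseteq> S - {p}" using V(1) by auto
  show "cyclic_moment \<psi> ?b v (arc (S - {p}) V v) = cyclic_moment \<psi> a v (arc S V v)"
  proof (cases "v = Max V")
    case False
    have u: "Max V \<in> V" "v < Max V"
      using finV V(2) v False by (auto simp: less_le)
    note arcs = arc_not_last_merge[OF S(1,3,5) V' v u]
    have "cyclic_moment \<psi> ?b v (arc S V v) = cyclic_moment \<psi> a v (arc S V v)"
      by (rule cyclic_moment_cong) (use S(1) arcs(3) in auto)
    then show ?thesis
      by (simp only: arcs(1))
  next
    case True
    then have "\<And>u. u \<in> V \<Longrightarrow> u \<le> v"
      using finV by simp
    note L = merge_ends_lists[OF S V' v this]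
    let ?X = "slist {x \<in> S. v \<le> x \<and> x < m}" and ?Y = "slist {x \<in> S - {p}. \<forall>u\<in>V. x < u}"
    \<comment> \<open>\<open>?X\<close> starts with \<open>v\<close> itself, which is not part of
      the arc and has to be split off.\<close>
    obtain X where X: "?X = v # X"
    proof -
      have "v \<in> set ?X" "hd ?X = v"
      proof -
        have vm: "v \<in> S" "v < m"
          using V(1) v S(5)[of v] by (auto simp: less_le)
        then show "v \<in> set ?X"
          using S(1) by simp
        have "?X = v # slist ({x \<in> S. v \<le> x \<and> x < m} - {v})"
          by (rule slist_Min) (use S(1) vm in auto)
        then show "hd ?X = v" by simp
      qed
      then show ?thesis
        using that[of "tl ?X"] by (cases ?X) auto
    qed
    have eq: "clist v (arc (S - {p}) V v) = X @ [m] @ ?Y" "clist v (arc S V v) = X @ [m, p] @ ?Y"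
      using L(1,2) unfolding X by simp_all
    have "m \<notin> set X" "m \<notin> set ?Y"
      using L(5,6) X by auto
    then have "map ?b X = map a X" "map ?b ?Y = map a ?Y"
      by simp_all
    then have "prod_list (map ?b (X @ [m] @ ?Y)) = prod_list (map a (X @ [m, p] @ ?Y))"
      by (simp only: map_append prod_list.append) (simp add: mult.assoc)
    then show ?thesis
      by (simp only: cyclic_moment_def eq)
  qed
qed

lemma sum_Pow_split:
  fixes h :: "nat set \<Rightarrow> complex"
  assumes "finite S" "m \<noteq> p"
  shows "(\<Sum>V\<in>Pow S - {{}}. h V) = (\<Sum>V\<in>Pow (S - {m, p}) - {{}}. h V) +
    (\<Sum>V | m \<in> V \<and> V \<subseteq> S - {p}. h V) + (\<Sum>V | p \<in> V \<and> V \<subseteq> S - {m}. h V) +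
    (\<Sum>V | m \<in> V \<and> p \<in> V \<and> V \<subseteq> S. h V)"
proof -
  let ?A = "Pow (S - {m, p}) - {{}}" and ?B = "{V. m \<in> V \<and> V \<subseteq> S - {p}}"
    and ?C = "{V. p \<in> V \<and> V \<subseteq> S - {m}}" and ?D = "{V. m \<in> V \<and> p \<in> V \<and> V \<subseteq> S}"
  have fin: "finite ?A" "finite ?B" "finite ?C" "finite ?D"
    by (rule finite_subset[of _ "Pow S"]; use assms in auto)+
  have "Pow S - {{}} = ?A \<union> ?B \<union> ?C \<union> ?D"
    by auto
  moreover have "?A \<inter> ?B = {}" "(?A \<union> ?B) \<inter> ?C = {}" "(?A \<union> ?B \<union> ?C) \<inter> ?D = {}"
    by auto
  ultimately show ?thesis
    using fin by (simp only: sum.union_disjoint finite_Un)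
qed

lemma sum_Pow_delete:
  fixes h :: "nat set \<Rightarrow> complex"
  assumes "finite S" "p \<in> S" "m \<noteq> p"
  shows "(\<Sum>V\<in>Pow (S - {p}) - {{}}. h V) = (\<Sum>V\<in>Pow (S - {m, p}) - {{}}. h V) +
    (\<Sum>U | m \<in> U \<and> p \<in> U \<and> U \<subseteq> S. h (U - {p}))"
proof -
  let ?A = "Pow (S - {m, p}) - {{}}" and ?B = "{V. m \<in> V \<and> V \<subseteq> S - {p}}"
  have fin: "finite ?A" "finite ?B"
    by (rule finite_subset[of _ "Pow S"]; use assms in auto)+
  have "Pow (S - {p}) - {{}} = ?A \<union> ?B"
    by auto
  moreover have "?A \<inter> ?B = {}"
    by auto
  ultimately have "(\<Sum>V\<in>Pow (S - {p}) - {{}}. h V) = (\<Sum>V\<in>?A. h V) + (\<Sum>V\<in>?B. h V)"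
    using fin by (simp only: sum.union_disjoint)
  then show ?thesis
    by (simp only: sum_insert_block[OF assms])
qed

text \<open>
  In the two sums \<open>S - V\<close> is an interval of the circle which begins at \<open>p\<close>, respectively ends
  at \<open>m\<close>. The term with \<open>\<omega> 1\<close> compensates the Boolean cumulant by which \<open>[\<psi>]\<close> changes.
\<close>

lemma Dkappa_merge:
  fixes a :: "nat \<Rightarrow> 'a::ring_1"
  assumes \<psi>: "\<psi> 1 = 1" and \<omega>: "tracial \<omega>"
    and "finite S" "m \<in> S" "p \<in> S" "p < m" "\<And>x. x \<in> S \<Longrightarrow> p \<le> x \<and> x \<le> m"
  shows "Dkappa \<psi> \<omega> (a(m := a m * a p)) (S - {p}) = Dkappa \<psi> \<omega> a S + \<omega> 1 * kappa \<psi> a S +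
    (\<Sum>V | m \<in> V \<and> V \<subseteq> S - {p} \<and> S - V \<subseteq> arc S V m. Dkappa \<psi> \<omega> a V * kappa \<psi> a (S - V)) +
    (\<Sum>V | p \<in> V \<and> V \<subseteq> S - {m} \<and> S - V \<subseteq> {x \<in> S. \<forall>u\<in>V. u < x}.
      Dkappa \<psi> \<omega> a V * kappa \<psi> a (S - V))"
  using assms(3-)
proof (induction S rule: finite_psubset_induct)
  case (psubset S)
  note S = psubset.hyps psubset.prems
  let ?b = "a(m := a m * a p)"
  let ?D = "Dkappa \<psi> \<omega>" and ?K = "kappa \<psi> a" and ?w = "\<omega> 1"
  let ?G = "\<lambda>S V. {x \<in> S. \<forall>u\<in>V. u < (x::nat)}"
  let ?s1 = "\<lambda>U. \<Sum>V | m \<in> V \<and> V \<subseteq> U - {p} \<and> U - V \<subseteq> arc U V m. ?D a V * ?K (U - V)"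
  let ?s2 = "\<lambda>U. \<Sum>V | p \<in> V \<and> V \<subseteq> U - {m} \<and> U - V \<subseteq> ?G U V. ?D a V * ?K (U - V)"
  let ?I = "{U. m \<in> U \<and> p \<in> U \<and> U \<subseteq> S}"
  define T where "T = arc_moments \<psi> a S"
  let ?C = "\<lambda>a S V. \<Prod>v\<in>V. cyclic_moment \<psi> a v (arc S V v)"
  \<comment> \<open>The contribution of the blocks that avoid both ends; it occurs before and after
    the multiplication and cancels.\<close>
  define R where "R = (\<Sum>V\<in>Pow (S - {m, p}) - {{}}. ?D a V * ?C a S V)"
  have mp: "m \<noteq> p" and adj: "\<forall>x\<in>S. \<not> cyc m x p"
    using S by (auto simp: cyc_def leD)
  have T: "?C a S V = T V" if "V \<subseteq> S" "m \<in> V \<or> p \<in> V" for V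
    unfolding T_def by (rule prod_cyclic_moment_arc[of S p m V]) (use S that in auto)
  have "(\<Sum>V\<in>Pow (S - {p}) - {{}}. ?D ?b V * ?C ?b (S - {p}) V) =
      (\<Sum>V\<in>Pow (S - {m, p}) - {{}}. ?D ?b V * ?C ?b (S - {p}) V) +
      (\<Sum>U\<in>?I. ?D ?b (U - {p}) * ?C ?b (S - {p}) (U - {p}))"
    by (rule sum_Pow_delete) (use S mp in auto)
  also have "(\<Sum>V\<in>Pow (S - {m, p}) - {{}}. ?D ?b V * ?C ?b (S - {p}) V) = R"
    unfolding R_def
  proof (rule sum.cong[OF refl])
    fix V assume V: "V \<in> Pow (S - {m, p}) - {{}}"
    then have "finite V" "m \<notin> V"
      using S(1) finite_subset[of V S] by auto
    then have "?D ?b V = ?D a V"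
      by (intro Dkappa_cong) auto
    moreover have "?C ?b (S - {p}) V = ?C a S V"
      by (rule prod_cyclic_moment_merge[OF S]) (use V in auto)
    ultimately show "?D ?b V * ?C ?b (S - {p}) V = ?D a V * ?C a S V"
      by (simp only:)
  qed
  also have "(\<Sum>U\<in>?I. ?D ?b (U - {p}) * ?C ?b (S - {p}) (U - {p})) = (\<Sum>U\<in>?I. ?D ?b (U - {p}) * T U)"
  proof (rule sum.cong[OF refl])
    fix U assume "U \<in> ?I"
    then have U: "m \<in> U" "p \<in> U" "U \<subseteq> S" by auto
    have mid: "p < x \<and> x < m" if "x \<in> arc S U p" for x
      using arc_before_last[of p U m S] U S(4) that by auto
    \<comment> \<open>The arc of \<open>p\<close> lies strictly between \<open>p\<close> and
      \<open>m\<close>, so walks from either end read it in increasing order.\<close>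
    have ends: "cyclic_moment \<psi> ?b m (arc S U p) = cyclic_moment \<psi> ?b p (arc S U p)"
      using mid cyclic_moment_eq_moment[OF finite_arc[OF S(1)], of U p _ \<psi> ?b] by simp
    have "?C ?b (S - {p}) (U - {p}) = (\<Prod>v\<in>U. cyclic_moment \<psi> ?b v (arc S U v))"
      by (rule prod_arcs_delete[where M = "cyclic_moment \<psi> ?b", OF adj mp U S(1) _ ends]) (rule cyclic_moment_empty[where \<psi> = \<psi>, OF \<psi>])
    also have "\<dots> = ?C a S U"
      by (intro prod.cong refl cyclic_moment_cong) (use S(1) U in \<open>auto simp: arc_def\<close>)
    finally show "?D ?b (U - {p}) * ?C ?b (S - {p}) (U - {p}) = ?D ?b (U - {p}) * T U"
      using T[OF U(3)] U(1) by (simp only: simp_thms)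
  qed
  finally have eq1: "(\<Sum>V\<in>Pow (S - {p}) - {{}}. ?D ?b V * ?C ?b (S - {p}) V) =
      R + (\<Sum>U\<in>?I. ?D ?b (U - {p}) * T U)" .
  have "(\<Sum>V\<in>Pow S - {{}}. ?D a V * ?C a S V) = R +
      (\<Sum>V | m \<in> V \<and> V \<subseteq> S - {p}. ?D a V * ?C a S V) +
      (\<Sum>V | p \<in> V \<and> V \<subseteq> S - {m}. ?D a V * ?C a S V) + (\<Sum>U\<in>?I. ?D a U * ?C a S U)"
    unfolding R_def by (rule sum_Pow_split[OF S(1) mp])
  also have "(\<Sum>V | m \<in> V \<and> V \<subseteq> S - {p}. ?D a V * ?C a S V) = (\<Sum>V | m \<in> V \<and> V \<subseteq> S - {p}. ?D a V * T V)"
    using T by (intro sum.cong) auto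
  also have "\<dots> = (\<Sum>U\<in>?I. ?s1 U * T U)"
  proof (rule sum_refined_blocks)
    show "T V = (\<Sum>W | p \<in> W \<and> W \<subseteq> arc S V m. ?K W * T (V \<union> W))" if "m \<in> V" "V \<subseteq> S - {p}" for V
      unfolding T_def by (rule arc_moments_refine[where \<psi> = \<psi>, OF \<psi> adj S(1,3) that])
  qed (use S mp in \<open>auto simp: arc_def\<close>)
  also have "(\<Sum>V | p \<in> V \<and> V \<subseteq> S - {m}. ?D a V * ?C a S V) = (\<Sum>V | p \<in> V \<and> V \<subseteq> S - {m}. ?D a V * T V)"
    using T by (intro sum.cong) auto
  \<comment> \<open>The roles of \<open>m\<close> and \<open>p\<close> are exchanged: the second
    block now contains \<open>m\<close> and lies beyond all of \<open>V\<close>.\<close>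
  also have "\<dots> = (\<Sum>U | p \<in> U \<and> m \<in> U \<and> U \<subseteq> S. ?s2 U * T U)"
  proof (rule sum_refined_blocks)
    show "T V = (\<Sum>W | m \<in> W \<and> W \<subseteq> ?G S V. ?K W * T (V \<union> W))" if "p \<in> V" "V \<subseteq> S - {m}" for V
      unfolding T_def by (rule arc_moments_refine_last[where \<psi> = \<psi>, OF \<psi> S that])
  qed (use S mp in auto)
  also have "\<dots> = (\<Sum>U\<in>?I. ?s2 U * T U)"
    by (intro sum.cong) auto
  also have "(\<Sum>U\<in>?I. ?D a U * ?C a S U) = (\<Sum>U\<in>?I. ?D a U * T U)"
    using T by (intro sum.cong) auto
  finally have eq2: "(\<Sum>V\<in>Pow S - {{}}. ?D a V * ?C a S V) =
      R + (\<Sum>U\<in>?I. ?s1 U * T U) + (\<Sum>U\<in>?I. ?s2 U * T U) + (\<Sum>U\<in>?I. ?D a U * T U)" .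
  have "Max S = m" "Min S = p"
    by (rule Max_eqI Min_eqI; use S in auto)+
  \<comment> \<open>The Boolean cumulant is a sum over the same sets \<open>U\<close> with the same
    weights \<open>T U\<close>, so it adds \<open>\<omega> 1\<close> times \<open>kappa\<close> to
    every coefficient.\<close>
  then have eq3: "boolean_cumulant \<psi> (map a (slist S)) = (\<Sum>U\<in>?I. ?K U * T U)"
    using boolean_cumulant_eq_sum_kappa[where \<psi> = \<psi>, OF \<psi> S(1), of a] S(2) by (auto simp: T_def)
  have "moment \<omega> ?b (S - {p}) = ?w * cyclic_boolean_on \<psi> ?b (S - {p}) +
      (\<Sum>V\<in>Pow (S - {p}) - {{}}. ?D ?b V * ?C ?b (S - {p}) V)"
    by (rule cyclic_moment_by_block) (use \<psi> S mp in auto)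
  moreover have "moment \<omega> a S = ?w * cyclic_boolean_on \<psi> a S +
      (\<Sum>V\<in>Pow S - {{}}. ?D a V * ?C a S V)"
    by (rule cyclic_moment_by_block) (use \<psi> S mp in auto)
  moreover have "moment \<omega> ?b (S - {p}) = moment \<omega> a S"
    by (rule moment_merge_ends[OF \<omega> S])
  moreover have "cyclic_boolean_on \<psi> a S =
      cyclic_boolean_on \<psi> ?b (S - {p}) + boolean_cumulant \<psi> (map a (slist S))"
    by (rule cyclic_boolean_on_merge[where \<psi> = \<psi>, OF \<psi> S])
  ultimately have "(\<Sum>U\<in>?I. ?D ?b (U - {p}) * T U) = ?w * (\<Sum>U\<in>?I. ?K U * T U) +
      (\<Sum>U\<in>?I. ?s1 U * T U) + (\<Sum>U\<in>?I. ?s2 U * T U) + (\<Sum>U\<in>?I. ?D a U * T U)"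
    unfolding eq1 eq2 eq3 by (simp add: algebra_simps)
  then have zero: "(\<Sum>U\<in>?I. (?D ?b (U - {p}) - (?D a U + ?w * ?K U + ?s1 U + ?s2 U)) * T U) = 0"
    by (simp only: left_diff_distrib distrib_right sum_subtractf sum.distrib sum_distrib_left mult.assoc)
      simp
  have "?D ?b (S - {p}) - (?D a S + ?w * ?K S + ?s1 S + ?s2 S) = 0"
  proof (rule triangular_system[where P = "\<lambda>U. m \<in> U \<and> p \<in> U" and T = T
        and h = "\<lambda>U. ?D ?b (U - {p}) - (?D a U + ?w * ?K U + ?s1 U + ?s2 U)"])
    show "finite S" "m \<in> S \<and> p \<in> S"
      using S by auto
    show "(\<Sum>U | (m \<in> U \<and> p \<in> U) \<and> U \<subseteq> S. (?D ?b (U - {p}) - (?D a U + ?w * ?K U + ?s1 U + ?s2 U)) * T U) = 0"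
      using zero by (simp only: conj_assoc)
    show "T S = 1"
      by (simp add: T_def arc_moments_def moment_empty \<psi>)
    show "?D ?b (U - {p}) - (?D a U + ?w * ?K U + ?s1 U + ?s2 U) = 0" if "m \<in> U \<and> p \<in> U" "U \<subset> S" for U
    proof -
      have "?D ?b (U - {p}) = ?D a U + ?w * ?K U + ?s1 U + ?s2 U"
        by (rule psubset.IH[OF that(2) _ _ S(4)]) (use that S in auto)
      then show ?thesis
        by (simp only: diff_self)
    qed
  qed
  then show ?case
    by (rule eq_iff_diff_eq_0[THEN iffD2])
qed

section \<open>Cyclic invariance\<close>

text \<open>Cuts the circle just before \<open>k\<close>: positions below \<open>k\<close> move
  behind all of \<open>{..<N}\<close>. On \<open>{..<N}\<close> this is a rotation without modular
  arithmetic.\<close>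

definition rotate_from :: "nat \<Rightarrow> nat \<Rightarrow> nat \<Rightarrow> nat" where
  "rotate_from N k z = (if z < k then z + N else z)"

lemma cyc_preserving_rotate_from: "S \<subseteq> {..<N} \<Longrightarrow> cyc_preserving (rotate_from N k) S"
  unfolding cyc_preserving_def
proof (intro conjI ballI impI)
  assume S: "S \<subseteq> {..<N}"
  show "inj_on (rotate_from N k) S"
    using S by (auto simp: inj_on_def rotate_from_def split: if_splits)
  fix x y z assume h: "x \<in> S" "y \<in> S" "z \<in> S" "cyc x y z"
  then have "x < N" "y < N" "z < N"
    using S by auto
  then show "cyc (rotate_from N k x) (rotate_from N k y) (rotate_from N k z)"
    using h(4) unfolding cyc_def rotate_from_def by (elim disjE conjE) (auto)
qed

lemma moment_rotate:
  assumes "tracial \<omega>" "finite S" "S \<subseteq> {..<N}"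
  shows "moment \<omega> a (rotate_from N k ` S) = moment \<omega> (a \<circ> rotate_from N k) S"
proof -
  let ?g = "rotate_from N k" and ?A = "slist {x \<in> S. x < k}" and ?B = "slist {x \<in> S. k \<le> x}"
  have S: "slist S = ?A @ ?B"
    by (rule slist_eqI[symmetric]) (use assms(2) in \<open>auto simp: sorted_wrt_append\<close>)
  have "slist (?g ` S) = map ?g ?B @ map ?g ?A"
  proof (rule slist_eqI[symmetric])
    have "sorted_wrt (\<lambda>x y. ?g x < ?g y) ?A" "sorted_wrt (\<lambda>x y. ?g x < ?g y) ?B"
      by (rule sorted_wrt_mono_rel[of _ "(<)"]; use assms in \<open>auto simp: rotate_from_def\<close>)+
    then show "sorted_wrt (<) (map ?g ?B @ map ?g ?A)"
      using assms by (auto simp: sorted_wrt_append sorted_wrt_map rotate_from_def)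
    have "?g ` S = ?g ` ({x \<in> S. k \<le> x} \<union> {x \<in> S. x < k})"
      by (rule arg_cong[of _ _ "(`) ?g"]) auto
    then show "set (map ?g ?B @ map ?g ?A) = ?g ` S"
      using assms(2) by (simp add: image_Un)
  qed
  then show ?thesis
    using assms(1) by (simp add: moment_def S tracial_def)
qed

text \<open>Arcs and the cyclic Boolean term depend only on the cyclic order, and
  \<open>\<omega>\<close> is tracial, so both sides solve the same triangular system. This is the
  cyclic invariance expected of cyclic free cumulants.\<close>

lemma Dkappa_rotate:
  assumes \<psi>: "\<psi> 1 = 1" and \<omega>: "tracial \<omega>" and "finite S" "S \<noteq> {}" "S \<subseteq> {..<N}"
  shows "Dkappa \<psi> \<omega> a (rotate_from N k ` S) = Dkappa \<psi> \<omega> (a \<circ> rotate_from N k) S"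
  using assms(3-)
proof (induction S rule: finite_psubset_induct)
  case (psubset S)
  let ?g = "rotate_from N k"
  let ?C = "\<lambda>a S V. \<Prod>v\<in>V. cyclic_moment \<psi> a v (arc S V v)"
  have g: "cyc_preserving ?g S"
    by (rule cyc_preserving_rotate_from) (use psubset.prems in auto)
  then have inj: "inj_on ?g S"
    by (simp add: cyc_preserving_def)
  have "moment \<omega> a (?g ` S) = \<omega> 1 * cyclic_boolean_on \<psi> a (?g ` S) +
      (\<Sum>V\<in>Pow (?g ` S) - {{}}. Dkappa \<psi> \<omega> a V * ?C a (?g ` S) V)"
    by (rule cyclic_moment_by_block) (use \<psi> psubset.hyps psubset.prems in auto)
  also have "(\<Sum>V\<in>Pow (?g ` S) - {{}}. Dkappa \<psi> \<omega> a V * ?C a (?g ` S) V) =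
      (\<Sum>V\<in>Pow S - {{}}. Dkappa \<psi> \<omega> a (?g ` V) * ?C a (?g ` S) (?g ` V))"
    by (rule sum_Pow_image[OF inj])
  also have "\<dots> = (\<Sum>V\<in>Pow S - {{}}. Dkappa \<psi> \<omega> a (?g ` V) * ?C (a \<circ> ?g) S V)"
    using cyclic_moments_image[OF g psubset.hyps] by (intro sum.cong refl arg_cong2[where f = "(*)"]) auto
  also have "cyclic_boolean_on \<psi> a (?g ` S) = cyclic_boolean_on \<psi> (a \<circ> ?g) S"
    by (rule cyclic_boolean_on_image[OF g psubset.hyps])
  also have "moment \<omega> a (?g ` S) = moment \<omega> (a \<circ> ?g) S"
    by (rule moment_rotate[OF \<omega> psubset.hyps psubset.prems(2)])
  finally have "(\<Sum>V\<in>Pow S - {{}}. (Dkappa \<psi> \<omega> a (?g ` V) - Dkappa \<psi> \<omega> (a \<circ> ?g) V) * ?C (a \<circ> ?g) S V) = 0"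
    using cyclic_moment_by_block[where \<psi> = \<psi> and \<omega> = \<omega> and a = "a \<circ> ?g", OF \<psi> psubset.hyps psubset.prems(1)]
    by (simp add: left_diff_distrib sum_subtractf del: comp_apply)
  moreover have "{V. V \<noteq> {} \<and> V \<subseteq> S} = Pow S - {{}}"
    by auto
  ultimately have zero: "(\<Sum>V | V \<noteq> {} \<and> V \<subseteq> S.
      (Dkappa \<psi> \<omega> a (?g ` V) - Dkappa \<psi> \<omega> (a \<circ> ?g) V) * ?C (a \<circ> ?g) S V) = 0"
    by simp
  have "Dkappa \<psi> \<omega> a (?g ` S) - Dkappa \<psi> \<omega> (a \<circ> ?g) S = 0"
  proof (rule triangular_system[where P = "\<lambda>V. V \<noteq> {}" and T = "?C (a \<circ> ?g) S"
        and h = "\<lambda>V. Dkappa \<psi> \<omega> a (?g ` V) - Dkappa \<psi> \<omega> (a \<circ> ?g) V", OF psubset.hyps psubset.prems(1) zero])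
    show "?C (a \<circ> ?g) S S = 1"
      by (simp add: cyclic_moment_empty \<psi>)
    show "Dkappa \<psi> \<omega> a (?g ` U) - Dkappa \<psi> \<omega> (a \<circ> ?g) U = 0" if "U \<noteq> {}" "U \<subset> S" for U
    proof -
      have "Dkappa \<psi> \<omega> a (?g ` U) = Dkappa \<psi> \<omega> (a \<circ> ?g) U"
        by (rule psubset.IH[OF that(2,1)]) (use that psubset.prems in auto)
      then show ?thesis
        by (simp only: diff_self)
    qed
  qed
  then show ?case
    by (rule eq_iff_diff_eq_0[THEN iffD2])
qed

text \<open>The values travel with their positions, so only the cut of the circle changes, and
  \<open>k\<close> becomes the first position.\<close>

lemma Dkappa_rotate_to_Min:
  assumes \<psi>: "\<psi> 1 = 1" and \<omega>: "tracial \<omega>" and "finite S" "k \<in> S"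
  obtains g b where "cyc_preserving g S" "\<And>x. x \<in> S \<Longrightarrow> b (g x) = a x" "\<And>x. x \<in> S \<Longrightarrow> g k \<le> g x"
    "Dkappa \<psi> \<omega> b (g ` S) = Dkappa \<psi> \<omega> a S"
proof -
  obtain N where N: "S \<subseteq> {..<N}"
    using assms(3) unfolding finite_nat_set_iff_bounded by blast
  let ?g = "rotate_from N k"
  have g: "cyc_preserving ?g S"
    by (rule cyc_preserving_rotate_from[OF N])
  define b where "b = a \<circ> the_inv_into S ?g"
  have b: "b (?g x) = a x" if "x \<in> S" for x
    using g that by (simp add: b_def cyc_preserving_def the_inv_into_f_f)
  have "Dkappa \<psi> \<omega> b (?g ` S) = Dkappa \<psi> \<omega> (b \<circ> ?g) S"
    by (rule Dkappa_rotate[where \<psi> = \<psi>, OF \<psi> \<omega> assms(3) _ N]) (use assms in auto)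
  also have "\<dots> = Dkappa \<psi> \<omega> a S"
    by (rule Dkappa_cong[OF assms(3)]) (simp add: b)
  finally have "Dkappa \<psi> \<omega> b (?g ` S) = Dkappa \<psi> \<omega> a S" .
  moreover have "?g k \<le> ?g x" if "x \<in> S" for x
    using that N assms(4) by (auto simp: rotate_from_def)
  ultimately show thesis
    using that[of ?g b] g b by blast
qed

text \<open>For a single entry, \<open>[\<psi>](1) = 1\<close>, so the defining formula leaves 0.
  Otherwise the 1 is rotated to the first position and multiplied into the last argument, and
  \<open>Dkappa_merge\<close> has the cumulant without the 1 on both sides. The induction is on the
  cardinality, as rotation changes the set.\<close>

lemma Dkappa_one:
  fixes a :: "nat \<Rightarrow> 'a::ring_1"
  assumes \<psi>: "\<psi> 1 = 1" and \<omega>: "tracial \<omega>" and "finite S" "k \<in> S" "a k = 1"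
  shows "Dkappa \<psi> \<omega> a S = 0"
  using assms(3-)
proof (induction "card S" arbitrary: S a k rule: less_induct)
  case less
  show ?case
  proof (cases "S = {k}")
    case True
    have "arc {k} {k} k = {}"
      by simp
    moreover have "Pow {k} - {{}} = {{k}}"
      by auto
    moreover have "boolean_cumulant \<psi> [1] = 1"
      using boolean_cumulant_rec[where \<psi> = \<psi>, OF \<psi>, of "[1]"] \<psi> by simp
    ultimately show ?thesis
      using cyclic_moment_by_block[where \<psi> = \<psi> and \<omega> = \<omega> and a = a, OF \<psi>, of "{k}"] less.prems True \<psi>
      by (simp add: moment_def cyclic_boolean_on_def cyclic_moment_empty)
  next
    case False
    obtain g b where g: "cyc_preserving g S" "\<And>x. x \<in> S \<Longrightarrow> b (g x) = a x" "\<And>x. x \<in> S \<Longrightarrow> g k \<le> g x"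
      and D: "Dkappa \<psi> \<omega> b (g ` S) = Dkappa \<psi> \<omega> a S"
      using Dkappa_rotate_to_Min[where a = a and \<psi> = \<psi> and \<omega> = \<omega>, OF \<psi> \<omega> less.prems(1,2)] by blast
    define S' p m where "S' = g ` S" and "p = g k" and "m = Max S'"
    have inj: "inj_on g S"
      using g(1) by (simp add: cyc_preserving_def)
    have S': "finite S'" "p \<in> S'" "\<And>x. x \<in> S' \<Longrightarrow> p \<le> x \<and> x \<le> m"
      using less.prems g(3) by (auto simp: S'_def p_def m_def)
    then have m: "m \<in> S'"
      unfolding m_def by (intro Max_in) auto
    have card: "card S' = card S"
      using inj by (simp add: S'_def card_image)
    obtain y where "y \<in> S" "y \<noteq> k"
      using False less.prems by blast
    then have "g y \<in> S'" "g y \<noteq> p"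
      using inj less.prems by (auto simp: S'_def p_def inj_on_def)
    then have pm: "p < m"
      using S'(3)[of "g y"] by auto
    have bp: "b p = 1"
      using g(2) less.prems by (simp add: p_def)
    have small: "Dkappa \<psi> \<omega> b V = 0" if "p \<in> V" "V \<subset> S'" for V
      by (rule less.hyps[of V p]) (use that psubset_card_mono[OF S'(1) that(2)] card bp S'(1) finite_subset in auto)
    have K: "kappa \<psi> b W = (if W = {p} then 1 else 0)" if "p \<in> W" "W \<subseteq> S'" for W
      using kappa_one[where \<psi> = \<psi> and a = b, OF \<psi> _ that(1) bp] kappa_singleton[where \<psi> = \<psi>, OF \<psi>, of b p]
        finite_subset[OF that(2) S'(1)] bp \<psi> by auto
    have sum1: "(\<Sum>V | m \<in> V \<and> V \<subseteq> S' - {p} \<and> S' - V \<subseteq> arc S' V m.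
        Dkappa \<psi> \<omega> b V * kappa \<psi> b (S' - V)) = Dkappa \<psi> \<omega> b (S' - {p})"
    proof (rule sum_singleton_complement[OF S'(1) m S'(2)])
      show "\<not> cyc m u p" if "u \<in> S'" for u
        using S'(3)[OF that] by (auto simp: cyc_def)
      show "kappa \<psi> b W = (if W = {p} then 1 else 0)" if "p \<in> W" "W \<subseteq> S' - {m}" for W
        by (rule K) (use that in auto)
    qed (use pm in simp)
    \<comment> \<open>Here the entry 1 lies in \<open>V\<close>, so \<open>Dkappa\<close> vanishes
      by induction, even for \<open>V = {p}\<close>.\<close>
    have sum2: "(\<Sum>V | p \<in> V \<and> V \<subseteq> S' - {m} \<and> S' - V \<subseteq> {x \<in> S'. \<forall>u\<in>V. u < x}.
        Dkappa \<psi> \<omega> b V * kappa \<psi> b (S' - V)) = 0"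
    proof (intro sum.neutral ballI)
      fix V assume "V \<in> {V. p \<in> V \<and> V \<subseteq> S' - {m} \<and> S' - V \<subseteq> {x \<in> S'. \<forall>u\<in>V. u < x}}"
      then have "p \<in> V" "V \<subset> S'"
        using m by auto
      then show "Dkappa \<psi> \<omega> b V * kappa \<psi> b (S' - V) = 0"
        using small by simp
    qed
    have "S' \<noteq> {p}"
      using m pm by auto
    then have "kappa \<psi> b S' = 0"
      using K[OF S'(2)] by simp
    moreover have "b(m := b m * b p) = b"
      using bp by simp
    ultimately have "Dkappa \<psi> \<omega> b S' = 0"
      using Dkappa_merge[where \<psi> = \<psi> and \<omega> = \<omega> and a = b, OF \<psi> \<omega> S'(1) m S'(2) pm S'(3)] sum1 sum2
      by simp
    then show ?thesis
      using D by (simp add: S'_def)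
  qed
qed

section \<open>Multilinearity of cyclic free cumulants\<close>

lemma prod_linear:
  fixes f g h :: "nat \<Rightarrow> complex"
  assumes "finite V" "u \<in> V" "f u = g u + c * h u"
    and "\<And>v. v \<in> V \<Longrightarrow> v \<noteq> u \<Longrightarrow> g v = f v \<and> h v = f v"
  shows "prod f V = prod g V + c * prod h V"
proof -
  have "prod g (V - {u}) = prod f (V - {u})" "prod h (V - {u}) = prod f (V - {u})"
    using assms(4) by (auto intro!: prod.cong)
  then show ?thesis
    using prod.remove[OF assms(1,2), of f] prod.remove[OF assms(1,2), of g]
      prod.remove[OF assms(1,2), of h] assms(3) by (simp add: algebra_simps)
qed

context unital_complex_algebra
begin

text \<open>The lists cut out by \<open>V\<close> cover every position exactly once, so
  \<open>k\<close> enters a single factor.\<close>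

lemma cyclic_boolean_on_linear:
  assumes \<psi>: "linear_functional scale \<psi>" "\<psi> 1 = 1" and S: "finite S" "k \<in> S"
  shows "cyclic_boolean_on \<psi> (a(k := x + c *s y)) S =
    cyclic_boolean_on \<psi> (a(k := x)) S + c * cyclic_boolean_on \<psi> (a(k := y)) S"
proof -
  let ?t = "\<lambda>z V. \<Prod>v\<in>V. boolean_cumulant \<psi> (map (a(k := z)) (v # clist v (arc S V v)))"
  have "?t (x + c *s y) V = ?t x V + c * ?t y V" if V: "V \<in> Pow S - {{}}" for V
  proof -
    have finV: "finite V"
      using V S(1) finite_subset[of V S] by auto
    have set: "set (v # clist v (arc S V v)) = insert v (arc S V v)" "distinct (v # clist v (arc S V v))"
      if "v \<in> V" for v
      using set_clist[OF finite_arc[OF S(1)] arc_not_self[OF that]] distinct_clist[OF finite_arc[OF S(1)]]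
        arc_not_self[OF that] by simp_all
    obtain u where u: "u \<in> V" "k = u \<or> k \<in> arc S V u"
      using arcs_cover[OF finV, of k S] V S(2) by blast
    have other: "k \<notin> insert v (arc S V v)" if "v \<in> V" "v \<noteq> u" for v
      using u that arcs_disjoint[of k S V v u] by (auto simp: arc_def)
    show ?thesis
    proof (rule prod_linear[OF finV u(1)])
      show "boolean_cumulant \<psi> (map (a(k := x + c *s y)) (u # clist u (arc S V u))) =
          boolean_cumulant \<psi> (map (a(k := x)) (u # clist u (arc S V u))) +
          c * boolean_cumulant \<psi> (map (a(k := y)) (u # clist u (arc S V u)))"
        by (rule boolean_cumulant_linear[OF \<psi>]) (use set[OF u(1)] u(2) in auto)
      fix v assume v: "v \<in> V" "v \<noteq> u"
      have "k \<notin> set (v # clist v (arc S V v))"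
        using other[OF v] set(1)[OF v(1)] by simp
      then have "map (a(k := z)) (v # clist v (arc S V v)) = map a (v # clist v (arc S V v))" for z
        by (rule map_fun_upd)
      then show "boolean_cumulant \<psi> (map (a(k := x)) (v # clist v (arc S V v))) =
            boolean_cumulant \<psi> (map (a(k := x + c *s y)) (v # clist v (arc S V v))) \<and>
          boolean_cumulant \<psi> (map (a(k := y)) (v # clist v (arc S V v))) =
            boolean_cumulant \<psi> (map (a(k := x + c *s y)) (v # clist v (arc S V v)))"
        by (simp only: simp_thms)
    qed
  qed
  then show ?thesis
    unfolding cyclic_boolean_on_def by (simp only: sum.distrib sum_distrib_left cong: sum.cong)
qed

lemma cyclic_moments_linear:
  assumes \<psi>: "linear_functional scale \<psi>" and V: "finite S" "V \<subseteq> S" "V \<noteq> {}" "k \<in> S - V"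
  shows "(\<Prod>v\<in>V. cyclic_moment \<psi> (a(k := x + c *s y)) v (arc S V v)) =
    (\<Prod>v\<in>V. cyclic_moment \<psi> (a(k := x)) v (arc S V v)) +
    c * (\<Prod>v\<in>V. cyclic_moment \<psi> (a(k := y)) v (arc S V v))"
proof -
  have finV: "finite V"
    using V finite_subset by blast
  obtain u where u: "u \<in> V" "k \<in> arc S V u"
    using arcs_cover[OF finV V(3,4)] by blast
  show ?thesis
  proof (rule prod_linear[OF finV u(1)])
    show "cyclic_moment \<psi> (a(k := x + c *s y)) u (arc S V u) =
        cyclic_moment \<psi> (a(k := x)) u (arc S V u) + c * cyclic_moment \<psi> (a(k := y)) u (arc S V u)"
      by (rule cyclic_moment_linear[OF \<psi> finite_arc[OF V(1)] u(2) arc_not_self[OF u(1)]])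
    fix v assume v: "v \<in> V" "v \<noteq> u"
    then have "k \<notin> arc S V v"
      using u arcs_disjoint[of k S V v u] by auto
    then have "cyclic_moment \<psi> (a(k := z)) v (arc S V v) = cyclic_moment \<psi> a v (arc S V v)" for z
      by (intro cyclic_moment_cong) (use V(1) in auto)
    then show "cyclic_moment \<psi> (a(k := x)) v (arc S V v) = cyclic_moment \<psi> (a(k := x + c *s y)) v (arc S V v) \<and>
        cyclic_moment \<psi> (a(k := y)) v (arc S V v) = cyclic_moment \<psi> (a(k := x + c *s y)) v (arc S V v)"
      by (simp only: simp_thms)
  qed
qed

text \<open>All non-empty \<open>V\<close> occur in this expansion, not only those through
  \<open>k\<close>. If \<open>k \<in> V\<close>, no arc contains \<open>k\<close> and induction
  applies to \<open>Dkappa\<close>; otherwise \<open>k\<close> lies in one arc, whose moment is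
  linear.\<close>

lemma Dkappa_linear:
  assumes \<psi>: "linear_functional scale \<psi>" "\<psi> 1 = 1" and \<omega>: "linear_functional scale \<omega>"
    and "finite S" "k \<in> S"
  shows "Dkappa \<psi> \<omega> (a(k := x + c *s y)) S =
    Dkappa \<psi> \<omega> (a(k := x)) S + c * Dkappa \<psi> \<omega> (a(k := y)) S"
  using assms(4-)
proof (induction S rule: finite_psubset_induct)
  case (psubset S)
  let ?X = "Pow S - {{}} - {S}"
  let ?D = "\<lambda>z V. Dkappa \<psi> \<omega> (a(k := z)) V"
  let ?C = "\<lambda>z V. \<Prod>v\<in>V. cyclic_moment \<psi> (a(k := z)) v (arc S V v)"
  have eq: "?D z S = moment \<omega> (a(k := z)) S - \<omega> 1 * cyclic_boolean_on \<psi> (a(k := z)) S -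
      (\<Sum>V\<in>?X. ?D z V * ?C z V)" for z
  proof -
    have "moment \<omega> (a(k := z)) S = \<omega> 1 * cyclic_boolean_on \<psi> (a(k := z)) S +
        (\<Sum>V\<in>Pow S - {{}}. ?D z V * ?C z V)"
      by (rule cyclic_moment_by_block) (use \<psi> psubset.hyps psubset.prems in auto)
    also have "(\<Sum>V\<in>Pow S - {{}}. ?D z V * ?C z V) = ?D z S * ?C z S + (\<Sum>V\<in>?X. ?D z V * ?C z V)"
      by (rule sum.remove) (use psubset.hyps psubset.prems in auto)
    finally show ?thesis
      by (simp add: cyclic_moment_empty \<psi> del: fun_upd_apply)
  qed
  have "?D (x + c *s y) V * ?C (x + c *s y) V = ?D x V * ?C x V + c * (?D y V * ?C y V)" if V: "V \<in> ?X" for V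
  proof (cases "k \<in> V")
    case True
    have "cyclic_moment \<psi> (a(k := z)) v (arc S V v) = cyclic_moment \<psi> a v (arc S V v)" for z v
      by (rule cyclic_moment_cong) (use True psubset.hyps in \<open>auto simp: arc_def\<close>)
    moreover have "?D (x + c *s y) V = ?D x V + c * ?D y V"
      by (rule psubset.IH) (use True V in auto)
    ultimately show ?thesis
      by (simp only: distrib_right mult.assoc)
  next
    case False
    have "Dkappa \<psi> \<omega> (a(k := z)) V = Dkappa \<psi> \<omega> a V" for z
      by (rule Dkappa_cong) (use False V psubset.hyps finite_subset[of V S] in auto)
    moreover have "?C (x + c *s y) V = ?C x V + c * ?C y V"
      by (rule cyclic_moments_linear[OF \<psi>(1) psubset.hyps]) (use False V psubset.prems in auto)
    ultimately show ?thesis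
      by (simp only: distrib_left mult_ac)
  qed
  then have "(\<Sum>V\<in>?X. ?D (x + c *s y) V * ?C (x + c *s y) V) =
      (\<Sum>V\<in>?X. ?D x V * ?C x V) + c * (\<Sum>V\<in>?X. ?D y V * ?C y V)"
    by (simp only: sum.distrib sum_distrib_left cong: sum.cong)
  moreover have "moment \<omega> (a(k := x + c *s y)) S = moment \<omega> (a(k := x)) S + c * moment \<omega> (a(k := y)) S"
    by (rule moment_linear[OF \<omega> psubset.hyps psubset.prems])
  moreover have "cyclic_boolean_on \<psi> (a(k := x + c *s y)) S =
      cyclic_boolean_on \<psi> (a(k := x)) S + c * cyclic_boolean_on \<psi> (a(k := y)) S"
    by (rule cyclic_boolean_on_linear[OF \<psi> psubset.hyps psubset.prems])
  ultimately show ?case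
    by (simp only: eq) (simp add: algebra_simps)
qed

end

section \<open>Alternating families\<close>

text \<open>Colours are attached to positions rather than to list entries, so that passing to a
  subset of the positions needs no new list of indices.\<close>

definition coloured :: "'i set \<Rightarrow> ('i \<Rightarrow> 'a set) \<Rightarrow> (nat \<Rightarrow> 'i) \<Rightarrow> (nat \<Rightarrow> 'a) \<Rightarrow> nat set \<Rightarrow> bool" where
  "coloured I A c a S \<longleftrightarrow> (\<forall>x\<in>S. c x \<in> I \<and> a x \<in> A (c x))"

definition alternating :: "(nat \<Rightarrow> 'i) \<Rightarrow> nat set \<Rightarrow> bool" where
  "alternating c S \<longleftrightarrow>
     (\<forall>x\<in>S. \<forall>y\<in>S. x < y \<longrightarrow> (\<forall>z\<in>S. \<not> (x < z \<and> z < y)) \<longrightarrow> c x \<noteq> c y)"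

text \<open>Neighbours on the circle are compared, thus also the last and the first element of
  \<open>S\<close>.\<close>

definition cyc_alternating :: "(nat \<Rightarrow> 'i) \<Rightarrow> nat set \<Rightarrow> bool" where
  "cyc_alternating c S \<longleftrightarrow>
     (\<forall>x\<in>S. \<forall>y\<in>S. x \<noteq> y \<longrightarrow> (\<forall>z\<in>S. \<not> cyc x z y) \<longrightarrow> c x \<noteq> c y)"

lemma coloured_subset: "coloured I A c a S \<Longrightarrow> R \<subseteq> S \<Longrightarrow> coloured I A c a R"
  by (auto simp: coloured_def)

lemma arguments_from_map:
  "arguments_from I A (map c L) (map a L) \<longleftrightarrow> coloured I A c a (set L)"
  by (auto simp: arguments_from_def coloured_def list_all2_map1 list_all2_map2 list_all2_same)

lemma arguments_from_nth:
  assumes "arguments_from I A js as"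
  shows "coloured I A ((!) js) ((!) as) {..<length as}"
  using assms by (auto simp: arguments_from_def coloured_def list_all2_conv_all_nth)

lemma map_nth_slist: "map ((!) as) (slist {..<length as}) = as"
  by (simp add: slist_lessThan map_nth)

lemma mixed_cumulants_vanish_slist:
  "mixed_cumulants_vanish f I A \<longleftrightarrow>
    (\<forall>S a c. finite S \<and> coloured I A c a S \<and> (\<exists>x\<in>S. \<exists>y\<in>S. c x \<noteq> c y) \<longrightarrow> f (map a (slist S)) = 0)"
    (is "_ \<longleftrightarrow> ?R")
proof
  assume v: "mixed_cumulants_vanish f I A"
  show ?R
  proof (intro allI impI)
    fix S a c assume h: "finite S \<and> coloured I A c a S \<and> (\<exists>x\<in>S. \<exists>y\<in>S. c x \<noteq> c y)"
    then have "arguments_from I A (map c (slist S)) (map a (slist S))"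
      by (simp add: arguments_from_map)
    moreover have "\<exists>j\<in>set (map c (slist S)). \<exists>j'\<in>set (map c (slist S)). j \<noteq> j'"
      using h by auto
    ultimately show "f (map a (slist S)) = 0"
      using v unfolding mixed_cumulants_vanish_def by blast
  qed
next
  assume R: ?R
  show "mixed_cumulants_vanish f I A"
    unfolding mixed_cumulants_vanish_def
  proof (intro allI impI)
    fix js as assume h: "arguments_from I A js as \<and> (\<exists>j\<in>set js. \<exists>j'\<in>set js. j \<noteq> j')"
    then have "length js = length as"
      by (auto simp: arguments_from_def dest: list_all2_lengthD)
    then have "\<exists>x\<in>{..<length as}. \<exists>y\<in>{..<length as}. js ! x \<noteq> js ! y"
      using h by (metis in_set_conv_nth lessThan_iff)
    then have "f (map ((!) as) (slist {..<length as})) = 0"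
      using R arguments_from_nth h by blast
    then show "f as = 0"
      by (simp only: map_nth_slist)
  qed
qed

lemma free_subalgebrasD:
  assumes "free_subalgebras \<psi> I A" "L \<noteq> []" "coloured I A c a (set L)" "\<And>x. x \<in> set L \<Longrightarrow> \<psi> (a x) = 0"
    "distinct_adj (map c L)"
  shows "\<psi> (prod_list (map a L)) = 0"
  using assms(1)[unfolded free_subalgebras_def, rule_format, of "map a L" "map c L"] assms(2-)
  by (auto simp: arguments_from_map)

lemma cyc_insert: "cyc v x y \<Longrightarrow> cyc x z y \<Longrightarrow> cyc v x z \<and> cyc v z y"
  unfolding cyc_def by (elim disjE conjE) simp_all

lemma cyc_chain: "cyc v u z \<Longrightarrow> cyc v z y \<Longrightarrow> cyc v u y"
  unfolding cyc_def by (elim disjE conjE) simp_all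

text \<open>The walk from \<open>v\<close> to a point of the arc stays in the arc. Consecutive
  entries of an arc are therefore consecutive in \<open>S\<close>, which is why alternation passes
  to arcs.\<close>

lemma arc_downward_closed:
  assumes "y \<in> arc S V v" "z \<in> S" "cyc v z y"
  shows "z \<in> arc S V v"
  using assms cyc_chain[of v _ z y] by (auto simp: arc_def)

lemma distinct_adj_clist_arc:
  assumes "finite S" "v \<in> V"
    and alt: "\<And>x y. x \<in> arc S V v \<Longrightarrow> y \<in> arc S V v \<Longrightarrow> cyc v x y \<Longrightarrow> \<forall>z\<in>S. \<not> cyc x z y \<Longrightarrow> c x \<noteq> c y"
  shows "distinct_adj (map c (clist v (arc S V v)))"
  unfolding distinct_adj_conv_nth length_map
proof (intro allI impI)
  let ?L = "clist v (arc S V v)"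
  note fin = finite_arc[OF assms(1), of V v]
  have set: "set ?L = arc S V v"
    using set_clist[OF fin arc_not_self[OF assms(2)]] .
  have less: "cyc v (?L ! i) (?L ! j)" if "i < j" "j < length ?L" for i j
    using sorted_wrt_nth_less[OF sorted_wrt_clist[OF fin]] that by blast
  fix i assume i: "Suc i < length ?L"
  let ?x = "?L ! i" and ?y = "?L ! Suc i"
  have xy: "cyc v ?x ?y"
    using less[of i "Suc i"] i by simp
  have mem: "?x \<in> arc S V v" "?y \<in> arc S V v"
    using nth_mem[of i ?L] nth_mem[of "Suc i" ?L] i set by auto
  have "\<not> cyc ?x z ?y" if z: "z \<in> S" for z
  proof
    assume "cyc ?x z ?y"
    with xy have vz: "cyc v ?x z" "cyc v z ?y"
      using cyc_insert by blast+
    then have "z \<in> set ?L"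
      using arc_downward_closed[OF mem(2) z] set by simp
    then obtain k where k: "k < length ?L" "z = ?L ! k"
      by (metis in_set_conv_nth)
    have "i < k"
      using vz(1) less[of k i] k i cyc_asym[of v ?x z] cyc_distinct[OF vz(1)]
      by (metis Suc_lessD linorder_neqE_nat)
    moreover have "k < Suc i"
      using vz(2) less[of "Suc i" k] k i cyc_asym[of v z ?y] cyc_distinct[OF vz(2)]
      by (metis linorder_neqE_nat)
    ultimately show False by simp
  qed
  then have "c ?x \<noteq> c ?y"
    using alt[OF mem xy] by blast
  then show "map c ?L ! i \<noteq> map c ?L ! Suc i"
    using i by simp
qed

text \<open>The base point \<open>v\<close> and the first position of its arc are neighbours on the
  circle, so prepending \<open>v\<close> preserves alternation.\<close>

lemma distinct_adj_Cons_clist_arc: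
  assumes "finite S" "v \<in> V" "V \<subseteq> S" "cyc_alternating c S"
  shows "distinct_adj (map c (v # clist v (arc S V v)))"
proof -
  let ?L = "clist v (arc S V v)"
  note fin = finite_arc[OF assms(1), of V v]
  have set: "set ?L = arc S V v"
    using set_clist[OF fin arc_not_self[OF assms(2)]] .
  have adj: "distinct_adj (map c ?L)"
    by (rule distinct_adj_clist_arc[OF assms(1,2)])
       (use assms(4) in \<open>auto simp: cyc_alternating_def arc_def dest: cyc_distinct\<close>)
  show ?thesis
  proof (cases "?L")
    case (Cons h T)
    have h: "h \<in> arc S V v" "h \<in> S"
      using set Cons by (auto simp: arc_def)
    have "\<not> cyc v z h" if z: "z \<in> S" for z
    proof
      assume vz: "cyc v z h"
      then have "z \<in> set ?L"
        using arc_downward_closed[OF h(1) z] set by simp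
      moreover have "\<forall>x\<in>set T. cyc v h x"
        using sorted_wrt_clist[OF fin, of v] Cons by simp
      ultimately show False
        using vz Cons cyc_asym cyc_distinct by fastforce
    qed
    moreover have "v \<noteq> h" "v \<in> S"
      using h(1) assms by (auto simp: arc_def)
    ultimately have "c v \<noteq> c h"
      using assms(4) h(2) unfolding cyc_alternating_def by blast
    with adj Cons show ?thesis
      by simp
  qed simp
qed

section \<open>Vanishing arc factors for centred alternating arguments\<close>

lemma cyclic_moment_arc_zero:
  assumes "free_subalgebras \<psi> I A" "finite S" "V \<subseteq> S" "v \<in> V" "arc S V v \<noteq> {}"
    "coloured I A c a S" "\<And>x. x \<in> S \<Longrightarrow> \<psi> (a x) = 0" "cyc_alternating c S"
  shows "cyclic_moment \<psi> a v (arc S V v) = 0"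
proof -
  let ?L = "clist v (arc S V v)"
  have set: "set ?L = arc S V v"
    using set_clist[OF finite_arc[OF assms(2)] arc_not_self[OF assms(4)]] .
  show ?thesis
    unfolding cyclic_moment_def
  proof (rule free_subalgebrasD[OF assms(1), where c = c])
    show "?L \<noteq> []"
      using set assms(5) by auto
    show "coloured I A c a (set ?L)"
      unfolding set by (rule coloured_subset[OF assms(6)]) (auto simp: arc_def)
    show "\<psi> (a x) = 0" if "x \<in> set ?L" for x
      using that assms(7) unfolding set by (auto simp: arc_def)
    show "distinct_adj (map c ?L)"
      using distinct_adj_Cons_clist_arc[OF assms(2,4,3,8)] distinct_adj_ConsD by fastforce
  qed
qed

lemma nonempty_arc:
  assumes "finite S" "V \<subseteq> S" "V \<noteq> {}" "V \<noteq> S"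
  obtains v where "v \<in> V" "arc S V v \<noteq> {}"
  using arcs_Union[OF finite_subset[OF assms(2,1)] assms(3), of S] assms by blast

lemma cyclic_moments_arc_zero:
  assumes "free_subalgebras \<psi> I A" "finite S" "V \<subseteq> S" "V \<noteq> {}" "V \<noteq> S"
    "coloured I A c a S" "\<And>x. x \<in> S \<Longrightarrow> \<psi> (a x) = 0" "cyc_alternating c S"
  shows "(\<Prod>v\<in>V. cyclic_moment \<psi> a v (arc S V v)) = 0"
proof -
  obtain v where v: "v \<in> V" "arc S V v \<noteq> {}"
    using nonempty_arc[OF assms(2-5)] .
  have "cyclic_moment \<psi> a v (arc S V v) = 0"
    by (rule cyclic_moment_arc_zero[OF assms(1-3) v assms(6-8)])
  then show ?thesis
    using finite_subset[OF assms(3,2)] v(1) by (intro prod_zero) auto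
qed

text \<open>Each list \<open>v # clist v (arc S V v)\<close> is centred and alternating, and so are
  its prefixes; freeness kills all their moments and hence the Boolean cumulant.\<close>

lemma cyclic_boolean_on_zero:
  assumes \<psi>: "\<psi> 1 = 1" and "free_subalgebras \<psi> I A" "finite S"
    "coloured I A c a S" "\<And>x. x \<in> S \<Longrightarrow> \<psi> (a x) = 0" "cyc_alternating c S"
  shows "cyclic_boolean_on \<psi> a S = 0"
  unfolding cyclic_boolean_on_def
proof (intro sum.neutral ballI)
  fix V assume "V \<in> Pow S - {{}}"
  then obtain v where V: "V \<subseteq> S" "v \<in> V" "finite V"
    using assms(3) finite_subset by blast
  let ?L = "v # clist v (arc S V v)"
  have set: "set ?L \<subseteq> S"
    using set_clist[OF finite_arc[OF assms(3), of V v] arc_not_self[OF V(2)]] V by (auto simp: arc_def)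
  have adj: "distinct_adj (map c ?L)"
    by (rule distinct_adj_Cons_clist_arc[OF assms(3) V(2,1) assms(6)])
  have "boolean_cumulant \<psi> (map a ?L) = 0"
  proof (rule boolean_cumulant_vanish[where \<psi> = \<psi>, OF \<psi>])
    fix k :: nat assume "0 < k"
    have sub: "set (take k ?L) \<subseteq> S"
      using set set_take_subset by fast
    have "\<psi> (prod_list (map a (take k ?L))) = 0"
    proof (rule free_subalgebrasD[OF assms(2), where c = c])
      show "take k ?L \<noteq> []"
        using \<open>0 < k\<close> by (simp only: take_eq_Nil) simp
      show "coloured I A c a (set (take k ?L))"
        by (rule coloured_subset[OF assms(4) sub])
      show "\<psi> (a x) = 0" if "x \<in> set (take k ?L)" for x
        using that sub assms(5) by blast
      have "distinct_adj (map c (take k ?L) @ map c (drop k ?L))"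
        using adj by (simp only: map_append[symmetric] append_take_drop_id)
      then show "distinct_adj (map c (take k ?L))"
        by (rule distinct_adj_appendD1)
    qed
    then show "\<psi> (prod_list (take k (map a ?L))) = 0"
      by (simp only: take_map)
  qed simp
  then show "(\<Prod>v\<in>V. boolean_cumulant \<psi> (map a (v # clist v (arc S V v)))) = 0"
    using V by (intro prod_zero) auto
qed

text \<open>If \<open>V\<close> contains the first position, no arc wraps around, so neighbours in
  an arc are neighbours in the increasing order of \<open>S\<close>.\<close>

lemma alternating_arc:
  assumes p: "p \<in> V" "\<And>x. x \<in> S \<Longrightarrow> p \<le> x" and V: "V \<subseteq> S" "v \<in> V"
  shows "\<And>x. x \<in> arc S V v \<Longrightarrow> v < x" and "alternating c S \<Longrightarrow> alternating c (arc S V v)"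
proof -
  show greater: "v < x" if x: "x \<in> arc S V v" for x
  proof (rule ccontr)
    assume "\<not> v < x"
    moreover have xS: "x \<in> S" "x \<notin> V" "\<not> cyc v p x"
      using x p(1) by (auto simp: arc_def)
    ultimately have "x < v" "p < x"
      using V(2) p(1) p(2)[OF xS(1)] by (auto simp: not_less le_less)
    with xS(3) show False
      by (auto simp: cyc_def)
  qed
  assume alt: "alternating c S"
  show "alternating c (arc S V v)"
    unfolding alternating_def
  proof (intro ballI impI)
    fix x y assume x: "x \<in> arc S V v" and y: "y \<in> arc S V v" and "x < y"
      and gap: "\<forall>z\<in>arc S V v. \<not> (x < z \<and> z < y)"
    have "\<not> (x < z \<and> z < y)" if "z \<in> S" for z
    proof
      assume z: "x < z \<and> z < y"
      then have "cyc v z y"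
        using greater[OF x] by (auto simp: cyc_def)
      then have "z \<in> arc S V v"
        by (rule arc_downward_closed[OF y that])
      with gap z show False by blast
    qed
    then show "c x \<noteq> c y"
      using alt x y \<open>x < y\<close> unfolding alternating_def arc_def by blast
  qed
qed

lemma distinct_adj_slist:
  assumes "finite S" "alternating c S"
  shows "distinct_adj (map c (slist S))"
  unfolding distinct_adj_conv_nth length_map
proof (intro allI impI)
  let ?L = "slist S"
  have less: "?L ! i < ?L ! j" if "i < j" "j < length ?L" for i j
    using sorted_wrt_nth_less[of "(<)" ?L i j] that by simp
  fix i assume i: "Suc i < length ?L"
  have mem: "?L ! i \<in> S" "?L ! Suc i \<in> S"
    using nth_mem[of i ?L] nth_mem[of "Suc i" ?L] i assms(1) by auto
  have "\<not> (?L ! i < z \<and> z < ?L ! Suc i)" if "z \<in> S" for z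
  proof
    assume z: "?L ! i < z \<and> z < ?L ! Suc i"
    have "z \<in> set ?L"
      using that assms(1) by simp
    then obtain k where k: "k < length ?L" "z = ?L ! k"
      unfolding in_set_conv_nth by blast
    have "\<not> k \<le> i"
      using z k less[of k i] i by (auto simp: le_less)
    moreover have "\<not> Suc i \<le> k"
      using z k less[of "Suc i" k] by (auto simp: le_less)
    ultimately show False by simp
  qed
  then have "c (?L ! i) \<noteq> c (?L ! Suc i)"
    using assms(2) mem less[of i "Suc i"] i unfolding alternating_def by blast
  then show "map c ?L ! i \<noteq> map c ?L ! Suc i"
    using i by simp
qed

lemma moment_alternating_zero:
  assumes "free_subalgebras \<psi> I A" "finite S" "S \<noteq> {}" "coloured I A c a S"
    "\<And>x. x \<in> S \<Longrightarrow> \<psi> (a x) = 0" "alternating c S"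
  shows "moment \<psi> a S = 0"
  unfolding moment_def
  by (rule free_subalgebrasD[OF assms(1), where c = c])
     (use assms distinct_adj_slist[OF assms(2,6)] in auto)

text \<open>The two smallest elements are neighbours and so differ in colour.\<close>

lemma alternating_imp_mixed:
  assumes "finite S" "alternating c S" "p \<in> S" "S \<noteq> {p}"
  shows "\<exists>x\<in>S. \<exists>y\<in>S. c x \<noteq> c y"
proof -
  define q where "q = Min S"
  have q: "q \<in> S" "\<And>x. x \<in> S \<Longrightarrow> q \<le> x"
    using Min_in[OF assms(1)] Min_le[OF assms(1)] assms(3) by (auto simp: q_def)
  have ne: "S - {q} \<noteq> {}"
    using assms(3,4) by blast
  define r where "r = Min (S - {q})"
  have "r \<in> S - {q}"
    unfolding r_def by (rule Min_in) (use assms(1) ne in auto)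
  then have r: "r \<in> S" "q < r"
    using q(2)[of r] by (auto simp: le_less)
  have "\<not> (q < z \<and> z < r)" if "z \<in> S" for z
  proof
    assume z: "q < z \<and> z < r"
    then have "r \<le> z"
      unfolding r_def by (intro Min_le) (use assms(1) that in auto)
    with z show False by simp
  qed
  then have "c q \<noteq> c r"
    using assms(2) q(1) r unfolding alternating_def by blast
  with q(1) r(1) show ?thesis by blast
qed

lemma cyc_alternating_imp_alternating:
  assumes "cyc_alternating c S"
  shows "alternating c S"
  unfolding alternating_def
proof (intro ballI impI)
  fix x y assume h: "x \<in> S" "y \<in> S" "x < y" "\<forall>z\<in>S. \<not> (x < z \<and> z < y)"
  then have "\<not> cyc x z y" if "z \<in> S" for z
    using that by (auto simp: cyc_def)
  then show "c x \<noteq> c y"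
    using assms[unfolded cyc_alternating_def, rule_format, of x y] h(1-3) by simp
qed

section \<open>Vanishing of mixed cumulants implies cyclic freeness\<close>

lemma mixed_kappa_zero:
  assumes "mixed_cumulants_vanish (free_cumulant \<psi>) I A" "finite S" "coloured I A c a S"
    "x \<in> S" "y \<in> S" "c x \<noteq> c y"
  shows "kappa \<psi> a S = 0"
  using assms(1)[unfolded mixed_cumulants_vanish_slist, rule_format, of S c a] assms(2-)
  by (auto simp: kappa_def)

text \<open>In the expansion around the first position, the full block gives a mixed cumulant or the
  moment of one centred element. Every other block leaves a non-empty arc, which is alternating and
  smaller, so its moment vanishes by induction.\<close>

lemma mixed_kappa_imp_moment_zero:
  assumes \<psi>: "\<psi> 1 = 1" and van: "mixed_cumulants_vanish (free_cumulant \<psi>) I A"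
    and "finite S" "S \<noteq> {}" "coloured I A c a S" "\<And>x. x \<in> S \<Longrightarrow> \<psi> (a x) = 0" "alternating c S"
  shows "moment \<psi> a S = 0"
  using assms(3-)
proof (induction S rule: finite_psubset_induct)
  case (psubset S)
  define p where "p = Min S"
  have p: "p \<in> S" "\<And>x. x \<in> S \<Longrightarrow> p \<le> x"
    using psubset.hyps psubset.prems(1) by (auto simp: p_def)
  have "moment \<psi> a S = (\<Sum>V | p \<in> V \<and> V \<subseteq> S. kappa \<psi> a V * (\<Prod>v\<in>V. moment \<psi> a (arc S V v)))"
    by (rule free_moment_by_block[where \<psi> = \<psi>, OF \<psi> psubset.hyps p(1)])
  also have "\<dots> = 0"
  proof (intro sum.neutral ballI)
    fix V assume "V \<in> {V. p \<in> V \<and> V \<subseteq> S}"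
    then have V: "p \<in> V" "V \<subseteq> S" by auto
    show "kappa \<psi> a V * (\<Prod>v\<in>V. moment \<psi> a (arc S V v)) = 0"
    proof (cases "V = S")
      case True
      have "kappa \<psi> a S = 0"
      proof (cases "S = {p}")
        case True
        then show ?thesis
          using kappa_singleton[where \<psi> = \<psi>, OF \<psi>, of a p] psubset.prems(3) by simp
      next
        case False
        then show ?thesis
          using alternating_imp_mixed[OF psubset.hyps psubset.prems(4) p(1)]
            mixed_kappa_zero[OF van psubset.hyps psubset.prems(2)] by blast
      qed
      with True show ?thesis by simp
    next
      case False
      then obtain v where v: "v \<in> V" "arc S V v \<noteq> {}"
        using nonempty_arc[OF psubset.hyps V(2)] V(1) by blast
      have "moment \<psi> a (arc S V v) = 0"
      proof (rule psubset.IH[OF _ v(2)])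
        show "arc S V v \<subset> S"
          using v V by (auto simp: arc_def)
        show "coloured I A c a (arc S V v)"
          by (rule coloured_subset[OF psubset.prems(2)]) (auto simp: arc_def)
        show "\<psi> (a x) = 0" if "x \<in> arc S V v" for x
          using that psubset.prems(3) by (auto simp: arc_def)
        show "alternating c (arc S V v)"
          by (rule alternating_arc(2)[OF V(1) p(2) V(2) v(1) psubset.prems(4)])
      qed
      then have "(\<Prod>v\<in>V. moment \<psi> a (arc S V v)) = 0"
        using finite_subset[OF V(2) psubset.hyps] v(1) by (intro prod_zero) auto
      then show ?thesis by simp
    qed
  qed
  finally show ?case .
qed

lemma alternating_nth: "distinct_adj js \<Longrightarrow> alternating ((!) js) {..<length js}"
  unfolding alternating_def
proof (intro ballI impI)
  fix x y assume h: "distinct_adj js" "x \<in> {..<length js}" "y \<in> {..<length js}" "x < y"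
    "\<forall>z\<in>{..<length js}. \<not> (x < z \<and> z < y)"
  have "\<not> Suc x < y"
    using h(5)[rule_format, of "Suc x"] h(3) by auto
  then have "y = Suc x"
    using h(4) by simp
  then show "js ! x \<noteq> js ! y"
    using distinct_adj_nth[OF h(1), of x] h(3) by simp
qed

lemma cyc_alternating_nth:
  assumes "distinct_adj js" "last js \<noteq> hd js"
  shows "cyc_alternating ((!) js) {..<length js}"
  unfolding cyc_alternating_def
proof (intro ballI impI)
  let ?n = "length js"
  fix x y assume h: "x \<in> {..<?n}" "y \<in> {..<?n}" "x \<noteq> y" "\<forall>z\<in>{..<?n}. \<not> cyc x z y"
  show "js ! x \<noteq> js ! y"
  proof (cases "x < y")
    case True
    then have "\<forall>z\<in>{..<?n}. \<not> (x < z \<and> z < y)"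
      using h(4) by (auto simp: cyc_def)
    then show ?thesis
      using alternating_nth[OF assms(1)] h True unfolding alternating_def by blast
  next
    \<comment> \<open>With \<open>y < x\<close>, having nothing clockwise between \<open>x\<close>
      and \<open>y\<close> forces \<open>x\<close> to be the last and \<open>y\<close> the first
      index, the pair compared by \<open>last\<close> and \<open>hd\<close>.\<close>
    case False
    then have "y < x" using h(3) by simp
    have "js \<noteq> []"
      using h(1) by auto
    then have "\<not> cyc x 0 y"
      using h(4) by simp
    then have "y = 0"
      using \<open>y < x\<close> by (auto simp: cyc_def)
    moreover have "x = ?n - 1"
    proof (rule ccontr)
      assume "x \<noteq> ?n - 1"
      then have "Suc x \<in> {..<?n}"
        using h(1) by auto
      from h(4)[rule_format, OF this] \<open>y < x\<close> show False
        by (auto simp: cyc_def)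
    qed
    ultimately show ?thesis
      using assms(2) \<open>js \<noteq> []\<close> by (simp add: last_conv_nth hd_conv_nth)
  qed
qed

lemma moment_nth: "moment \<phi> ((!) as) {..<length as} = \<phi> (prod_list as)"
  by (simp only: moment_def map_nth_slist)

lemma mixed_cumulants_vanish_imp_cyclically_free:
  assumes \<psi>: "\<psi> 1 = 1"
    and kappa: "mixed_cumulants_vanish (free_cumulant \<psi>) I A"
    and Dkappa: "mixed_cumulants_vanish (cyclic_free_cumulant \<psi> \<omega>) I A"
  shows "cyclically_free \<psi> \<omega> I A"
proof -
  have free: "free_subalgebras \<psi> I A"
    unfolding free_subalgebras_def
  proof (intro allI impI)
    fix js as
    assume h: "as \<noteq> [] \<and> arguments_from I A js as \<and> (\<forall>a\<in>set as. \<psi> a = 0) \<and> distinct_adj js"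
    then have len: "length js = length as"
      by (auto simp: arguments_from_def dest: list_all2_lengthD)
    have "moment \<psi> ((!) as) {..<length as} = 0"
    proof (rule mixed_kappa_imp_moment_zero[where \<psi> = \<psi>, OF \<psi> kappa])
      show "coloured I A ((!) js) ((!) as) {..<length as}"
        using h arguments_from_nth by blast
      show "alternating ((!) js) {..<length as}"
        using alternating_nth[of js] h len by simp
    qed (use h in auto)
    then show "\<psi> (prod_list as) = 0"
      by (simp only: moment_nth)
  qed
  moreover have "\<omega> (prod_list as) = 0"
    if h: "length as \<ge> 2" "arguments_from I A js as" "\<forall>a\<in>set as. \<psi> a = 0" "distinct_adj js" "last js \<noteq> hd js"
    for js as
  proof -
    let ?S = "{..<length as}" and ?a = "(!) as"
    have len: "length js = length as"
      using h(2) by (auto simp: arguments_from_def dest: list_all2_lengthD)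
    have col: "coloured I A ((!) js) ?a ?S"
      by (rule arguments_from_nth[OF h(2)])
    have alt: "cyc_alternating ((!) js) ?S"
      using cyc_alternating_nth[OF h(4,5)] len by simp
    have cent: "\<psi> (?a x) = 0" if "x \<in> ?S" for x
      using h(3) that by simp
    have "js \<noteq> []"
      using h(1) len by auto
    \<comment> \<open>The first and the last colour differ, so the cumulant of the full list is
      mixed.\<close>
    then have "js ! 0 \<noteq> js ! (length as - 1)" "0 \<in> ?S" "length as - 1 \<in> ?S"
      using h(1,5) len by (auto simp: last_conv_nth hd_conv_nth)
    then have D0: "Dkappa \<psi> \<omega> ?a ?S = 0"
      using Dkappa col unfolding mixed_cumulants_vanish_slist Dkappa_def by blast
    have "moment \<omega> ?a ?S = \<omega> 1 * cyclic_boolean_on \<psi> ?a ?S +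
        (\<Sum>V\<in>Pow ?S - {{}}. Dkappa \<psi> \<omega> ?a V * (\<Prod>v\<in>V. cyclic_moment \<psi> ?a v (arc ?S V v)))"
      by (rule cyclic_moment_by_block) (use \<psi> h(1) in \<open>auto simp: lessThan_empty_iff\<close>)
    also have "cyclic_boolean_on \<psi> ?a ?S = 0"
      by (rule cyclic_boolean_on_zero[where \<psi> = \<psi>, OF \<psi> free finite_lessThan col cent alt])
    also have "(\<Sum>V\<in>Pow ?S - {{}}. Dkappa \<psi> \<omega> ?a V * (\<Prod>v\<in>V. cyclic_moment \<psi> ?a v (arc ?S V v))) = 0"
    proof (intro sum.neutral ballI)
      fix V assume V: "V \<in> Pow ?S - {{}}"
      show "Dkappa \<psi> \<omega> ?a V * (\<Prod>v\<in>V. cyclic_moment \<psi> ?a v (arc ?S V v)) = 0"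
      proof (cases "V = ?S")
        case True
        with D0 show ?thesis by simp
      next
        case False
        have "(\<Prod>v\<in>V. cyclic_moment \<psi> ?a v (arc ?S V v)) = 0"
          by (rule cyclic_moments_arc_zero[where \<psi> = \<psi>, OF free finite_lessThan _ _ False col cent alt]) (use V in auto)
        then show ?thesis by simp
      qed
    qed
    finally show ?thesis
      by (simp only: moment_nth) simp
  qed
  ultimately show ?thesis
    unfolding cyclically_free_def by blast
qed

section \<open>Cyclic freeness implies vanishing of mixed cumulants\<close>

context unital_complex_algebra
begin

lemma coloured_merge:
  assumes "\<And>i. i \<in> I \<Longrightarrow> unital_subalgebra scale (A i)" "coloured I A c a S" "m \<in> S" "p \<in> S" "c m = c p"
  shows "coloured I A c (a(m := a m * a p)) (S - {p})"
proof -
  have "c p \<in> I" "a m \<in> A (c p)" "a p \<in> A (c p)"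
    using assms(2-) by (auto simp: coloured_def)
  then have "a m * a p \<in> A (c p)"
    using assms(1)[of "c p"] unfolding unital_subalgebra_def by blast
  then show ?thesis
    using assms(2-) by (auto simp: coloured_def)
qed

lemma coloured_centred:
  assumes "\<And>i. i \<in> I \<Longrightarrow> unital_subalgebra scale (A i)" "coloured I A c a S"
  shows "coloured I A c (\<lambda>i. if i \<in> S then a i + t i *s 1 else a i) S"
  unfolding coloured_def
proof
  fix x assume x: "x \<in> S"
  then have "c x \<in> I" "a x \<in> A (c x)"
    using assms(2) by (auto simp: coloured_def)
  moreover from this have "subspace (A (c x))" "1 \<in> A (c x)"
    using assms(1) by (auto simp: unital_subalgebra_def)
  ultimately show "c x \<in> I \<and> (if x \<in> S then a x + t x *s 1 else a x) \<in> A (c x)"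
    using x by (simp add: subspace_add subspace_scale)
qed

lemma free_imp_mixed_kappa_zero:
  assumes \<psi>: "linear_functional scale \<psi>" "\<psi> 1 = 1"
    and A: "\<And>i. i \<in> I \<Longrightarrow> unital_subalgebra scale (A i)"
    and free: "free_subalgebras \<psi> I A"
    and "finite S" "coloured I A c a S" "\<exists>x\<in>S. \<exists>y\<in>S. c x \<noteq> c y"
  shows "kappa \<psi> a S = 0"
  using assms(5-)
proof (induction S arbitrary: a rule: finite_psubset_induct)
  case (psubset S)
  show ?case
  proof (cases "alternating c S")
    case False
    then obtain m p where mp: "m \<in> S" "p \<in> S" "m < p" "c m = c p"
      and gap: "\<And>z. z \<in> S \<Longrightarrow> \<not> (m < z \<and> z < p)"
      unfolding alternating_def by blast
    let ?b = "a(m := a m * a p)"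
    have "kappa \<psi> ?b (S - {p}) = 0"
    proof (rule psubset.IH)
      show "coloured I A c ?b (S - {p})"
        by (rule coloured_merge[OF A psubset.prems(1) mp(1,2,4)])
      obtain x where "x \<in> S" "c x \<noteq> c p"
        using psubset.prems(2) by metis
      then show "\<exists>x\<in>S - {p}. \<exists>y\<in>S - {p}. c x \<noteq> c y"
        using mp by (intro bexI[of _ x] bexI[of _ m]) auto
    qed (use mp in auto)
    \<comment> \<open>\<open>m\<close> and \<open>p\<close> share a colour. If \<open>V\<close> has
      only this colour, every position of another colour lies in the complement together with
      \<open>p\<close>; so one of the factors is a smaller mixed cumulant.\<close>
    moreover have "kappa \<psi> a V * kappa \<psi> a (S - V) = 0" if V: "m \<in> V" "V \<subseteq> S - {p}" for V
    proof (cases "\<exists>x\<in>V. \<exists>y\<in>V. c x \<noteq> c y")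
      case True
      have "kappa \<psi> a V = 0"
        by (rule psubset.IH[OF _ coloured_subset[OF psubset.prems(1)] True]) (use V mp in auto)
      then show ?thesis by simp
    next
      case False
      have "kappa \<psi> a (S - V) = 0"
      proof (rule psubset.IH[OF _ coloured_subset[OF psubset.prems(1)]])
        obtain x where "x \<in> S" "c x \<noteq> c p"
          using psubset.prems(2) by metis
        moreover from this have "x \<notin> V"
          using False V(1) mp(4) by metis
        ultimately show "\<exists>x\<in>S - V. \<exists>y\<in>S - V. c x \<noteq> c y"
          using mp V by (intro bexI[of _ x] bexI[of _ p]) auto
      qed (use V mp in auto)
      then show ?thesis by simp
    qed
    then have "(\<Sum>V | m \<in> V \<and> V \<subseteq> S - {p} \<and> S - V \<subseteq> arc S V m. kappa \<psi> a V * kappa \<psi> a (S - V)) = 0"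
      by (intro sum.neutral) auto
    ultimately show ?thesis
      using kappa_merge[where \<psi> = \<psi> and a = a, OF \<psi>(2) psubset.hyps mp(1-3) gap] by simp
  next
    case alt: True
    \<comment> \<open>As \<open>\<psi> 1 = 1\<close>, this shift by a multiple of 1 centres the
      entry and keeps it in its subalgebra.\<close>
    let ?b = "\<lambda>i. if i \<in> S then a i + (- \<psi> (a i)) *s 1 else a i"
    have two: "S \<noteq> {k}" for k
      using psubset.prems(2) by auto
    have "kappa \<psi> ?b S = kappa \<psi> a S"
    proof (rule centering[where F = "\<lambda>a. kappa \<psi> a S" and S = S])
      show "kappa \<psi> (a(k := x + c *s y)) S = kappa \<psi> (a(k := x)) S + c * kappa \<psi> (a(k := y)) S"
        if "k \<in> S" for a k x c y
        by (rule kappa_linear[OF \<psi> psubset.hyps that])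
      show "kappa \<psi> a S = 0" if "k \<in> S" "a k = 1" for a k
        by (rule kappa_one[where \<psi> = \<psi> and a = a, OF \<psi>(2) psubset.hyps that two])
    qed (use psubset.hyps in auto)
    moreover have "kappa \<psi> ?b S = 0"
    proof -
      have col: "coloured I A c ?b S"
        by (rule coloured_centred[OF A psubset.prems(1)])
      have cent: "\<psi> (?b x) = 0" if "x \<in> S" for x
        using that functional_linear[OF \<psi>(1), of "a x" "- \<psi> (a x)" 1] \<psi>(2) by simp
      \<comment> \<open>Expanding around the first position keeps all arcs from wrapping around, so
        they inherit linear alternation.\<close>
      define p where "p = Min S"
      have p: "p \<in> S" "\<And>x. x \<in> S \<Longrightarrow> p \<le> x"
        using psubset.hyps psubset.prems(2) by (auto simp: p_def intro: Min_in)
      let ?X = "{V. p \<in> V \<and> V \<subseteq> S}"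
      have fin: "finite ?X"
        by (rule finite_subset[of _ "Pow S"]) (use psubset.hyps in auto)
      have "moment \<psi> ?b S = 0"
        by (rule moment_alternating_zero[where \<psi> = \<psi>, OF free psubset.hyps _ col cent alt]) (use p in auto)
      then have "0 = (\<Sum>V\<in>?X. kappa \<psi> ?b V * (\<Prod>v\<in>V. moment \<psi> ?b (arc S V v)))"
        using free_moment_by_block[where \<psi> = \<psi>, OF \<psi>(2) psubset.hyps p(1), of ?b] by simp
      also have "\<dots> = (\<Sum>V\<in>{S}. kappa \<psi> ?b V * (\<Prod>v\<in>V. moment \<psi> ?b (arc S V v)))"
      proof (rule sum.mono_neutral_right[OF fin])
        show "\<forall>V\<in>?X - {S}. kappa \<psi> ?b V * (\<Prod>v\<in>V. moment \<psi> ?b (arc S V v)) = 0"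
        proof
          fix V assume "V \<in> ?X - {S}"
          then have V: "p \<in> V" "V \<subseteq> S" "V \<noteq> S" by auto
          then obtain v where v: "v \<in> V" "arc S V v \<noteq> {}"
            using nonempty_arc[OF psubset.hyps V(2)] by blast
          have "moment \<psi> ?b (arc S V v) = 0"
          proof (rule moment_alternating_zero[where \<psi> = \<psi>, OF free finite_arc[OF psubset.hyps] v(2)])
            show "coloured I A c ?b (arc S V v)"
              by (rule coloured_subset[OF col]) (auto simp: arc_def)
            show "\<psi> (?b x) = 0" if "x \<in> arc S V v" for x
              by (rule cent) (use that in \<open>auto simp: arc_def\<close>)
            show "alternating c (arc S V v)"
              by (rule alternating_arc(2)[OF V(1) p(2) V(2) v(1) alt])
          qed
          then have "(\<Prod>v\<in>V. moment \<psi> ?b (arc S V v)) = 0"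
            using finite_subset[OF V(2) psubset.hyps] v(1) by (intro prod_zero) auto
          then show "kappa \<psi> ?b V * (\<Prod>v\<in>V. moment \<psi> ?b (arc S V v)) = 0"
            by (simp only: mult_zero_right)
        qed
      qed (use p in auto)
      finally show ?thesis
        by (simp add: moment_empty \<psi>(2))
    qed
    ultimately show ?thesis
      by (simp only:)
  qed
qed

text \<open>The induction is on the cardinality, because neighbours of equal colour are first
  rotated to the ends, which replaces \<open>S\<close> by another set of the same size.\<close>

lemma cyclically_free_imp_mixed_Dkappa_zero:
  assumes \<psi>: "linear_functional scale \<psi>" "\<psi> 1 = 1" and \<omega>: "linear_functional scale \<omega>" "tracial \<omega>"
    and A: "\<And>i. i \<in> I \<Longrightarrow> unital_subalgebra scale (A i)"
    and cfree: "cyclically_free \<psi> \<omega> I A"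
    and "finite S" "coloured I A c a S" "\<exists>x\<in>S. \<exists>y\<in>S. c x \<noteq> c y"
  shows "Dkappa \<psi> \<omega> a S = 0"
  using assms(7-)
proof (induction "card S" arbitrary: S a c rule: less_induct)
  case less
  note S = less.prems
  have free: "free_subalgebras \<psi> I A"
    using cfree by (simp add: cyclically_free_def)
  note mixed_kappa = free_imp_mixed_kappa_zero[where \<psi> = \<psi> and I = I and A = A, OF \<psi> A free]
  show ?case
  proof (cases "cyc_alternating c S")
    case False
    then obtain x y where xy: "x \<in> S" "y \<in> S" "x \<noteq> y" "c x = c y" and gap: "\<And>z. z \<in> S \<Longrightarrow> \<not> cyc x z y"
      unfolding cyc_alternating_def by blast
    obtain g b where g: "cyc_preserving g S" "\<And>z. z \<in> S \<Longrightarrow> b (g z) = a z" "\<And>z. z \<in> S \<Longrightarrow> g y \<le> g z"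
      and D: "Dkappa \<psi> \<omega> b (g ` S) = Dkappa \<psi> \<omega> a S"
      using Dkappa_rotate_to_Min[where a = a and \<psi> = \<psi> and \<omega> = \<omega>, OF \<psi>(2) \<omega>(2) S(1) xy(2)] by blast
    have inj: "inj_on g S"
      using g(1) by (simp add: cyc_preserving_def)
    define S' d m p where "S' = g ` S" and "d = c \<circ> the_inv_into S g" and "m = g x" and "p = g y"
    have d: "d (g z) = c z" if "z \<in> S" for z
      using inj that by (simp add: d_def the_inv_into_f_f)
    have fin: "finite S'" and card: "card S' = card S" and mp: "m \<in> S'" "p \<in> S'" "d m = d p"
      using S(1) inj xy d by (auto simp: S'_def m_def p_def card_image)
    have col: "coloured I A d b S'"
      using S(2) g(2) d by (auto simp: coloured_def S'_def)
    have "m \<noteq> p"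
      using inj xy by (auto simp: m_def p_def inj_on_def)
    then have pm: "p < m"
      using g(3)[OF xy(1)] by (simp add: m_def p_def)
    \<comment> \<open>Nothing lies clockwise between \<open>x\<close> and \<open>y\<close>. Once
      \<open>y\<close> has become the first position, this says that \<open>x\<close> has become the
      last.\<close>
    have range: "p \<le> z \<and> z \<le> m" if z: "z \<in> S'" for z
    proof -
      obtain w where w: "w \<in> S" "z = g w"
        using z by (auto simp: S'_def)
      have "\<not> cyc m z p"
        using gap[OF w(1)] cyc_preserving_iff[OF g(1) xy(1) w(1) xy(2)] by (simp add: w m_def p_def)
      then show ?thesis
        using pm g(3)[OF w(1)] by (auto simp: cyc_def w p_def)
    qed
    obtain u where u: "u \<in> S'" "d u \<noteq> d p"
    proof -
      obtain w where "w \<in> S" "c w \<noteq> c y"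
        using S(3) by metis
      then show thesis
        using that[of "g w"] d xy(2) by (simp add: S'_def p_def)
    qed
    let ?b = "b(m := b m * b p)"
    have small: "Dkappa \<psi> \<omega> b V = 0" if "V \<subset> S'" "\<exists>x\<in>V. \<exists>y\<in>V. d x \<noteq> d y" for V
    proof (rule less.hyps[of V d b])
      show "card V < card S"
        using psubset_card_mono[OF fin that(1)] card by simp
      show "finite V" "coloured I A d b V"
        using that(1) fin finite_subset coloured_subset[OF col, of V] by auto
    qed (rule that(2))
    have "Dkappa \<psi> \<omega> ?b (S' - {p}) = 0"
    proof (rule less.hyps[of "S' - {p}" d ?b])
      show "card (S' - {p}) < card S"
        using card_Diff1_less[OF fin mp(2)] card by simp
      show "coloured I A d ?b (S' - {p})"
        by (rule coloured_merge[OF A col mp])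
      show "\<exists>x\<in>S' - {p}. \<exists>y\<in>S' - {p}. d x \<noteq> d y"
        using u mp \<open>m \<noteq> p\<close> by (intro bexI[of _ u] bexI[of _ m]) auto
    qed (use fin in auto)
    moreover have K: "kappa \<psi> b S' = 0"
      by (rule mixed_kappa[OF _ fin col]) (use u mp in auto)
    \<comment> \<open>Formulated with \<open>k\<close> and \<open>l\<close> so that it serves both
      sums of \<open>Dkappa_merge\<close>: \<open>(k, l)\<close> is \<open>(m, p)\<close> in one and
      \<open>(p, m)\<close> in the other.\<close>
    moreover have split: "Dkappa \<psi> \<omega> b V * kappa \<psi> b (S' - V) = 0"
      if V: "V \<subset> S'" "k \<in> V" "l \<in> S' - V" "d k = d p" "d l = d p" for V k l
    proof (cases "\<exists>x\<in>V. \<exists>y\<in>V. d x \<noteq> d y")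
      case True
      with small[OF V(1)] show ?thesis by simp
    next
      case False
      have "u \<notin> V"
        using False V(2,4) u(2) by metis
      then have "\<exists>x\<in>S' - V. \<exists>y\<in>S' - V. d x \<noteq> d y"
        using u V by (intro bexI[of _ u] bexI[of _ l]) auto
      then have "kappa \<psi> b (S' - V) = 0"
        by (intro mixed_kappa[where c = d]) (use fin coloured_subset[OF col, of "S' - V"] in auto)
      then show ?thesis by simp
    qed
    have "(\<Sum>V | m \<in> V \<and> V \<subseteq> S' - {p} \<and> S' - V \<subseteq> arc S' V m. Dkappa \<psi> \<omega> b V * kappa \<psi> b (S' - V)) = 0"
      by (intro sum.neutral ballI split[of _ m p]) (use mp in auto)
    moreover have "(\<Sum>V | p \<in> V \<and> V \<subseteq> S' - {m} \<and> S' - V \<subseteq> {x \<in> S'. \<forall>u\<in>V. u < x}.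
        Dkappa \<psi> \<omega> b V * kappa \<psi> b (S' - V)) = 0"
      by (intro sum.neutral ballI split[of _ p m]) (use mp in auto)
    ultimately have "Dkappa \<psi> \<omega> b S' = 0"
      using Dkappa_merge[where \<psi> = \<psi> and \<omega> = \<omega> and a = b, OF \<psi>(2) \<omega>(2) fin mp(1,2) pm range] by simp
    then show ?thesis
      using D by (simp add: S'_def)
  next
    case alt: True
    let ?b = "\<lambda>i. if i \<in> S then a i + (- \<psi> (a i)) *s 1 else a i"
    have "Dkappa \<psi> \<omega> ?b S = Dkappa \<psi> \<omega> a S"
    proof (rule centering[where F = "\<lambda>a. Dkappa \<psi> \<omega> a S" and S = S])
      show "Dkappa \<psi> \<omega> (a(k := x + c *s y)) S = Dkappa \<psi> \<omega> (a(k := x)) S + c * Dkappa \<psi> \<omega> (a(k := y)) S"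
        if "k \<in> S" for a k x c y
        by (rule Dkappa_linear[OF \<psi> \<omega>(1) S(1) that])
      show "Dkappa \<psi> \<omega> a S = 0" if "k \<in> S" "a k = 1" for a k
        by (rule Dkappa_one[where \<psi> = \<psi> and \<omega> = \<omega> and a = a, OF \<psi>(2) \<omega>(2) S(1) that])
    qed (use S in auto)
    moreover have "Dkappa \<psi> \<omega> ?b S = 0"
    proof -
      have col: "coloured I A c ?b S"
        by (rule coloured_centred[OF A S(2)])
      have cent: "\<psi> (?b x) = 0" if "x \<in> S" for x
        using that functional_linear[OF \<psi>(1), of "a x" "- \<psi> (a x)" 1] \<psi>(2) by simp
      have "moment \<omega> ?b S = 0"
      proof -
        define p m where "p = Min S" and "m = Max S"
        have ne: "S \<noteq> {}"
          using S(3) by auto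
        then have p: "p \<in> S" "\<And>x. x \<in> S \<Longrightarrow> p \<le> x" and m: "m \<in> S" "\<And>x. x \<in> S \<Longrightarrow> x \<le> m"
          using S(1) by (auto simp: p_def m_def)
        have "p \<noteq> m"
        proof
          assume "p = m"
          then have "x = p" if "x \<in> S" for x
            using p(2)[OF that] m(2)[OF that] by simp
          with S(3) show False by metis
        qed
        \<comment> \<open>The last and the first position are neighbours on the circle, so cyclic
          alternation provides the condition on \<open>last\<close> and \<open>hd\<close> in cyclic
          freeness.\<close>
        moreover have "\<not> cyc m z p" if "z \<in> S" for z
          using p(2)[OF that] m(2)[OF that] by (auto simp: cyc_def)
        ultimately have cpm: "c m \<noteq> c p"
          using alt[unfolded cyc_alternating_def, rule_format, of m p] p(1) m(1) by simp
        have "last (slist S) = m"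
          using slist_Max[OF S(1) m] by simp
        moreover have "hd (slist S) = p"
          using slist_Min[OF S(1) p] by simp
        moreover have "slist S \<noteq> []"
          using ne S(1) by simp
        ultimately have "last (map c (slist S)) \<noteq> hd (map c (slist S))"
          using cpm by (simp add: last_map hd_map)
        moreover have "length (map ?b (slist S)) \<ge> 2"
        proof -
          have "card {p, m} \<le> card S"
            by (rule card_mono) (use S(1) p m in auto)
          then show ?thesis
            using \<open>p \<noteq> m\<close> by simp
        qed
        moreover have "arguments_from I A (map c (slist S)) (map ?b (slist S))"
          using col S(1) by (simp only: arguments_from_map set_sorted_list_of_set)
        moreover have "\<forall>x\<in>set (map ?b (slist S)). \<psi> x = 0"
          using cent S(1) by auto
        moreover have "distinct_adj (map c (slist S))"
          by (rule distinct_adj_slist[OF S(1) cyc_alternating_imp_alternating[OF alt]])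
        ultimately show ?thesis
          using cfree unfolding cyclically_free_def moment_def by blast
      qed
      moreover have "moment \<omega> ?b S = \<omega> 1 * cyclic_boolean_on \<psi> ?b S +
          (\<Sum>V\<in>Pow S - {{}}. Dkappa \<psi> \<omega> ?b V * (\<Prod>v\<in>V. cyclic_moment \<psi> ?b v (arc S V v)))"
        by (rule cyclic_moment_by_block[where \<psi> = \<psi>, OF \<psi>(2) S(1)]) (use S(3) in auto)
      moreover have "cyclic_boolean_on \<psi> ?b S = 0"
        by (rule cyclic_boolean_on_zero[where \<psi> = \<psi>, OF \<psi>(2) free S(1) col cent alt])
      moreover have "(\<Sum>V\<in>Pow S - {{}}. Dkappa \<psi> \<omega> ?b V * (\<Prod>v\<in>V. cyclic_moment \<psi> ?b v (arc S V v))) =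
          (\<Sum>V\<in>{S}. Dkappa \<psi> \<omega> ?b V * (\<Prod>v\<in>V. cyclic_moment \<psi> ?b v (arc S V v)))"
      proof (rule sum.mono_neutral_right)
        show "\<forall>V\<in>Pow S - {{}} - {S}. Dkappa \<psi> \<omega> ?b V * (\<Prod>v\<in>V. cyclic_moment \<psi> ?b v (arc S V v)) = 0"
        proof
          fix V assume V: "V \<in> Pow S - {{}} - {S}"
          have "(\<Prod>v\<in>V. cyclic_moment \<psi> ?b v (arc S V v)) = 0"
            by (rule cyclic_moments_arc_zero[where \<psi> = \<psi>, OF free S(1) _ _ _ col cent alt]) (use V in auto)
          then show "Dkappa \<psi> \<omega> ?b V * (\<Prod>v\<in>V. cyclic_moment \<psi> ?b v (arc S V v)) = 0"
            by (simp only: mult_zero_right)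
        qed
      qed (use S in auto)
      ultimately have "0 = (\<Sum>V\<in>{S}. Dkappa \<psi> \<omega> ?b V * (\<Prod>v\<in>V. cyclic_moment \<psi> ?b v (arc S V v)))"
        by (simp only: mult_zero_right add_0)
      \<comment> \<open>All arcs of the full block are empty, so its weight is 1.\<close>
      then show ?thesis
        by (simp add: cyclic_moment_empty \<psi>(2))
    qed
    ultimately show ?thesis
      by (simp only:)
  qed
qed

end

theorem theorem2p9:
  fixes scale :: "complex \<Rightarrow> 'a::ring_1 \<Rightarrow> 'a"
    and \<psi> \<omega> :: "'a \<Rightarrow> complex"
    and I :: "'i set"
    and A :: "'i \<Rightarrow> 'a set"
  assumes "unital_complex_algebra scale"
    and "linear_functional scale \<psi>" and "\<psi> 1 = 1"
    and "linear_functional scale \<omega>" and "tracial \<omega>"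
    and "\<And>i. i \<in> I \<Longrightarrow> unital_subalgebra scale (A i)"
  shows "cyclically_free \<psi> \<omega> I A \<longleftrightarrow>
    mixed_cumulants_vanish (free_cumulant \<psi>) I A \<and>
    mixed_cumulants_vanish (cyclic_free_cumulant \<psi> \<omega>) I A"
proof
  assume cfree: "cyclically_free \<psi> \<omega> I A"
  then have free: "free_subalgebras \<psi> I A"
    by (simp add: cyclically_free_def)
  interpret unital_complex_algebra scale
    by (rule assms(1))
  show "mixed_cumulants_vanish (free_cumulant \<psi>) I A \<and>
      mixed_cumulants_vanish (cyclic_free_cumulant \<psi> \<omega>) I A"
    unfolding mixed_cumulants_vanish_slist kappa_def[symmetric] Dkappa_def[symmetric]
    using free_imp_mixed_kappa_zero[where \<psi> = \<psi> and I = I and A = A, OF assms(2,3,6) free]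
      cyclically_free_imp_mixed_Dkappa_zero[where \<psi> = \<psi> and \<omega> = \<omega> and I = I and A = A, OF assms(2-6) cfree]
    by blast
next
  assume "mixed_cumulants_vanish (free_cumulant \<psi>) I A \<and>
    mixed_cumulants_vanish (cyclic_free_cumulant \<psi> \<omega>) I A"
  then show "cyclically_free \<psi> \<omega> I A"
    using mixed_cumulants_vanish_imp_cyclically_free[where \<psi> = \<psi>, OF assms(3)] by blast
qed

end
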